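(* Let $K$ be a field and let $P=K[a_1,\dots,a_m,x_1,\dots,x_{n-m}]$ (with $0\le m\le n-1$) be non-negatively $\mathbb{Z}$-graded by $W$ such that $P_0=K[a_1,\dots,a_m]$ and $0<\deg_W(x_1)\le\cdots\le\deg_W(x_{n-m})$. Let $X^{+}=(x_1,\dots,x_{n-m})$. Let $g_1,\dots,g_r\in P$ be $W$-homogeneous polynomials of positive $W$-degree, and let $I=\langle g_1,\dots,g_r\rangle$. Assume that there is a number $k$ with $1\le k\le\min\{r,n-m\}$ such that, if we write $g_i=h_{i1}x_1+\cdots+h_{i\,n-m}x_{n-m}+\tilde h_i$ with $h_{ij}\in P_0$ and $\tilde h_i\in\langle X^{+}\rangle^2$ for $i=1,\dots,k$, then the maximal minors of the matrix $A=(h_{ij})\in\mathrm{Mat}_{k,n-m}(P_0)$ generate the unit ideal. Let $g_1,\dots,g_k$ be ordered such that $\deg_W(g_1)\le\cdots\le\deg_W(g_k)$, and let $D=\{\deg_W(x_j)\mid j=1,\dots,n-m\}$. Then the following construction can be carried out. (1) For every $d\in D$, let $x_\alpha,x_{\alpha+1},\dots,x_\beta$ be the indeterminates of degree $d$ in $X^{+}$, let $g_\gamma,\dots,g_\delta$ be the polynomials of degree $d$ among $g_1,\dots,g_k$, let $A_d=(h_{ij})_{\gamma\le i\le\delta,\,\alpha\le j\le\beta}$, let $B_d\in\mathrm{Mat}_{\beta-\alpha+1}(P_0)$ be a matrix which solves the unimodular matrix problem for $A_d$, and let $F_d=(x_\alpha,\dots,x_\beta)\cdot B_d^{\mathrm{tr}}$.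 (If there are no polynomials of degree $d$ among $g_1,\dots,g_k$, let $B_d$ be the identity matrix.) For $i=\gamma,\dots,\delta$ put $\nu_i=\alpha+i-\gamma$. (2) Let $F$ be the concatenation of $(a_1,\dots,a_m)$ and the tuples $F_d$ with $d\in D$ in increasing order, and let $\phi$ be the $K$-algebra endomorphism of $P$ defined by $F$ (i.e., mapping the tuple of indeterminates $(a_1,\dots,a_m,x_1,\dots,x_{n-m})$ to $F$). (3) For $i=1,\dots,k$, write $\phi(g_i)=x_{\nu_i}-q_i$ with $q_i\in P$ such that $x_{\nu_i}$ divides no term in the support of $q_i$. Successively for $i=1,\dots,k$, substitute $x_{\nu_j}\mapsto\tilde q_j$ for $j=1,\dots,i-1$ in $\phi(g_i)$ to obtain a polynomial $x_{\nu_i}-\tilde q_i$. (4) Let $\widehat{X}=\{x_1,\dots,x_{n-m}\}\setminus\{x_{\nu_1},\dots,x_{\nu_k}\}$, and let $\widehat{P}=P_0[\widehat{X}]$ be graded by the restriction $\widehat{W}$ of $W$. Let $\psi:P\to\widehat{P}$ be the $K$-algebra homomorphism with $\psi(a_i)=a_i$ for all $i$, $\psi(x_{\nu_i})=\tilde q_i$ for $i=1,\dots,k$, and $\psi(x_j)=x_j$ for $x_j\in\widehat{X}$. Let $\theta=\psi\circ\phi:P\to\widehat{P}$. Moreover, $\theta$ induces a $K$-algebra isomorphism $\Theta:P/I\to\widehat{P}/J$, where $\widehat{P}=P_0[\widehat{X}]$ is a polynomial ring in $n-k$ indeterminates over $K$ and $J=\langle\theta(g_{k+1}),\dots,\theta(g_r)\rangle$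 is a $\widehat{W}$-homogeneous ideal in $\widehat{P}$.
   Context: Unimodular matrix problem: for a polynomial ring $R$ over a field and $1\le k<\ell$, a matrix $A\in\mathrm{Mat}_{k,\ell}(R)$ is unimodular if its maximal minors generate the unit ideal. A matrix $B\in\mathrm{Mat}_\ell(R)$ solves the unimodular matrix problem (UMP) for $A$ if $\det(B)=1$ and $A\cdot B=(I_k\mid 0)$, where $I_k$ is the identity matrix of size $k$. In the case $k=\ell$ one takes $B=A^{-1}$. "The support" of a polynomial is the set of power products occurring in it with nonzero coefficient. *)

theory Defs
  imports
    "HOL-Library.Poly_Mapping"
    "HOL-Algebra.QuotRing"
    "HOL-Algebra.Ideal_Product"
    "Jordan_Normal_Form.Determinant"
    "Jordan_Normal_Form.DL_Submatrix"
begin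

section \<open>Multivariate polynomials over a field\<close>

text \<open>
  A power product is a finitely supported exponent vector \<open>nat \<Rightarrow>\<^sub>0 nat\<close>; a polynomial assigns
  coefficients to finitely many power products, so its support is \<^const>\<open>Poly_Mapping.keys\<close>.
  The indeterminates are indexed by all of \<open>nat\<close>, and the polynomial ring in the indeterminates
  indexed by \<open>V\<close> is the \<open>HOL-Algebra\<close> ring \<open>mpoly_ring V\<close> below.
\<close>

type_synonym 'a mpoly = "(nat \<Rightarrow>\<^sub>0 nat) \<Rightarrow>\<^sub>0 'a"

definition Var :: "nat \<Rightarrow> 'a::field mpoly" where
  "Var v = Poly_Mapping.single (Poly_Mapping.single v 1) 1"

definition Const :: "'a::field \<Rightarrow> 'a mpoly" where
  "Const c = Poly_Mapping.single 0 c"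

definition vars :: "'a::field mpoly \<Rightarrow> nat set" where
  "vars p = (\<Union>t\<in>Poly_Mapping.keys p. Poly_Mapping.keys t)"

definition mpoly_ring :: "nat set \<Rightarrow> 'a::field mpoly ring" where
  "mpoly_ring V = \<lparr>carrier = {p. vars p \<subseteq> V}, monoid.mult = (*), one = 1, zero = 0, add = (+)\<rparr>"

text \<open>The \<open>K\<close>-algebra endomorphism with \<open>Var v \<mapsto> F v\<close>.\<close>

definition subst :: "(nat \<Rightarrow> 'a::field mpoly) \<Rightarrow> 'a mpoly \<Rightarrow> 'a mpoly" where
  "subst F p = (\<Sum>t\<in>Poly_Mapping.keys p.
     Const (Poly_Mapping.lookup p t) * (\<Prod>v\<in>Poly_Mapping.keys t. F v ^ Poly_Mapping.lookup t v))"

text \<open>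
  Substitution of \<open>q j\<close> for the indeterminate with index \<open>u j\<close>, for all \<open>j < i\<close>; the other
  indeterminates are kept.  The map \<open>u\<close> is meant to be injective on \<open>{..<i}\<close>.
\<close>

definition replace_vars ::
  "(nat \<Rightarrow> nat) \<Rightarrow> (nat \<Rightarrow> 'a::field mpoly) \<Rightarrow> nat \<Rightarrow> 'a mpoly \<Rightarrow> 'a mpoly" where
  "replace_vars u q i =
     subst (\<lambda>v. if v \<in> u ` {..<i} then q (inv_into {..<i} u v) else Var v)"

lemma vars_add: "vars (p + q) \<subseteq> vars p \<union> vars q"
  unfolding vars_def using Poly_Mapping.keys_add[of p q] by blast

lemma vars_mult: "vars (p * q) \<subseteq> vars p \<union> vars q"
proof
  fix v assume "v \<in> vars (p * q)"
  then obtain t where "t \<in> Poly_Mapping.keys (p * q)" "v \<in> Poly_Mapping.keys t"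
    by (auto simp: vars_def)
  with Poly_Mapping.keys_mult[of p q] obtain a b
    where "a \<in> Poly_Mapping.keys p" "b \<in> Poly_Mapping.keys q" "v \<in> Poly_Mapping.keys (a + b)"
    by blast
  with Poly_Mapping.keys_add[of a b] show "v \<in> vars p \<union> vars q"
    by (auto simp: vars_def)
qed

lemma vars_uminus: "vars (- p) = vars p"
  by (simp add: vars_def in_keys_iff)

lemma cring_mpoly_ring: "cring (mpoly_ring V)"
proof (rule cringI)
  have vars_0: "vars (0 :: 'a mpoly) = {}" and vars_1: "vars (1 :: 'a mpoly) = {}"
    by (simp_all add: vars_def)
  show "abelian_group (mpoly_ring V :: 'a mpoly ring)"
  proof (rule abelian_groupI)
    fix p :: "'a mpoly" assume "p \<in> carrier (mpoly_ring V)"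
    then show "\<exists>q\<in>carrier (mpoly_ring V). q \<oplus>\<^bsub>mpoly_ring V\<^esub> p = \<zero>\<^bsub>mpoly_ring V\<^esub>"
      by (intro bexI[of _ "- p"]) (simp_all add: mpoly_ring_def vars_uminus)
  next
    fix p q :: "'a mpoly" assume "p \<in> carrier (mpoly_ring V)" "q \<in> carrier (mpoly_ring V)"
    then show "p \<oplus>\<^bsub>mpoly_ring V\<^esub> q \<in> carrier (mpoly_ring V)"
      using vars_add[of p q] by (auto simp: mpoly_ring_def)
  qed (simp_all add: mpoly_ring_def vars_0 add_ac)
  show "Group.comm_monoid (mpoly_ring V :: 'a mpoly ring)"
  proof (rule Group.comm_monoidI)
    fix p q :: "'a mpoly" assume "p \<in> carrier (mpoly_ring V)" "q \<in> carrier (mpoly_ring V)"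
    then show "p \<otimes>\<^bsub>mpoly_ring V\<^esub> q \<in> carrier (mpoly_ring V)"
      using vars_mult[of p q] by (auto simp: mpoly_ring_def)
  qed (simp_all add: mpoly_ring_def vars_1 mult_ac)
qed (simp add: mpoly_ring_def distrib_right)


section \<open>Algebra homomorphisms\<close>

text \<open>
  A \<open>K\<close>-algebra is a ring \<open>R\<close> together with its structure map \<open>\<iota>\<close> from \<open>K\<close> to \<open>R\<close>.
\<close>

definition alg_hom ::
  "('b, 'm) ring_scheme \<Rightarrow> ('k \<Rightarrow> 'b) \<Rightarrow> ('c, 'n) ring_scheme \<Rightarrow> ('k \<Rightarrow> 'c) \<Rightarrow> ('b \<Rightarrow> 'c) set" where
  "alg_hom R \<iota> S \<kappa> = {f \<in> Ring.ring_hom R S. \<forall>c. f (\<iota> c) = \<kappa> c}"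

definition alg_iso ::
  "('b, 'm) ring_scheme \<Rightarrow> ('k \<Rightarrow> 'b) \<Rightarrow> ('c, 'n) ring_scheme \<Rightarrow> ('k \<Rightarrow> 'c) \<Rightarrow> ('b \<Rightarrow> 'c) set" where
  "alg_iso R \<iota> S \<kappa> = {f \<in> ring_iso R S. \<forall>c. f (\<iota> c) = \<kappa> c}"


section \<open>Gradings\<close>

definition wdeg :: "(nat \<Rightarrow> int) \<Rightarrow> (nat \<Rightarrow>\<^sub>0 nat) \<Rightarrow> int" where
  "wdeg W t = (\<Sum>v\<in>Poly_Mapping.keys t. W v * int (Poly_Mapping.lookup t v))"

definition homogeneous :: "(nat \<Rightarrow> int) \<Rightarrow> int \<Rightarrow> 'a::field mpoly \<Rightarrow> bool" where
  "homogeneous W d p \<longleftrightarrow> (\<forall>t\<in>Poly_Mapping.keys p. wdeg W t = d)"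

definition graded_part ::
  "('a::field mpoly, 'm) ring_scheme \<Rightarrow> (nat \<Rightarrow> int) \<Rightarrow> int \<Rightarrow> 'a mpoly set" where
  "graded_part R W d = {p \<in> carrier R. homogeneous W d p}"

definition hcomp :: "(nat \<Rightarrow> int) \<Rightarrow> int \<Rightarrow> 'a::field mpoly \<Rightarrow> 'a mpoly" where
  "hcomp W d p = (\<Sum>t\<in>{t \<in> Poly_Mapping.keys p. wdeg W t = d}.
     Poly_Mapping.single t (Poly_Mapping.lookup p t))"

definition homogeneous_ideal ::
  "('a::field mpoly, 'm) ring_scheme \<Rightarrow> (nat \<Rightarrow> int) \<Rightarrow> 'a mpoly set \<Rightarrow> bool" where
  "homogeneous_ideal R W J \<longleftrightarrow> ideal J R \<and> (\<forall>p\<in>J. \<forall>d. hcomp W d p \<in> J)"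


section \<open>The unimodular matrix problem\<close>

definition maximal_minors :: "'a::field mpoly mat \<Rightarrow> 'a mpoly set" where
  "maximal_minors A =
     {det (submatrix A {..<dim_row A} J) | J. J \<subseteq> {..<dim_col A} \<and> card J = dim_row A}"

definition unimodular :: "('a::field mpoly, 'm) ring_scheme \<Rightarrow> 'a mpoly mat \<Rightarrow> bool" where
  "unimodular R A \<longleftrightarrow>
     elements_mat A \<subseteq> carrier R \<and> genideal R (maximal_minors A) = carrier R"

text \<open>
  In the square case the solution is \<open>A\<^sup>-\<^sup>1\<close>, whose determinant may be a unit other than 1.
\<close>

definition solves_UMP ::
  "('a::field mpoly, 'm) ring_scheme \<Rightarrow> 'a mpoly mat \<Rightarrow> 'a mpoly mat \<Rightarrow> bool" where
  "solves_UMP R A B \<longleftrightarrow>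
     B \<in> carrier_mat (dim_col A) (dim_col A) \<and> elements_mat B \<subseteq> carrier R \<and>
     (if dim_row A = dim_col A then inverts_mat A B \<and> inverts_mat B A
      else det B = 1 \<and>
           A * B = mat (dim_row A) (dim_col A) (\<lambda>(i, j). if i = j then 1 else 0))"


section \<open>Blocks of equal degree\<close>

text \<open>
  If \<open>u 0 \<le> \<dots> \<le> u (N - 1)\<close>, the indices \<open>j < N\<close> with \<open>u j = d\<close> are the \<open>block_size u N d\<close>
  consecutive ones that start at \<open>block_start u N d\<close>, see \<open>block_eq\<close>.
\<close>

definition block_start :: "(nat \<Rightarrow> int) \<Rightarrow> nat \<Rightarrow> int \<Rightarrow> nat" where
  "block_start u N d = (LEAST j. j < N \<and> u j = d)"

definition block_size :: "(nat \<Rightarrow> int) \<Rightarrow> nat \<Rightarrow> int \<Rightarrow> nat" where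
  "block_size u N d = card {j. j < N \<and> u j = d}"

lemma block_eq:
  assumes u: "mono_on {..<N} u" and ne: "\<exists>j<N. u j = d"
  shows "{j. j < N \<and> u j = d} = {block_start u N d..<block_start u N d + block_size u N d}"
proof -
  let ?S = "{j. j < N \<and> u j = d}" and ?a = "block_start u N d"
  have fin: "finite ?S" by simp
  have neS: "?S \<noteq> {}" using ne by auto
  have a: "?a < N \<and> u ?a = d"
    unfolding block_start_def using ne by (auto intro: LeastI2_ex)
  define b where "b = Max ?S"
  have b: "b < N \<and> u b = d" using Max_in[OF fin neS] by (simp add: b_def)
  have "?S = {?a..b}"
  proof (intro subset_antisym subsetI)
    fix j assume "j \<in> ?S"
    then show "j \<in> {?a..b}"
      using Max_ge[OF fin] by (auto simp: block_start_def b_def intro: Least_le)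
  next
    fix j assume j: "j \<in> {?a..b}"
    then have "j < N" using b by auto
    then show "j \<in> ?S"
      using j a b mono_onD[OF u, of ?a j] mono_onD[OF u, of j b] by auto
  qed
  then have S: "?S = {?a..<Suc b}" by (simp add: atLeastLessThanSuc_atLeastAtMost)
  then have "block_size u N d = Suc b - ?a"
    unfolding block_size_def by (simp only: card_atLeastLessThan)
  moreover have "?a \<le> b" using a fin unfolding b_def by (intro Max_ge) auto
  ultimately have "?a + block_size u N d = Suc b" by linarith
  with S show ?thesis by (simp only:)
qed


section \<open>The tuple defining the linear change of coordinates\<close>

text \<open>The row vector \<open>(X\<^sub>\<alpha>, \<dots>, X\<^sub>\<alpha>\<^sub>+\<^sub>s\<^sub>-\<^sub>1) \<cdot> B\<^sup>t\<^sup>r\<close>, where \<open>X\<^sub>v = Var v\<close>.\<close>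

definition block_tuple :: "nat \<Rightarrow> nat \<Rightarrow> 'a::field mpoly mat \<Rightarrow> 'a mpoly list" where
  "block_tuple \<alpha> s B =
     list_of_vec (row (mat 1 s (\<lambda>(_, j). Var (\<alpha> + j)) * transpose_mat B) 0)"

end

theory Submission
  imports Defs "Jordan_Normal_Form.Char_Poly"
begin

text \<open>
  By homogeneity the matrix of linear parts is block diagonal, with one block per degree. It has a
  right inverse, hence so has every block, and the solvability of the unimodular matrix problem for
  the blocks is the Quillen--Suslin theorem. The latter is proved along the lines of Suslin and
  Vaserstein: a unimodular row over \<open>R[X]\<close> with an entry that has an invertible leading coefficient
  is equivalent to its value at \<open>0\<close>, because the constants \<open>c\<close> such that \<open>F(a) ~ F(b)\<close> whenever
  \<open>c\<close> divides \<open>b - a\<close> form an ideal that lies in no maximal ideal; a change of variables makes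
  an entry monic up to a unit, and one inducts on the number of indeterminates.

  After the linear change of coordinates \<open>\<phi>\<close>, every \<open>\<phi>(g\<^sub>i)\<close> with \<open>i < k\<close> is an indeterminate
  minus a polynomial in indeterminates of smaller degree, so that the elimination is triangular.
  Modulo \<open>\<phi>(I)\<close> every polynomial is congruent to its image under \<open>\<psi>\<close>; this yields the kernel
  of \<open>P \<rightarrow> P\<^sub>h/J\<close>.
\<close>

section \<open>Completion of unimodular rows\<close>

text \<open>The coefficient ring R is neither local nor Euclidean. Both defects are overcome by one
  computation per maximal ideal M: modulo M a row can be brought to a shape with at most two nonzero
  entries, and the two lifted entries generate an ideal of R[X] that contains a constant r with 1 -
  r in M. For these two entries the passage from the argument a to the argument b is an explicit 2x2
  matrix of determinant 1, provided that r divides b - a; dividing by r is the reason for working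
  over integral domains. Comparing the arguments X and 0 then removes an indeterminate.

  Matrices and univariate polynomials live over the whole type \<open>'a mpoly\<close>; the carriers
  of the statement enter only at the end of the matrix part. The elimination is done for an
  arbitrary family \<open>B\<close> of solutions, as the theorem claims it for each of them;
  Quillen--Suslin guarantees that there is one. In the square case a solution is the inverse of the
  block, whose determinant may be any unit, so the elimination relies on the invertibility of
  \<open>B\<close> over P_0 and on the shape of the products with the blocks.\<close>

definition sl_equiv :: "nat \<Rightarrow> (nat \<Rightarrow> 'r::comm_ring_1) \<Rightarrow> (nat \<Rightarrow> 'r) \<Rightarrow> bool" where
  "sl_equiv n f g \<longleftrightarrow> (\<exists>B\<in>carrier_mat n n. det B = 1 \<and> B *\<^sub>v vec n f = vec n g)"

lemma sl_equiv_cong: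
  "(\<And>i. i < n \<Longrightarrow> f i = f' i) \<Longrightarrow> (\<And>i. i < n \<Longrightarrow> g i = g' i) \<Longrightarrow> sl_equiv n f g \<longleftrightarrow> sl_equiv n f' g'"
proof -
  assume "\<And>i. i < n \<Longrightarrow> f i = f' i" "\<And>i. i < n \<Longrightarrow> g i = g' i"
  then have "vec n f = vec n f'" "vec n g = vec n g'" by auto
  then show ?thesis by (simp add: sl_equiv_def)
qed

lemma sl_equiv_refl: "sl_equiv n f f"
  unfolding sl_equiv_def by (rule bexI[of _ "1\<^sub>m n"]) auto

lemma sl_equiv_sym:
  assumes "sl_equiv n f g"
  shows "sl_equiv n g f"
proof -
  from assms obtain B where B: "B \<in> carrier_mat n n" "det B = 1" "B *\<^sub>v vec n f = vec n g"
    by (auto simp: sl_equiv_def)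
  let ?C = "adj_mat B"
  have C: "?C \<in> carrier_mat n n" and CB: "?C * B = 1\<^sub>m n"
    using adj_mat[OF B(1)] B(2) by auto
  have "det ?C * det B = 1" using det_mult[OF C B(1)] CB by simp
  then have "det ?C = 1" using B(2) by simp
  moreover have "?C *\<^sub>v vec n g = vec n f"
    using assoc_mult_mat_vec[OF C B(1), of "vec n f"] CB B(3) by auto
  ultimately show ?thesis using C by (auto simp: sl_equiv_def)
qed

lemma sl_equiv_trans:
  assumes "sl_equiv n f g" "sl_equiv n g h"
  shows "sl_equiv n f h"
proof -
  from assms obtain B C where B: "B \<in> carrier_mat n n" "det B = 1" "B *\<^sub>v vec n f = vec n g"
    and C: "C \<in> carrier_mat n n" "det C = 1" "C *\<^sub>v vec n g = vec n h"
    by (auto simp: sl_equiv_def)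
  have "C * B \<in> carrier_mat n n" using B C by auto
  moreover have "det (C * B) = 1" using det_mult[OF C(1) B(1)] B C by simp
  moreover have "(C * B) *\<^sub>v vec n f = vec n h"
    using assoc_mult_mat_vec[OF C(1) B(1), of "vec n f"] B C by auto
  ultimately show ?thesis by (auto simp: sl_equiv_def)
qed

lemma sl_equiv_hom:
  assumes "comm_ring_hom H" "sl_equiv n f g"
  shows "sl_equiv n (\<lambda>i. H (f i)) (\<lambda>i. H (g i))"
proof -
  interpret comm_ring_hom H by fact
  from assms(2) obtain B where B: "B \<in> carrier_mat n n" "det B = 1" "B *\<^sub>v vec n f = vec n g"
    by (auto simp: sl_equiv_def)
  have *: "map_vec H (vec n u) = vec n (\<lambda>i. H (u i))" for u by auto
  have "map_mat H B *\<^sub>v vec n (\<lambda>i. H (f i)) = vec n (\<lambda>i. H (g i))"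
    using mult_mat_vec_hom[OF B(1), of "vec n f"] B(3) by (simp add: *)
  moreover have "det (map_mat H B) = 1" using B(2) by (simp add: hom_det)
  ultimately show ?thesis using B(1) unfolding sl_equiv_def by (intro bexI[of _ "map_mat H B"]) auto
qed

lemma sl_equiv_add:
  assumes "i < n" "j < n" "i \<noteq> j"
  shows "sl_equiv n f (f(i := f i + c * f j))"
proof -
  have "addrow_mat n c i j *\<^sub>v vec n f = vec n (f(i := f i + c * f j))"
  proof (rule eq_vecI)
    fix k assume "k < dim_vec (vec n (f(i := f i + c * f j)))"
    then have k: "k < n" by simp
    show "(addrow_mat n c i j *\<^sub>v vec n f) $ k = vec n (f(i := f i + c * f j)) $ k"
    proof (cases "k = i")
      case True
      have "(c \<cdot>\<^sub>v unit_vec n j + unit_vec n i) \<bullet> vec n f = c * f j + f i"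
        using assms by (subst add_scalar_prod_distrib[of _ n]) auto
      then show ?thesis using True k assms by (simp add: row_addrow algebra_simps)
    qed (use k assms in \<open>simp add: row_addrow\<close>)
  qed simp
  moreover have "det (addrow_mat n c i j) = 1" using assms by (simp add: det_addrow_mat)
  ultimately show ?thesis unfolding sl_equiv_def by (intro bexI[of _ "addrow_mat n c i j"]) auto
qed

text \<open>The pivot \<open>f j\<close> lies outside \<open>S\<close> and stays fixed, so the
  elementary operations can be performed one after another and the coefficients \<open>c\<close> may
  be read off from \<open>f\<close> itself.\<close>

lemma sl_equiv_clear:
  assumes "finite S" "S \<subseteq> {..<n}" "j < n" "j \<notin> S"
  shows "sl_equiv n f (\<lambda>i. if i \<in> S then f i + c i * f j else f i)"
  using assms
proof (induction S rule: finite_induct)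
  case (insert i S)
  let ?g = "\<lambda>k. if k \<in> S then f k + c k * f j else f k"
  have "?g(i := ?g i + c i * ?g j) = (\<lambda>k. if k \<in> insert i S then f k + c k * f j else f k)"
    using insert.hyps insert.prems by (intro ext) simp
  moreover have "sl_equiv n ?g (?g(i := ?g i + c i * ?g j))"
    by (rule sl_equiv_add) (use insert.prems in auto)
  ultimately have "sl_equiv n ?g (\<lambda>k. if k \<in> insert i S then f k + c k * f j else f k)"
    by (simp only:)
  moreover have "sl_equiv n f ?g" by (rule insert.IH) (use insert.prems in auto)
  ultimately show ?case by (rule sl_equiv_trans[rotated])
qed (simp add: sl_equiv_refl)

text \<open>A transposition has determinant -1, whence the sign; three elementary operations produce
  the signed version.\<close>

lemma sl_equiv_swap:
  assumes "i < n" "j < n" "i \<noteq> j"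
  shows "sl_equiv n f (f(i := f j, j := - f i))"
proof -
  let ?f1 = "f(i := f i + 1 * f j)"
  let ?f2 = "?f1(j := ?f1 j + (-1) * ?f1 i)"
  let ?f3 = "?f2(i := ?f2 i + 1 * ?f2 j)"
  have "sl_equiv n f ?f1" by (rule sl_equiv_add; rule assms)
  also have "sl_equiv n ?f1 ?f2"
    by (rule sl_equiv_add) (use assms in auto)
  also (sl_equiv_trans) have "sl_equiv n ?f2 ?f3" by (rule sl_equiv_add; rule assms)
  finally (sl_equiv_trans) have "sl_equiv n f ?f3" .
  moreover have "?f3 = f(i := f j, j := - f i)" using assms by (auto simp: fun_eq_iff)
  ultimately show ?thesis by simp
qed

text \<open>Every \<open>f i\<close> is a combination of the \<open>g j\<close>, so a relation for
  \<open>f\<close> turns into one for \<open>g\<close>.\<close>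

lemma sl_equiv_unimodular:
  assumes "sl_equiv n f g" "(\<Sum>i<n. u i * f i) = 1"
  obtains v where "(\<Sum>i<n. v i * g i) = 1"
proof -
  from sl_equiv_sym[OF assms(1)] obtain B where
    B: "B \<in> carrier_mat n n" "B *\<^sub>v vec n g = vec n f" by (auto simp: sl_equiv_def)
  have f: "f i = (\<Sum>j<n. B $$ (i,j) * g j)" if "i < n" for i
  proof -
    have "f i = (B *\<^sub>v vec n g) $ i" using B(2) that by simp
    also have "\<dots> = (\<Sum>j<n. B $$ (i,j) * g j)"
      using B(1) that by (auto simp: scalar_prod_def atLeast0LessThan intro!: sum.cong)
    finally show ?thesis .
  qed
  have "(\<Sum>j<n. (\<Sum>i<n. u i * B $$ (i,j)) * g j) = (\<Sum>i<n. u i * f i)"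
    unfolding sum_distrib_right by (subst sum.swap) (simp add: f sum_distrib_left mult.assoc)
  with assms(2) show ?thesis by (intro that) simp
qed

lemma det_two_by_two:
  assumes "A \<in> carrier_mat 2 2"
  shows "det A = A $$ (0,0) * A $$ (1,1) - A $$ (0,1) * A $$ (1,0)"
proof -
  have "det A = (\<Sum>i<2. A $$ (i,0) * cofactor A i 0)"
    by (rule laplace_expansion_column[OF assms]) simp
  also have "\<dots> = A $$ (0,0) * A $$ (1,1) - A $$ (0,1) * A $$ (1,0)"
    using assms
    by (simp add: numeral_2_eq_2 cofactor_def det_single mat_delete_def)
  finally show ?thesis .
qed

lemma sl_equiv_two:
  fixes f :: "nat \<Rightarrow> 'r::idom"
  assumes n: "2 \<le> n" and det: "a * d - b * c = 1"
  shows "sl_equiv n f (f(0 := a * f 0 + b * f 1, 1 := c * f 0 + d * f 1))"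
proof -
  define S where "S = mat 2 2 (\<lambda>(i,j). if i = 0 then if j = 0 then a else b else if j = (0::nat) then c else d)"
  let ?I = "1\<^sub>m (n - 2) :: 'r mat"
  define B where "B = four_block_mat S (0\<^sub>m 2 (n - 2)) (0\<^sub>m (n - 2) 2) ?I"
  have S: "S \<in> carrier_mat 2 2" by (simp add: S_def)
  have "B \<in> carrier_mat (2 + (n - 2)) (2 + (n - 2))"
    unfolding B_def by (rule four_block_carrier_mat) (auto simp: S)
  then have B: "B \<in> carrier_mat n n" using le_add_diff_inverse[OF n] by (simp only:)
  have "det B = det S * det ?I"
    unfolding B_def by (rule det_four_block_mat_upper_right_zero[OF S]) auto
  then have "det B = 1" using det det_two_by_two[OF S] by (simp add: S_def)
  moreover have "B *\<^sub>v vec n f = vec n (f(0 := a * f 0 + b * f 1, 1 := c * f 0 + d * f 1))"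
  proof (rule eq_vecI)
    fix i assume "i < dim_vec (vec n (f(0 := a * f 0 + b * f 1, 1 := c * f 0 + d * f 1)))"
    then have i: "i < n" by simp
    have Bij: "B $$ (i, j) = (if i = 0 then if j = 0 then a else if j = 1 then b else 0
        else if i = 1 then if j = 0 then c else if j = 1 then d else 0
        else if i = j then 1 else 0)" if "j < n" for j
      using that i n by (auto simp: B_def S_def)
    have "(B *\<^sub>v vec n f) $ i = (\<Sum>j<n. B $$ (i,j) * f j)"
      using B i by (auto simp: scalar_prod_def atLeast0LessThan intro!: sum.cong)
    \<comment> \<open>Row \<open>i\<close> of \<open>B\<close> is supported in the columns 0, 1 and
      \<open>i\<close>.\<close>
    also have "\<dots> = (\<Sum>j\<in>insert 0 (insert 1 ({..<n} \<inter> {i})). B $$ (i,j) * f j)"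
      by (rule sum.mono_neutral_right) (use n i in \<open>auto simp: Bij\<close>)
    also have "\<dots> = vec n (f(0 := a * f 0 + b * f 1, 1 := c * f 0 + d * f 1)) $ i"
      using i n Bij[of 0] Bij[of 1] Bij[of i] by (cases "i = 0"; cases "i = 1") (auto simp: insert_commute simp del: One_nat_def)
    finally show "(B *\<^sub>v vec n f) $ i = \<dots>" .
  qed (use B in auto)
  ultimately show ?thesis using B unfolding sl_equiv_def by blast
qed

lemma sl_equiv_unit:
  assumes n: "2 \<le> n" and j: "j < n" "f j * u = 1"
  shows "sl_equiv n f (\<lambda>i. if i = 0 then 1 else 0)"
proof -
  have *: "sl_equiv n f (\<lambda>i. if i = 0 then 1 else 0)" if j: "0 < j" "j < n" "f j * u = 1" for f u j
  proof -
    \<comment> \<open>The unit \<open>f j\<close> changes entry 0 into 1, which then clears all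
      other entries.\<close>
    let ?g = "f(0 := f 0 + (1 - f 0) * u * f j)"
    have "(1 - f 0) * u * f j = (1 - f 0) * (f j * u)" by (simp only: mult_ac)
    then have g0: "?g 0 = 1" using j by simp
    have "sl_equiv n f ?g" by (rule sl_equiv_add) (use j in auto)
    moreover have "sl_equiv n ?g (\<lambda>i. if i \<in> {1..<n} then ?g i + - ?g i * ?g 0 else ?g i)"
      by (rule sl_equiv_clear) (use j in auto)
    moreover have "sl_equiv n f (\<lambda>i. if i \<in> {1..<n} then ?g i + - ?g i * ?g 0 else ?g i) \<longleftrightarrow>
        sl_equiv n f (\<lambda>i. if i = 0 then 1 else 0)"
      by (rule sl_equiv_cong) (use g0 in auto)
    ultimately show ?thesis by (blast intro: sl_equiv_trans)
  qed
  show ?thesis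
  proof (cases "j = 0")
    case True
    \<comment> \<open>Entry 0 cannot be its own pivot; it first turns entry 1 into the unit 1, which
      leads back to the other case.\<close>
    let ?g = "f(1 := f 1 + (1 - f 1) * u * f 0)"
    have "sl_equiv n f ?g" by (rule sl_equiv_add) (use n in auto)
    moreover have "(1 - f 1) * u * f 0 = (1 - f 1) * (f j * u)" using True by (simp only: mult_ac)
    then have "?g 1 * 1 = 1" using j by simp
    then have "sl_equiv n ?g (\<lambda>i. if i = 0 then 1 else 0)" by (rule *[rotated 2]) (use n in auto)
    ultimately show ?thesis by (rule sl_equiv_trans)
  qed (use * j in blast)
qed

section \<open>Ideals of a whole type and division of polynomials\<close>

definition type_ideal :: "'r::comm_ring_1 set \<Rightarrow> bool" where
  "type_ideal M \<longleftrightarrow> 0 \<in> M \<and> (\<forall>x\<in>M. \<forall>y\<in>M. x + y \<in> M) \<and> (\<forall>x\<in>M. \<forall>c. c * x \<in> M)"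

text \<open>The last clause gives every \<open>c\<close> outside \<open>M\<close> an inverse
  \<open>d\<close> modulo \<open>M\<close>, so that divisions in the field R/M can be done on
  representatives.\<close>

definition type_maximal :: "'r::comm_ring_1 set \<Rightarrow> bool" where
  "type_maximal M \<longleftrightarrow> type_ideal M \<and> 1 \<notin> M \<and> (\<forall>c. c \<notin> M \<longrightarrow> (\<exists>d. 1 - d * c \<in> M))"

lemma sum_const_poly: "(\<Sum>i\<in>S. [:f i:]) = [:\<Sum>i\<in>S. f i:]"
  by (induction S rule: infinite_finite_induct) auto

context
  fixes M :: "'r::comm_ring_1 set"
  assumes M: "type_ideal M"
begin

lemma type_ideal_0: "0 \<in> M" using M by (simp add: type_ideal_def)
lemma type_ideal_add: "x \<in> M \<Longrightarrow> y \<in> M \<Longrightarrow> x + y \<in> M" using M by (simp add: type_ideal_def)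
lemma type_ideal_mult: "x \<in> M \<Longrightarrow> c * x \<in> M" using M by (simp add: type_ideal_def)
lemma type_ideal_mult_right: "x \<in> M \<Longrightarrow> x * c \<in> M" using type_ideal_mult[of x c] by (simp add: mult.commute)
lemma type_ideal_uminus: "x \<in> M \<Longrightarrow> - x \<in> M" using type_ideal_mult[of x "-1"] by simp
lemma type_ideal_diff: "x \<in> M \<Longrightarrow> y \<in> M \<Longrightarrow> x - y \<in> M"
  using type_ideal_add[of x "- y"] type_ideal_uminus by simp
lemma type_ideal_sum: "(\<And>i. i \<in> S \<Longrightarrow> f i \<in> M) \<Longrightarrow> sum f S \<in> M"
  by (induction S rule: infinite_finite_induct) (auto intro: type_ideal_0 type_ideal_add)

lemma type_ideal_prod_cong:
  "(\<And>i. i \<in> S \<Longrightarrow> f i - g i \<in> M) \<Longrightarrow> prod f S - prod g S \<in> M"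
proof (induction S rule: infinite_finite_induct)
  case (insert i S)
  have "f i * prod f S - g i * prod g S = f i * (prod f S - prod g S) + (f i - g i) * prod g S"
    by (simp add: algebra_simps)
  moreover have "f i * (prod f S - prod g S) \<in> M" using insert by (intro type_ideal_mult) auto
  moreover have "(f i - g i) * prod g S \<in> M" using insert by (intro type_ideal_mult_right) auto
  ultimately show ?case using insert.hyps type_ideal_add by auto
qed (auto intro: type_ideal_0)

lemma det_cong_ideal:
  assumes A: "A \<in> carrier_mat n n" and B: "B \<in> carrier_mat n n"
    and AB: "\<And>i j. i < n \<Longrightarrow> j < n \<Longrightarrow> A $$ (i,j) - B $$ (i,j) \<in> M"
  shows "det A - det B \<in> M"
proof -
  have "det A - det B = (\<Sum>p | p permutes {0..<n}.
      signof p * ((\<Prod>i = 0..<n. A $$ (i, p i)) - (\<Prod>i = 0..<n. B $$ (i, p i))))"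
    by (simp add: det_def'[OF A] det_def'[OF B] sum_subtractf right_diff_distrib)
  also have "\<dots> \<in> M"
  proof (rule type_ideal_sum, rule type_ideal_mult, rule type_ideal_prod_cong)
    fix p i assume "p \<in> {p. p permutes {0..<n}}" "i \<in> {0..<n}"
    then show "A $$ (i, p i) - B $$ (i, p i) \<in> M"
      using AB[of i "p i"] permutes_in_image[of p "{0..<n}" i] by auto
  qed
  finally show ?thesis .
qed

text \<open>Each term of the quotient is a multiple of a coefficient of the current dividend, so
  long division never leaves \<open>M\<close>. The bound \<open>N\<close> on the degree of the
  dividend drives the induction.\<close>

lemma division_ideal:
  fixes p :: "'r poly"
  assumes l: "lead_coeff p * l = 1" and w: "\<And>i. coeff w i \<in> M" and N: "\<And>i. i \<ge> N \<Longrightarrow> coeff w i = 0"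
  shows "\<exists>s t. w = p * s + t \<and> (\<forall>i\<ge>degree p. coeff t i = 0) \<and> (\<forall>i. coeff t i \<in> M)"
  using w N
proof (induction N arbitrary: w)
  case 0
  then show ?case by (intro exI[of _ 0] exI[of _ w]) auto
next
  case (Suc N)
  show ?case
  proof (cases "N < degree p")
    case True
    with Suc.prems show ?thesis by (intro exI[of _ 0] exI[of _ w]) auto
  next
    case False
    \<comment> \<open>Multiplying by \<open>l\<close> divides by the leading coefficient of
      \<open>p\<close>, so that \<open>m * p\<close> cancels the coefficient of index
      \<open>N\<close>.\<close>
    define c where "c = l * coeff w N"
    define m where "m = Polynomial.monom c (N - degree p)"
    have cM: "c \<in> M" using Suc.prems(1) type_ideal_mult by (simp add: c_def)
    have co: "coeff (w - m * p) i = coeff w i - (if N - degree p \<le> i then c * coeff p (i - (N - degree p)) else 0)" for i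
      by (simp add: m_def coeff_monom_mult)
    have "coeff (w - m * p) i = 0" if "i \<ge> N" for i
    proof (cases "i = N")
      case True
      have "N - (N - degree p) = degree p" using False by simp
      then have "coeff (w - m * p) i = coeff w N - c * lead_coeff p"
        using True unfolding co by simp
      also have "c * lead_coeff p = coeff w N * (lead_coeff p * l)" by (simp add: c_def algebra_simps)
      finally show ?thesis using l by simp
    next
      case i: False
      then have "coeff p (i - (N - degree p)) = 0" using that False by (intro coeff_eq_0) simp
      with i that Suc.prems(2)[of i] show ?thesis unfolding co by simp
    qed
    moreover have "coeff (w - m * p) i \<in> M" for i
      unfolding co using Suc.prems(1)[of i] cM
      by (auto intro!: type_ideal_diff type_ideal_mult_right type_ideal_0)
    ultimately obtain s t where "w - m * p = p * s + t" and t: "\<forall>i\<ge>degree p. coeff t i = 0" "\<forall>i. coeff t i \<in> M"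
      using Suc.IH[of "w - m * p"] by blast
    then have "w = p * (s + m) + t" by (simp add: algebra_simps)
    with t show ?thesis by blast
  qed
qed

text \<open>
  The determinant trick: modulo \<open>(p, q)\<close> the powers \<open>1, X, \<dots>, X\<^sup>d\<^sup>-\<^sup>1\<close> with \<open>d = degree p\<close> are killed by a
  matrix that is congruent to the identity modulo \<open>M\<close>; its determinant is the constant sought.
\<close>

lemma constant_in_ideal:
  fixes p q :: "'r poly"
  assumes l: "lead_coeff p * l = 1" and z: "\<And>i. coeff z i \<in> M" and pq: "u * p + v * q + z = 1"
  shows "\<exists>r a b. [:r:] = a * p + b * q \<and> 1 - r \<in> M"
proof (cases "degree p = 0")
  case True
  then obtain c where "p = [:c:]" by (metis degree_eq_zeroE)
  \<comment> \<open>A constant \<open>p\<close> is a unit, so \<open>r = 1\<close> works.\<close>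
  with l have "[:1:] = [:l:] * p + 0 * q" by (simp add: mult.commute)
  then show ?thesis using type_ideal_0 by (metis diff_self)
next
  case d: False
  let ?d = "degree p" and ?X = "\<lambda>i. Polynomial.monom (1::'r) i"
  have zX: "coeff (?X i * z) j \<in> M" for i j
    using z by (simp add: coeff_monom_mult type_ideal_0)
  have "\<exists>s t. ?X i * z = p * s + t \<and> (\<forall>j\<ge>?d. coeff t j = 0) \<and> (\<forall>j. coeff t j \<in> M)" for i
    by (rule division_ideal[OF l zX, of "Suc (degree (?X i * z))"]) (auto intro: coeff_eq_0)
  then obtain s t where st: "\<And>i. ?X i * z = p * s i + t i"
    and t0: "\<And>i j. j \<ge> ?d \<Longrightarrow> coeff (t i) j = 0" and tM: "\<And>i j. coeff (t i) j \<in> M" by metis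
  \<comment> \<open>Since \<open>z = 1 - u * p - v * q\<close>, the division of \<open>X^i z\<close>
    by \<open>p\<close> with remainder \<open>t i\<close> makes \<open>X^i - t i\<close> a
    combination of \<open>p\<close> and \<open>q\<close>; row \<open>i\<close> of \<open>A\<close>
    lists its coefficients.\<close>
  define A where "A = mat ?d ?d (\<lambda>(i,j). (if i = j then 1 else 0) - coeff (t i) j)"
  have A: "A \<in> carrier_mat ?d ?d" by (simp add: A_def)
  define C where "C = adj_mat A"
  have C: "C \<in> carrier_mat ?d ?d" and CA: "C * A = det A \<cdot>\<^sub>m 1\<^sub>m ?d"
    using adj_mat[OF A] by (auto simp: C_def)
  have t: "t i = (\<Sum>j<?d. [:coeff (t i) j:] * ?X j)" for i
  proof (rule poly_eqI)
    fix k
    show "coeff (t i) k = coeff (\<Sum>j<?d. [:coeff (t i) j:] * ?X j) k"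
      using t0[of k i] by (simp add: coeff_sum if_distrib[of "(*) _"] cong: if_cong)
  qed
  have row: "(\<Sum>j<?d. [:A $$ (i,j):] * ?X j) = (?X i * u + s i) * p + (?X i * v) * q" if i: "i < ?d" for i
  proof -
    have "(\<Sum>j<?d. [:A $$ (i,j):] * ?X j) = (\<Sum>j<?d. (if i = j then ?X j else 0)) - (\<Sum>j<?d. [:coeff (t i) j:] * ?X j)"
      unfolding sum_subtractf[symmetric] using i
      by (intro sum.cong) (auto simp: A_def smult_diff_left)
    also have "\<dots> = ?X i - t i" using i t[of i] by simp
    also have "t i = ?X i * z - p * s i" using st[of i] by simp
    also have "z = 1 - u * p - v * q" using pq by (simp add: algebra_simps)
    finally show ?thesis by (simp add: algebra_simps)
  qed
  \<comment> \<open>Row 0 of the adjugate isolates the power \<open>X^0 = 1\<close>, so this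
    combination of \<open>p\<close> and \<open>q\<close> is the constant
    \<open>det A\<close>.\<close>
  define a where "a = (\<Sum>i<?d. [:C $$ (0,i):] * (?X i * u + s i))"
  define b where "b = (\<Sum>i<?d. [:C $$ (0,i):] * (?X i * v))"
  have CAij: "(\<Sum>i<?d. C $$ (0,i) * A $$ (i,j)) = (if j = 0 then det A else 0)" if j: "j < ?d" for j
  proof -
    have "(C * A) $$ (0,j) = (\<Sum>i<?d. C $$ (0,i) * A $$ (i,j))"
      using A C j d by (auto simp: scalar_prod_def atLeast0LessThan intro!: sum.cong)
    then show ?thesis using j d unfolding CA by auto
  qed
  have "a * p + b * q = (\<Sum>i<?d. [:C $$ (0,i):] * (\<Sum>j<?d. [:A $$ (i,j):] * ?X j))"
    unfolding a_def b_def sum_distrib_right sum.distrib[symmetric]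
    by (intro sum.cong refl) (simp add: row[simplified] smult_add_right ac_simps distrib_left distrib_right)
  also have "\<dots> = (\<Sum>j<?d. (\<Sum>i<?d. [:C $$ (0,i) * A $$ (i,j):]) * ?X j)"
    unfolding sum_distrib_left sum_distrib_right by (subst sum.swap) (simp add: mult.assoc[symmetric] mult.commute)
  also have "\<dots> = (\<Sum>j<?d. [:if j = 0 then det A else 0:] * ?X j)"
  proof (intro sum.cong refl)
    fix j assume "j \<in> {..<?d}"
    then have "(\<Sum>i<?d. [:C $$ (0,i) * A $$ (i,j):]) = [:if j = 0 then det A else 0:]"
      using CAij[of j] by (simp add: sum_const_poly)
    then show "(\<Sum>i<?d. [:C $$ (0,i) * A $$ (i,j):]) * ?X j = [:if j = 0 then det A else 0:] * ?X j"
      by (simp only:)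
  qed
  also have "\<dots> = (\<Sum>j\<in>{0}. [:if j = 0 then det A else 0:] * ?X j)"
    by (rule sum.mono_neutral_right) (use d in auto)
  also have "\<dots> = [:det A:]" by (simp add: monom_0)
  finally have "[:det A:] = a * p + b * q" by simp
  moreover have "det (1\<^sub>m ?d) - det A \<in> M"
    by (rule det_cong_ideal[OF _ A]) (use tM in \<open>auto simp: A_def\<close>)
  ultimately show ?thesis by (metis det_one)
qed

end

text \<open>Krull's theorem by Zorn's lemma. Maximality, tested against the ideal generated by
  \<open>M\<close> and \<open>c\<close>, yields the inverse of \<open>c\<close> modulo
  \<open>M\<close>.\<close>

lemma exists_type_maximal:
  fixes I :: "'r::comm_ring_1 set"
  assumes "type_ideal I" "1 \<notin> I"
  shows "\<exists>M. type_maximal M \<and> I \<subseteq> M"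
proof -
  let ?P = "{J. type_ideal J \<and> 1 \<notin> J \<and> I \<subseteq> J}"
  have "\<exists>M\<in>?P. \<forall>X\<in>?P. M \<subseteq> X \<longrightarrow> X = M"
  proof (rule subset_Zorn_nonempty)
    show "?P \<noteq> {}" using assms by auto
    fix \<C> assume ne: "\<C> \<noteq> {}" and ch: "subset.chain ?P \<C>"
    then have sub: "\<And>J. J \<in> \<C> \<Longrightarrow> type_ideal J \<and> 1 \<notin> J \<and> I \<subseteq> J"
      and lin: "\<And>J K. J \<in> \<C> \<Longrightarrow> K \<in> \<C> \<Longrightarrow> J \<subseteq> K \<or> K \<subseteq> J"
      by (auto simp: subset.chain_def)
    have "type_ideal (\<Union>\<C>)"
      unfolding type_ideal_def
    proof (intro conjI ballI allI)
      show "0 \<in> \<Union>\<C>" using ne sub type_ideal_0 by blast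
      fix x assume x: "x \<in> \<Union>\<C>"
      show "c * x \<in> \<Union>\<C>" for c using x sub type_ideal_mult by blast
      fix y assume "y \<in> \<Union>\<C>"
      with x obtain J K where "J \<in> \<C>" "K \<in> \<C>" "x \<in> J" "y \<in> K" by blast
      with lin[of J K] sub show "x + y \<in> \<Union>\<C>" by (meson UnionI subsetD type_ideal_add)
    qed
    with sub ne show "\<Union>\<C> \<in> ?P" by blast
  qed
  then obtain M where M: "type_ideal M" "1 \<notin> M" "I \<subseteq> M"
    and max: "\<And>X. type_ideal X \<Longrightarrow> 1 \<notin> X \<Longrightarrow> M \<subseteq> X \<Longrightarrow> X = M" by auto
  have "\<exists>d. 1 - d * c \<in> M" if c: "c \<notin> M" for c
  proof -
    let ?X = "{x + d * c | x d. x \<in> M}"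
    have "type_ideal ?X"
      unfolding type_ideal_def
    proof (intro conjI ballI allI)
      show "0 \<in> ?X" using type_ideal_0[OF M(1)] by (auto intro!: exI[of _ 0])
      fix x assume "x \<in> ?X"
      then obtain a d where x: "x = a + d * c" "a \<in> M" by auto
      show "e * x \<in> ?X" for e
        using x type_ideal_mult[OF M(1), of a e]
        by (intro CollectI exI[of _ "e * a"] exI[of _ "e * d"]) (simp add: algebra_simps)
      fix y assume "y \<in> ?X"
      then obtain b f where y: "y = b + f * c" "b \<in> M" by auto
      show "x + y \<in> ?X"
        using x y type_ideal_add[OF M(1), of a b]
        by (intro CollectI exI[of _ "a + b"] exI[of _ "d + f"]) (simp add: algebra_simps)
    qed
    moreover have "M \<subseteq> ?X"
    proof
      fix x assume "x \<in> M"
      then show "x \<in> ?X" by (intro CollectI exI[of _ x] exI[of _ 0]) simp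
    qed
    moreover have "c \<in> ?X" using type_ideal_0[OF M(1)] by (intro CollectI exI[of _ 0] exI[of _ 1]) simp
    ultimately have "1 \<in> ?X" using max[of ?X] c by auto
    then obtain x d where "1 = x + d * c" "x \<in> M" by auto
    then show ?thesis by (metis add_diff_cancel_right')
  qed
  with M show ?thesis by (auto simp: type_maximal_def)
qed

text \<open>One more than the degree of the reduction of \<open>p\<close> modulo \<open>M\<close>,
  and 0 if that reduction vanishes; with this convention a zero entry is strictly smaller than a
  nonzero constant.\<close>

definition mdeg :: "'r::comm_ring_1 set \<Rightarrow> 'r poly \<Rightarrow> nat" where
  "mdeg M p = (LEAST d. \<forall>i\<ge>d. coeff p i \<in> M)"

lemma mdeg_coeff:
  assumes "0 \<in> M" "mdeg M p \<le> i"
  shows "coeff p i \<in> M"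
proof -
  have "\<forall>i\<ge>Suc (degree p). coeff p i \<in> M" using assms(1) by (simp add: coeff_eq_0)
  then have "\<forall>i\<ge>mdeg M p. coeff p i \<in> M" unfolding mdeg_def by (rule LeastI)
  with assms show ?thesis by blast
qed

lemma mdeg_le: "(\<And>i. d \<le> i \<Longrightarrow> coeff p i \<in> M) \<Longrightarrow> mdeg M p \<le> d"
  unfolding mdeg_def by (intro Least_le) blast

lemma mdeg_lead:
  assumes "0 \<in> M" "mdeg M p = Suc d"
  shows "coeff p d \<notin> M"
proof
  assume *: "coeff p d \<in> M"
  have "mdeg M p \<le> d"
  proof (rule mdeg_le)
    fix i assume "d \<le> i"
    then show "coeff p i \<in> M" using * mdeg_coeff[OF assms(1), of p i] assms(2) by (cases "i = d") auto
  qed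
  with assms show False by simp
qed

text \<open>One step of the division algorithm over R/M: a monomial multiple of \<open>q\<close>
  removes the leading term of \<open>p\<close> modulo \<open>M\<close>.\<close>

lemma mdeg_reduce:
  assumes M: "type_maximal M" and q: "0 < mdeg M q" and pq: "mdeg M q \<le> mdeg M p"
  shows "\<exists>c. mdeg M (p + c * q) < mdeg M p"
proof -
  have I: "type_ideal M" using M by (simp add: type_maximal_def)
  note M0 = type_ideal_0[OF I]
  obtain e where e: "mdeg M q = Suc e" using q by (cases "mdeg M q") auto
  obtain d where d: "mdeg M p = Suc d" using q pq by (cases "mdeg M p") auto
  have ed: "e \<le> d" using pq d e by simp
  from mdeg_lead[OF M0 e] M obtain l where l: "1 - l * coeff q e \<in> M"
    by (auto simp: type_maximal_def)
  \<comment> \<open>\<open>l\<close> inverts the leading coefficient of \<open>q\<close> modulo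
    \<open>M\<close>, so \<open>a\<close> is minus the quotient of the leading coefficients.\<close>
  define a where "a = - (coeff p d * l)"
  let ?c = "Polynomial.monom a (d - e)"
  have co: "coeff (p + ?c * q) i = coeff p i + (if d - e \<le> i then a * coeff q (i - (d - e)) else 0)" for i
    by (simp add: coeff_monom_mult)
  have "mdeg M (p + ?c * q) \<le> d"
  proof (rule mdeg_le)
    fix i assume i: "d \<le> i"
    show "coeff (p + ?c * q) i \<in> M"
    proof (cases "i = d")
      case True
      have "d - (d - e) = e" using ed by simp
      then have "coeff (p + ?c * q) i = coeff p d * (1 - l * coeff q e)"
        unfolding co True by (simp add: a_def algebra_simps)
      with type_ideal_mult[OF I l] show ?thesis by (simp only:)
    next
      case False
      with i have "mdeg M p \<le> i" "mdeg M q \<le> i - (d - e)" using d e ed by auto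
      from mdeg_coeff[OF M0 this(1)] mdeg_coeff[OF M0 this(2)] show ?thesis
        unfolding co by (auto intro!: type_ideal_add[OF I] type_ideal_mult[OF I] M0)
    qed
  qed
  then show ?thesis using d by (intro exI[of _ ?c]) simp
qed

text \<open>
  Euclidean algorithm over the field \<open>R/M\<close>, carried out on representatives: among all rows
  reachable without touching the first entry, one of minimal total degree modulo \<open>M\<close> has at most
  one other entry that is nonzero modulo \<open>M\<close>.
\<close>

lemma reduce_mod_maximal:
  fixes F :: "nat \<Rightarrow> 'r::comm_ring_1 poly"
  assumes M: "type_maximal M" and n: "2 \<le> n"
  shows "\<exists>G. sl_equiv n F G \<and> G 0 = F 0 \<and> (\<forall>i\<in>{2..<n}. \<forall>k. coeff (G i) k \<in> M)"
proof -
  have I: "type_ideal M" using M by (simp add: type_maximal_def)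
  note M0 = type_ideal_0[OF I]
  let ?R = "\<lambda>G. sl_equiv n F G \<and> G 0 = F 0"
  define \<mu> where "\<mu> = (\<lambda>G :: nat \<Rightarrow> 'r poly. \<Sum>i\<in>{1..<n}. mdeg M (G i))"
  have "?R F" by (simp add: sl_equiv_refl)
  then obtain G where G: "?R G" and min: "\<And>G'. ?R G' \<Longrightarrow> \<mu> G \<le> \<mu> G'"
    using ex_has_least_nat[of ?R F \<mu>] by blast
  \<comment> \<open>Of two entries that are nonzero modulo \<open>M\<close>, the one of smaller
    degree would lower the other, and with it the minimal total degree.\<close>
  have *: False if ij: "i \<in> {1..<n}" "j \<in> {1..<n}" "i \<noteq> j" and d: "0 < mdeg M (G j)" "mdeg M (G j) \<le> mdeg M (G i)" for i j
  proof -
    obtain c where c: "mdeg M (G i + c * G j) < mdeg M (G i)" using mdeg_reduce[OF M d] by blast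
    let ?G = "G(i := G i + c * G j)"
    have "sl_equiv n G ?G" by (rule sl_equiv_add) (use ij in auto)
    then have "?R ?G" using G ij by (auto intro: sl_equiv_trans)
    then have "\<mu> G \<le> \<mu> ?G" by (rule min)
    moreover have "\<mu> ?G < \<mu> G"
      unfolding \<mu>_def by (rule sum_strict_mono_ex1) (use c ij in \<open>auto intro!: bexI[of _ i]\<close>)
    ultimately show False by simp
  qed
  have uniq: "i = j" if "i \<in> {1..<n}" "j \<in> {1..<n}" "0 < mdeg M (G i)" "0 < mdeg M (G j)" for i j
    using *[of i j] *[of j i] that by (metis nat_le_linear)
  show ?thesis
  proof (cases "\<exists>j\<in>{2..<n}. 0 < mdeg M (G j)")
    case False
    then show ?thesis using G mdeg_coeff[OF M0] by (intro exI[of _ G]) auto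
  next
    case True
    then obtain j where j: "j \<in> {2..<n}" "0 < mdeg M (G j)" by blast
    \<comment> \<open>The entry that is nonzero modulo \<open>M\<close> moves to position 1; what
      comes to position \<open>j\<close> in exchange is zero modulo \<open>M\<close>.\<close>
    let ?G = "G(1 := G j, j := - G 1)"
    have "sl_equiv n G ?G" by (rule sl_equiv_swap) (use j in auto)
    then have "?R ?G" using G j by (auto intro: sl_equiv_trans)
    moreover have "coeff (?G i) k \<in> M" if i: "i \<in> {2..<n}" for i k
    proof -
      have "coeff (G l) k \<in> M" if "l \<in> {1..<n}" "l \<noteq> j" for l
        using uniq[of l j] that j by (intro mdeg_coeff[OF M0]) fastforce
      from this[of 1] this[of i] show ?thesis using i j type_ideal_uminus[OF I] by auto
    qed
    ultimately show ?thesis by blast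
  qed
qed

section \<open>A row over R[X] evaluated at two arguments\<close>

lemma dvd_pcompose_diff:
  fixes p :: "'r::comm_ring_1 poly"
  shows "b - a dvd pcompose p b - pcompose p a"
proof (induction p)
  case (pCons c p)
  have "pcompose (pCons c p) b - pcompose (pCons c p) a =
      b * (pcompose p b - pcompose p a) + (b - a) * pcompose p a"
    by (simp add: pcompose_pCons algebra_simps)
  then show ?case using pCons.IH by (metis dvd_add dvd_mult dvd_triv_left)
qed simp

lemma pcompose_const [simp]: "pcompose [:c:] a = [:c:]"
  by (simp add: pcompose_pCons)

lemma comm_ring_hom_pcompose: "comm_ring_hom (\<lambda>p. pcompose p (a :: 'r::comm_ring_1 poly))"
  by unfold_locales (auto simp: pcompose_add pcompose_mult pcompose_1)

text \<open>
  With \<open>f = (G 0, G 1)\<close> and \<open>u G\<^sub>0 + v G\<^sub>1 = r\<close>, the product of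
  \<open>(f\<^sub>0(b), -v(b); f\<^sub>1(b), u(b))\<close> and \<open>(u(a), v(a); -f\<^sub>1(a), f\<^sub>0(a))\<close> carries \<open>f(a)\<close> to \<open>r f(b)\<close>; as
  \<open>a \<equiv> b (mod r)\<close> it is congruent to \<open>r I\<close> modulo \<open>r\<close>, hence divisible by \<open>r\<close>.
\<close>

lemma sl_equiv_pcompose:
  fixes G :: "nat \<Rightarrow> 'r::idom poly"
  assumes n: "2 \<le> n" and r: "r \<noteq> 0" "[:r:] = u * G 0 + v * G 1" and ab: "[:r:] dvd b - a"
  shows "sl_equiv n (\<lambda>i. pcompose (G i) a) (\<lambda>i. pcompose (G i) b)"
proof -
  define R where "R = [:r:]"
  have Rc: "pcompose R x = R" for x by (simp add: R_def)
  have ex: "\<exists>d. pcompose p b = pcompose p a + R * d" for p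
    using dvd_trans[OF ab[folded R_def] dvd_pcompose_diff[of b a p]] by (metis dvdE diff_eq_eq add.commute)
  define f0 f1 g0 g1 where fg: "f0 = pcompose (G 0) a" "f1 = pcompose (G 1) a" "g0 = pcompose u a" "g1 = pcompose v a"
  obtain d0 d1 e0 e1 where
    d: "pcompose (G 0) b = f0 + R * d0" "pcompose (G 1) b = f1 + R * d1"
    and e: "pcompose u b = g0 + R * e0" "pcompose v b = g1 + R * e1"
    using ex fg by metis
  have r1: "R = g0 * f0 + g1 * f1"
    using arg_cong[OF r(2), of "\<lambda>p. pcompose p a"] by (simp add: R_def pcompose_add pcompose_mult fg)
  have "R = (g0 + R * e0) * (f0 + R * d0) + (g1 + R * e1) * (f1 + R * d1)"
    using arg_cong[OF r(2)[folded R_def], of "\<lambda>p. pcompose p b"]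
    unfolding pcompose_add pcompose_mult d e Rc .
  moreover have "R * (d0 * g0 + f0 * e0 + d1 * g1 + f1 * e1 + R * (d0 * e0 + d1 * e1)) =
      ((g0 + R * e0) * (f0 + R * d0) + (g1 + R * e1) * (f1 + R * d1)) - (g0 * f0 + g1 * f1)"
    by (simp add: algebra_simps)
  ultimately have "R * (d0 * g0 + f0 * e0 + d1 * g1 + f1 * e1 + R * (d0 * e0 + d1 * e1)) = 0"
    using r1 by simp
  \<comment> \<open>The nonzero constant \<open>r\<close> is cancelled in an integral
    domain.\<close>
  then have r2: "d0 * g0 + f0 * e0 + d1 * g1 + f1 * e1 + R * (d0 * e0 + d1 * e1) = 0"
    using r(1) unfolding R_def by (metis mult_eq_0_iff pCons_eq_0_iff)
  \<comment> \<open>The entries of the matrix product described above, divided by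
    \<open>R\<close>.\<close>
  define A B C D where ABCD: "A = 1 + d0 * g0 + e1 * f1" "B = d0 * g1 - e1 * f0"
    "C = d1 * g0 - e0 * f1" "D = 1 + d1 * g1 + e0 * f0"
  have "A * D - B * C = 1 + (d0 * g0 + f0 * e0 + d1 * g1 + f1 * e1 + (g0 * f0 + g1 * f1) * (d0 * e0 + d1 * e1))"
    unfolding ABCD by (simp add: algebra_simps)
  then have det: "A * D - B * C = 1" using r2 by (simp add: r1[symmetric])
  have AB: "A * f0 + B * f1 = f0 + R * d0" unfolding ABCD r1 by (simp add: algebra_simps)
  have CD: "C * f0 + D * f1 = f1 + R * d1" unfolding ABCD r1 by (simp add: algebra_simps)
  let ?a = "\<lambda>i. pcompose (G i) a" and ?b = "\<lambda>i. pcompose (G i) b"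
  have "sl_equiv n ?a (?a(0 := A * ?a 0 + B * ?a 1, 1 := C * ?a 0 + D * ?a 1))"
    by (rule sl_equiv_two[OF n det])
  also have "?a(0 := A * ?a 0 + B * ?a 1, 1 := C * ?a 0 + D * ?a 1) = ?a(0 := ?b 0, 1 := ?b 1)"
    unfolding fg(1,2)[symmetric] d AB CD ..
  finally have s1: "sl_equiv n ?a (?a(0 := ?b 0, 1 := ?b 1))" .
  have "\<forall>i. \<exists>c. pcompose (G i) b = pcompose (G i) a + R * c" using ex by blast
  then have "\<exists>c. \<forall>i. pcompose (G i) b = pcompose (G i) a + R * c i" by (rule choice)
  then obtain c where c: "\<And>i. pcompose (G i) b = pcompose (G i) a + R * c i" by blast
  \<comment> \<open>For the entries from 2 on, the values at \<open>b\<close> and \<open>a\<close>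
    differ by a multiple of \<open>R\<close>, and \<open>R\<close> is a combination of the entries 0
    and 1, which have already reached their values at \<open>b\<close>.\<close>
  have rb: "R = pcompose u b * ?b 0 + pcompose v b * ?b 1"
    using arg_cong[OF r(2), of "\<lambda>p. pcompose p b"] by (simp add: R_def pcompose_add pcompose_mult)
  let ?h = "?a(0 := ?b 0, 1 := ?b 1)"
  let ?h' = "\<lambda>i. if i \<in> {2..<n} then ?h i + c i * pcompose u b * ?h 0 else ?h i"
  have s2: "sl_equiv n ?h ?h'" by (rule sl_equiv_clear) (use n in auto)
  have "sl_equiv n ?h' (\<lambda>i. if i \<in> {2..<n} then ?h' i + c i * pcompose v b * ?h' 1 else ?h' i)"
    by (rule sl_equiv_clear) (use n in auto)
  also have "(\<lambda>i. if i \<in> {2..<n} then ?h' i + c i * pcompose v b * ?h' 1 else ?h' i) =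
      (\<lambda>i. if i < n then ?b i else ?h i)"
  proof
    fix i
    show "(if i \<in> {2..<n} then ?h' i + c i * pcompose v b * ?h' 1 else ?h' i) = (if i < n then ?b i else ?h i)"
    proof (cases "i \<in> {2..<n}")
      case True
      then have "?b i = ?a i + c i * (pcompose u b * ?b 0 + pcompose v b * ?b 1)"
        using c[of i] rb by (simp add: mult.commute)
      then show ?thesis using True by (simp add: algebra_simps)
    next
      case False
      then show ?thesis using n by (cases "i < 2") (auto simp: less_2_cases_iff)
    qed
  qed
  finally have "sl_equiv n ?h' (\<lambda>i. if i < n then ?b i else ?h i)" .
  from sl_equiv_trans[OF sl_equiv_trans[OF s1 s2] this]
  show ?thesis by (rule iffD1[OF sl_equiv_cong, rotated 2]) auto
qed

text \<open>\<open>constant_in_ideal\<close> needs an entry with invertible leading coefficient; for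
  this reason \<open>reduce_mod_maximal\<close> leaves entry 0 untouched. The set \<open>J\<close>
  in the proof plays the role of the Quillen ideal in patching.\<close>

lemma sl_equiv_at_0:
  fixes F :: "nat \<Rightarrow> 'r::idom poly"
  assumes n: "2 \<le> n" and u: "(\<Sum>i<n. u i * F i) = 1" and l: "lead_coeff (F 0) * l = 1"
  shows "sl_equiv n F (\<lambda>i. [:poly (F i) 0:])"
proof -
  define J where "J = {c. \<forall>a b. [:c:] dvd b - a \<longrightarrow>
    sl_equiv n (\<lambda>i. pcompose (F i) a) (\<lambda>i. pcompose (F i) b)}"
  have J: "type_ideal J"
    unfolding type_ideal_def
  proof (intro conjI ballI allI)
    show "0 \<in> J" by (simp add: J_def sl_equiv_refl)
    fix x assume x: "x \<in> J"
    show "c * x \<in> J" for c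
    proof -
      have "[:x:] dvd [:c * x:]" by (simp add: const_poly_dvd_const_poly_iff)
      with x dvd_trans show ?thesis unfolding J_def by blast
    qed
    fix y assume y: "y \<in> J"
    have "sl_equiv n (\<lambda>i. pcompose (F i) a) (\<lambda>i. pcompose (F i) b)" if "[:x + y:] dvd b - a" for a b
    proof -
      from that obtain e where e: "b - a = [:x + y:] * e" by (rule dvdE)
      \<comment> \<open>Passing through this argument splits a shift by a multiple of
        \<open>x + y\<close> into a shift by a multiple of \<open>x\<close> and one by a multiple of
        \<open>y\<close>.\<close>
      let ?m = "a + [:x:] * e"
      have "b - ?m = [:y:] * e" using e by (simp add: algebra_simps smult_add_left)
      moreover have "?m - a = [:x:] * e" by simp
      ultimately have "[:x:] dvd ?m - a" "[:y:] dvd b - ?m" by (metis dvd_triv_left)+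
      with x y have "sl_equiv n (\<lambda>i. pcompose (F i) a) (\<lambda>i. pcompose (F i) ?m)"
        "sl_equiv n (\<lambda>i. pcompose (F i) ?m) (\<lambda>i. pcompose (F i) b)" unfolding J_def by blast+
      then show ?thesis by (rule sl_equiv_trans)
    qed
    then show "x + y \<in> J" by (simp add: J_def)
  qed
  have "1 \<in> J"
  proof (rule ccontr)
    assume "1 \<notin> J"
    from exists_type_maximal[OF J this] obtain M where M: "type_maximal M" "J \<subseteq> M" by blast
    have I: "type_ideal M" and M1: "1 \<notin> M" using M by (auto simp: type_maximal_def)
    obtain G where G: "sl_equiv n F G" "G 0 = F 0" "\<And>i k. i \<in> {2..<n} \<Longrightarrow> coeff (G i) k \<in> M"
      using reduce_mod_maximal[OF M(1) n, of F] by blast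
    obtain v where v: "(\<Sum>i<n. v i * G i) = 1" using sl_equiv_unimodular[OF G(1) u] by blast
    define z where "z = (\<Sum>i\<in>{2..<n}. v i * G i)"
    have zM: "coeff z k \<in> M" for k
      unfolding z_def coeff_sum coeff_mult
      by (intro type_ideal_sum[OF I] type_ideal_mult[OF I] G(3))
    have "{..<n} = insert 0 (insert 1 {2..<n})" using n by auto
    then have "v 0 * F 0 + v 1 * G 1 + z = 1" using v G(2) by (simp add: z_def add.assoc)
    from constant_in_ideal[OF I l zM this] obtain r a b where
      r: "[:r:] = a * F 0 + b * G 1" "1 - r \<in> M" by blast
    have r0: "r \<noteq> 0" using r M1 by auto
    have "r \<in> J"
      unfolding J_def
    proof (intro CollectI allI impI)
      fix x y assume xy: "[:r:] dvd y - x"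
      \<comment> \<open>A single matrix over R[X] carries \<open>F\<close> to \<open>G\<close>, and
        substituting an argument into its entries serves every argument.\<close>
      have *: "sl_equiv n (\<lambda>i. pcompose (F i) x) (\<lambda>i. pcompose (G i) x)" for x
        by (rule sl_equiv_hom[OF comm_ring_hom_pcompose G(1)])
      have "sl_equiv n (\<lambda>i. pcompose (G i) x) (\<lambda>i. pcompose (G i) y)"
        by (rule sl_equiv_pcompose[OF n r0 _ xy, of a _ b]) (simp add: r G)
      from sl_equiv_trans[OF sl_equiv_trans[OF *[of x] this] sl_equiv_sym[OF *[of y]]]
      show "sl_equiv n (\<lambda>i. pcompose (F i) x) (\<lambda>i. pcompose (F i) y)" .
    qed
    then have "r + (1 - r) \<in> M" using r(2) M(2) by (intro type_ideal_add[OF I]) auto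
    with M1 show False by simp
  qed
  \<comment> \<open>Every polynomial is a multiple of 1, so the arguments X and 0 may be
    compared.\<close>
  moreover have "[:1:] dvd 0 - [:0, 1 :: 'r:]" by (simp add: const_poly_dvd_iff)
  ultimately have "sl_equiv n (\<lambda>i. pcompose (F i) [:0, 1:]) (\<lambda>i. pcompose (F i) 0)"
    unfolding J_def by blast
  then show ?thesis by (simp add: pcompose_idR pcompose_0' poly_0_coeff_0)
qed

section \<open>Evaluation of multivariate polynomials\<close>

definition power_product :: "(nat \<Rightarrow> 'b::comm_monoid_mult) \<Rightarrow> (nat \<Rightarrow>\<^sub>0 nat) \<Rightarrow> 'b" where
  "power_product F t = (\<Prod>v\<in>Poly_Mapping.keys t. F v ^ Poly_Mapping.lookup t v)"

lemma power_product_superset: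
  "finite S \<Longrightarrow> Poly_Mapping.keys t \<subseteq> S \<Longrightarrow> power_product F t = (\<Prod>v\<in>S. F v ^ Poly_Mapping.lookup t v)"
  unfolding power_product_def by (rule prod.mono_neutral_left) (auto simp: in_keys_iff)

lemma power_product_0 [simp]: "power_product F 0 = 1"
  by (simp add: power_product_def)

lemma power_product_add: "power_product F (s + t) = power_product F s * power_product F t"
proof -
  let ?S = "Poly_Mapping.keys s \<union> Poly_Mapping.keys t"
  have "power_product F (s + t) = (\<Prod>v\<in>?S. F v ^ Poly_Mapping.lookup (s + t) v)"
    by (rule power_product_superset) (use Poly_Mapping.keys_add[of s t] in auto)
  then show ?thesis
    by (simp add: power_product_superset[of ?S s] power_product_superset[of ?S t]
        lookup_add power_add prod.distrib)
qed

lemma power_product_single [simp]: "power_product F (Poly_Mapping.single v n) = F v ^ n"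
  by (simp add: power_product_def)

text \<open>The coefficient map \<open>\<iota>\<close> is kept general because two instances are
  used: \<open>Const\<close> for substitutions, and constant polynomials for the change to a
  univariate polynomial ring.\<close>

definition meval :: "('a::field \<Rightarrow> 'b::comm_ring_1) \<Rightarrow> (nat \<Rightarrow> 'b) \<Rightarrow> 'a mpoly \<Rightarrow> 'b" where
  "meval \<iota> F p = (\<Sum>t\<in>Poly_Mapping.keys p. \<iota> (Poly_Mapping.lookup p t) * power_product F t)"

lemma subst_eq_meval: "subst F = meval Const F"
  by (simp add: fun_eq_iff subst_def meval_def power_product_def)

lemma comm_ring_hom_Const: "comm_ring_hom (Const :: 'a::field \<Rightarrow> _)"
  by unfold_locales (auto simp: Const_def single_add mult_single)

lemma mpoly_expansion_single: "p = (\<Sum>t\<in>Poly_Mapping.keys p. Poly_Mapping.single t (Poly_Mapping.lookup p t))"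
proof (rule poly_mapping_eqI)
  fix k
  have "Poly_Mapping.lookup (\<Sum>t\<in>Poly_Mapping.keys p. Poly_Mapping.single t (Poly_Mapping.lookup p t)) k = (\<Sum>t\<in>Poly_Mapping.keys p. if t = k then Poly_Mapping.lookup p t else 0)"
    by (simp add: lookup_sum lookup_single when_def)
  then show "Poly_Mapping.lookup p k = Poly_Mapping.lookup (\<Sum>t\<in>Poly_Mapping.keys p. Poly_Mapping.single t (Poly_Mapping.lookup p t)) k"
    by (simp add: in_keys_iff)
qed

lemma power_product_Var: "power_product Var t = (Poly_Mapping.single t 1 :: 'a::field mpoly)"
proof -
  have pow: "(Var v :: 'a mpoly) ^ n = Poly_Mapping.single (Poly_Mapping.single v n) 1" for v n
    by (induction n) (auto simp: Var_def mult_single single_add[symmetric])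
  have "(\<Prod>v\<in>S. Poly_Mapping.single (Poly_Mapping.single v (Poly_Mapping.lookup t v)) 1) =
      (Poly_Mapping.single (\<Sum>v\<in>S. Poly_Mapping.single v (Poly_Mapping.lookup t v)) 1 :: 'a mpoly)" for S
    by (induction S rule: infinite_finite_induct) (auto simp: mult_single)
  then show ?thesis using mpoly_expansion_single[of t]
    by (simp add: power_product_def pow)
qed

lemma mpoly_expansion: "p = (\<Sum>t\<in>Poly_Mapping.keys p. Const (Poly_Mapping.lookup p t) * power_product Var t)"
  using mpoly_expansion_single[of p] by (simp add: power_product_Var Const_def mult_single)

lemma mpoly_induct [case_names add monom]:
  fixes P :: "('k \<Rightarrow>\<^sub>0 'c::comm_monoid_add) \<Rightarrow> bool"
  assumes "\<And>p q. P p \<Longrightarrow> P q \<Longrightarrow> P (p + q)" "\<And>t c. P (Poly_Mapping.single t c)"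
  shows "P p"
proof -
  have "P (\<Sum>t\<in>S. Poly_Mapping.single t (f t))" for S f
    by (induction S rule: infinite_finite_induct) (use assms assms(2)[of undefined 0] in auto)
  then show ?thesis using mpoly_expansion_single[of p] by metis
qed

context
  fixes \<iota> :: "'a::field \<Rightarrow> 'b::comm_ring_1"
  assumes \<iota>: "comm_ring_hom \<iota>"
begin

interpretation comm_ring_hom \<iota> by (rule \<iota>)

lemma meval_superset:
  "finite S \<Longrightarrow> Poly_Mapping.keys p \<subseteq> S \<Longrightarrow> meval \<iota> F p = (\<Sum>t\<in>S. \<iota> (Poly_Mapping.lookup p t) * power_product F t)"
  unfolding meval_def by (rule sum.mono_neutral_left) (auto simp: in_keys_iff)

lemma meval_single [simp]: "meval \<iota> F (Poly_Mapping.single t c) = \<iota> c * power_product F t"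
  by (simp add: meval_def)

lemma meval_add: "meval \<iota> F (p + q) = meval \<iota> F p + meval \<iota> F q"
proof -
  let ?S = "Poly_Mapping.keys p \<union> Poly_Mapping.keys q"
  have "meval \<iota> F (p + q) = (\<Sum>t\<in>?S. \<iota> (Poly_Mapping.lookup (p + q) t) * power_product F t)"
    by (rule meval_superset) (use Poly_Mapping.keys_add[of p q] in auto)
  then show ?thesis
    by (simp add: meval_superset[of ?S p] meval_superset[of ?S q] lookup_add hom_add
        distrib_right sum.distrib)
qed

lemma meval_mult: "meval \<iota> F (p * q) = meval \<iota> F p * meval \<iota> F q"
proof (induction p rule: mpoly_induct)
  case (monom s a)
  show ?case
  proof (induction q rule: mpoly_induct)
    case (monom t b)
    show ?case by (simp add: mult_single power_product_add hom_mult)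
  qed (simp add: distrib_left meval_add)
qed (simp add: distrib_right meval_add)

lemma meval_Const [simp]: "meval \<iota> F (Const c) = \<iota> c"
  by (simp add: Const_def)

lemma meval_Var [simp]: "meval \<iota> F (Var v) = F v"
  by (simp add: Var_def)

lemma comm_ring_hom_meval: "comm_ring_hom (meval \<iota> F)"
proof
  show "meval \<iota> F 1 = 1"
    using meval_single[of F 0 1] by (simp del: meval_single)
  show "meval \<iota> F 0 = 0" by (simp add: meval_def)
qed (auto simp: meval_add meval_mult)

end

lemma comm_ring_hom_subst: "comm_ring_hom (subst F)"
  unfolding subst_eq_meval by (rule comm_ring_hom_meval[OF comm_ring_hom_Const])

lemma subst_Const [simp]: "subst F (Const c) = Const c"
  by (simp add: subst_eq_meval meval_Const[OF comm_ring_hom_Const])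

lemma subst_Var [simp]: "subst F (Var v) = F v"
  by (simp add: subst_eq_meval meval_Var[OF comm_ring_hom_Const])

text \<open>Uniqueness in the universal property of the polynomial ring, tested only on the
  indeterminates that occur in \<open>p\<close>; the identities between substitutions below come
  from it.\<close>

lemma mpoly_hom_eqI:
  assumes G: "comm_ring_hom G" and H: "comm_ring_hom H"
    and c: "\<And>c. G (Const c) = H (Const c)" and v: "\<And>v. v \<in> vars p \<Longrightarrow> G (Var v) = H (Var v)"
  shows "G p = H p"
proof -
  interpret G: comm_ring_hom G by fact
  interpret H: comm_ring_hom H by fact
  have "G (\<Sum>t\<in>Poly_Mapping.keys p. Const (Poly_Mapping.lookup p t) * power_product Var t) =
      H (\<Sum>t\<in>Poly_Mapping.keys p. Const (Poly_Mapping.lookup p t) * power_product Var t)"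
    unfolding G.hom_sum H.hom_sum G.hom_mult H.hom_mult power_product_def G.hom_prod H.hom_prod
      G.hom_power H.hom_power c
    by (intro sum.cong arg_cong2[of _ _ _ _ "(*)"] prod.cong arg_cong2[of _ _ _ _ "(^)"] refl v)
      (auto simp: vars_def)
  then show ?thesis using mpoly_expansion[of p] by simp
qed

lemma comm_ring_hom_id: "comm_ring_hom (\<lambda>x. x)"
  by unfold_locales auto

lemma comm_ring_hom_comp: "comm_ring_hom G \<Longrightarrow> comm_ring_hom H \<Longrightarrow> comm_ring_hom (\<lambda>x. G (H x))"
proof -
  assume "comm_ring_hom G" "comm_ring_hom H"
  then interpret G: comm_ring_hom G + H: comm_ring_hom H .
  show ?thesis by unfold_locales (auto simp: G.hom_add H.hom_add G.hom_mult H.hom_mult)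
qed

lemma subst_id: "(\<And>v. v \<in> vars p \<Longrightarrow> F v = Var v) \<Longrightarrow> subst F p = p"
  by (rule mpoly_hom_eqI[OF comm_ring_hom_subst comm_ring_hom_id]) auto

lemma subst_cong: "(\<And>v. v \<in> vars p \<Longrightarrow> F v = G v) \<Longrightarrow> subst F p = subst G p"
  by (rule mpoly_hom_eqI[OF comm_ring_hom_subst comm_ring_hom_subst]) auto

lemma subst_subst: "subst F (subst G p) = subst (\<lambda>v. subst F (G v)) p"
  by (rule mpoly_hom_eqI[OF comm_ring_hom_comp[OF comm_ring_hom_subst comm_ring_hom_subst]
        comm_ring_hom_subst]) auto

lemma vars_Const [simp]: "vars (Const c) = {}"
  by (simp add: vars_def Const_def)

lemma vars_Var [simp]: "vars (Var v :: 'a::field mpoly) = {v}"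
  by (simp add: vars_def Var_def)

lemma vars_0 [simp]: "vars 0 = {}" and vars_1 [simp]: "vars 1 = {}"
  by (simp_all add: vars_def)

lemma vars_add_subset: "vars p \<subseteq> V \<Longrightarrow> vars q \<subseteq> V \<Longrightarrow> vars (p + q) \<subseteq> V"
  using vars_add[of p q] by blast

lemma vars_mult_subset: "vars p \<subseteq> V \<Longrightarrow> vars q \<subseteq> V \<Longrightarrow> vars (p * q) \<subseteq> V"
  using vars_mult[of p q] by blast

lemma vars_diff_subset: "vars p \<subseteq> V \<Longrightarrow> vars q \<subseteq> V \<Longrightarrow> vars (p - q) \<subseteq> V"
  using vars_add_subset[of p V "- q"] vars_uminus[of q] by simp

lemma vars_sum_subset: "(\<And>i. i \<in> S \<Longrightarrow> vars (f i) \<subseteq> V) \<Longrightarrow> vars (sum f S) \<subseteq> V"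
  by (induction S rule: infinite_finite_induct) (simp_all add: vars_add_subset)

lemma vars_power_subset: "vars p \<subseteq> V \<Longrightarrow> vars (p ^ n) \<subseteq> V"
  by (induction n) (simp_all add: vars_mult_subset)

lemma vars_prod_subset: "(\<And>i. i \<in> S \<Longrightarrow> vars (f i) \<subseteq> V) \<Longrightarrow> vars (prod f S) \<subseteq> V"
  by (induction S rule: infinite_finite_induct) (simp_all add: vars_mult_subset)

lemma vars_subst_subset:
  assumes "\<And>v. v \<in> vars p \<Longrightarrow> vars (F v) \<subseteq> V"
  shows "vars (subst F p) \<subseteq> V"
  unfolding subst_def
  by (intro vars_sum_subset vars_mult_subset vars_prod_subset vars_power_subset assms)
    (auto simp: vars_def[of p])

section \<open>The Quillen--Suslin theorem\<close>

text \<open>The last digit is the residue modulo \<open>B\<close>; the remaining ones follow by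
  induction on the number of digits.\<close>

lemma digits_unique:
  fixes a b :: "nat \<Rightarrow> nat"
  assumes "\<And>v. a v < B" "\<And>v. b v < B"
    and "(\<Sum>v\<le>N. a v * B ^ (N - v)) = (\<Sum>v\<le>N. b v * B ^ (N - v))" "v \<le> N"
  shows "a v = b v"
  using assms(3,4)
proof (induction N arbitrary: v)
  case (Suc N)
  have *: "(\<Sum>v\<le>Suc N. c v * B ^ (Suc N - v)) = B * (\<Sum>v\<le>N. c v * B ^ (N - v)) + c (Suc N)" for c :: "nat \<Rightarrow> nat"
    by (simp add: sum_distrib_left Suc_diff_le mult_ac)
  from Suc.prems(1) have eq: "B * (\<Sum>v\<le>N. a v * B ^ (N - v)) + a (Suc N) =
      B * (\<Sum>v\<le>N. b v * B ^ (N - v)) + b (Suc N)" unfolding * .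
  have "a (Suc N) = b (Suc N)"
    using arg_cong[OF eq, of "\<lambda>x. x mod B"] assms(1)[of "Suc N"] assms(2)[of "Suc N"] by simp
  moreover from this eq assms(1)[of 0] have "(\<Sum>v\<le>N. a v * B ^ (N - v)) = (\<Sum>v\<le>N. b v * B ^ (N - v))"
    by simp
  ultimately show ?case using Suc.IH[of v] Suc.prems(2) by (cases "v = Suc N") auto
qed simp

text \<open>
  If all exponents of \<open>p\<close> are less than \<open>B\<close>, then distinct terms of \<open>p\<close> acquire distinct degrees
  in the new indeterminate, as the exponents become base \<open>B\<close> digits; so the leading coefficient of
  the image of \<open>p\<close> is a constant.
\<close>

definition to_upoly :: "nat \<Rightarrow> nat \<Rightarrow> 'a::field mpoly \<Rightarrow> 'a mpoly poly" where
  "to_upoly B N = meval (\<lambda>c. [:Const c:])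
     (\<lambda>v. if v < N then Polynomial.monom 1 (B ^ (N - v)) + [:Var v:]
          else if v = N then Polynomial.monom 1 1 else [:Var v:])"

lemma comm_ring_hom_pConst: "comm_ring_hom (\<lambda>c. [:Const c :: 'a::field mpoly:])"
proof -
  interpret comm_ring_hom "Const :: 'a \<Rightarrow> _" by (rule comm_ring_hom_Const)
  show ?thesis by unfold_locales (auto simp: hom_add hom_mult one_pCons)
qed

lemma comm_ring_hom_to_upoly: "comm_ring_hom (to_upoly B N)"
  unfolding to_upoly_def by (rule comm_ring_hom_meval[OF comm_ring_hom_pConst])

lemma to_upoly_Const [simp]: "to_upoly B N (Const c) = [:Const c:]"
  by (simp add: to_upoly_def meval_Const[OF comm_ring_hom_pConst])

lemma to_upoly_Var: "to_upoly B N (Var v) =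
    (if v < N then Polynomial.monom 1 (B ^ (N - v)) + [:Var v:]
     else if v = N then Polynomial.monom 1 1 else [:Var v:])"
  unfolding to_upoly_def by (rule meval_Var[OF comm_ring_hom_pConst])

text \<open>The factors \<open>?F v\<close> are monic of degree \<open>B ^ (N - v)\<close>, and
  degrees add up over an integral domain; the exponent of \<open>Var N\<close> becomes the last
  digit.\<close>

lemma lead_to_upoly_monom:
  fixes c :: "'a::field"
  assumes t: "Poly_Mapping.keys t \<subseteq> {..N}" and B: "1 < B" and c: "c \<noteq> 0"
  shows "to_upoly B N (Poly_Mapping.single t c) \<noteq> 0"
    and "degree (to_upoly B N (Poly_Mapping.single t c)) = (\<Sum>v\<le>N. Poly_Mapping.lookup t v * B ^ (N - v))"
    and "lead_coeff (to_upoly B N (Poly_Mapping.single t c)) = Const c"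
proof -
  let ?F = "\<lambda>v. if v < N then Polynomial.monom 1 (B ^ (N - v)) + [:Var v:]
          else if v = N then Polynomial.monom 1 1 else [:Var v :: 'a mpoly:]"
  have F: "degree (?F v) = B ^ (N - v) \<and> lead_coeff (?F v) = 1" if "v \<le> N" for v
  proof (cases "v < N")
    case True
    \<comment> \<open>The power of the new indeterminate is not constant, so the summand
      \<open>Var v\<close> does not touch the leading coefficient.\<close>
    then have "0 < B ^ (N - v)" using B by simp
    then have "degree [:Var v :: 'a mpoly:] < degree (Polynomial.monom (1 :: 'a mpoly) (B ^ (N - v)))"
      by (simp add: degree_monom_eq)
    then show ?thesis using True
      by (simp add: degree_add_eq_left degree_monom_eq coeff_pCons split: nat.splits)
  qed (use that in \<open>auto simp: degree_monom_eq\<close>)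
  have nz: "P \<noteq> 0" if "lead_coeff P = 1" for P :: "'a mpoly poly" using that by auto
  have F0: "?F v \<noteq> 0" if "v \<le> N" for v by (rule nz) (use F[OF that] in blast)
  let ?p = "\<Prod>v\<le>N. ?F v ^ Poly_Mapping.lookup t v"
  have eq: "to_upoly B N (Poly_Mapping.single t c) = [:Const c:] * ?p"
    unfolding to_upoly_def meval_single[OF comm_ring_hom_pConst]
    by (subst power_product_superset[of "{..N}"]) (use t in auto)
  have l: "lead_coeff ?p = 1"
    unfolding lead_coeff_prod lead_coeff_power
  proof (rule prod.neutral, rule ballI)
    fix v assume "v \<in> {..N}"
    then have "lead_coeff (?F v) = 1" using F by blast
    then show "lead_coeff (?F v) ^ Poly_Mapping.lookup t v = 1" by (simp only: power_one)
  qed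
  have "degree ?p = (\<Sum>v\<le>N. degree (?F v ^ Poly_Mapping.lookup t v))"
    by (rule degree_prod_eq_sum_degree) (use F0 in \<open>simp only: power_eq_0_iff, blast\<close>)
  also have "\<dots> = (\<Sum>v\<le>N. Poly_Mapping.lookup t v * B ^ (N - v))"
  proof (rule sum.cong[OF refl])
    fix v assume "v \<in> {..N}"
    then have v: "degree (?F v) = B ^ (N - v)" "?F v \<noteq> 0" using F F0 by blast+
    show "degree (?F v ^ Poly_Mapping.lookup t v) = Poly_Mapping.lookup t v * B ^ (N - v)"
      by (rule trans[OF Polynomial.degree_power_eq[OF v(2)]]) (simp only: v(1))
  qed
  finally have d: "degree ?p = (\<Sum>v\<le>N. Poly_Mapping.lookup t v * B ^ (N - v))" .
  have C: "Const c \<noteq> (0 :: 'a mpoly)" using c by (metis Const_def lookup_single_eq lookup_zero)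
  have p0: "?p \<noteq> 0" using l by (rule nz)
  show "to_upoly B N (Poly_Mapping.single t c) \<noteq> 0" unfolding eq using C p0 by simp
  show "degree (to_upoly B N (Poly_Mapping.single t c)) = (\<Sum>v\<le>N. Poly_Mapping.lookup t v * B ^ (N - v))"
    unfolding eq using C d by simp
  show "lead_coeff (to_upoly B N (Poly_Mapping.single t c)) = Const c"
    unfolding eq lead_coeff_mult using l by simp
qed

lemma lead_to_upoly:
  fixes p :: "'a::field mpoly"
  assumes p: "p \<noteq> 0" and vars: "vars p \<subseteq> {..N}" and B: "1 < B"
    and exps: "\<And>t v. t \<in> Poly_Mapping.keys p \<Longrightarrow> Poly_Mapping.lookup t v < B"
  shows "\<exists>c. c \<noteq> 0 \<and> lead_coeff (to_upoly B N p) = Const c"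
proof -
  interpret comm_ring_hom "to_upoly B N :: 'a mpoly \<Rightarrow> _" by (rule comm_ring_hom_to_upoly)
  let ?D = "\<lambda>t. \<Sum>v\<le>N. Poly_Mapping.lookup t v * B ^ (N - v)"
  let ?m = "\<lambda>t. to_upoly B N (Poly_Mapping.single t (Poly_Mapping.lookup p t))"
  have sub: "Poly_Mapping.keys t \<subseteq> {..N}" if "t \<in> Poly_Mapping.keys p" for t using vars that by (auto simp: vars_def)
  have inj: "s = t" if "s \<in> Poly_Mapping.keys p" "t \<in> Poly_Mapping.keys p" "?D s = ?D t" for s t
  proof (rule poly_mapping_eqI)
    fix v
    show "Poly_Mapping.lookup s v = Poly_Mapping.lookup t v"
    proof (cases "v \<le> N")
      case True
      show ?thesis by (rule digits_unique[OF exps exps that(3) True]) (use that in auto)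
    next
      case False
      then have "v \<notin> Poly_Mapping.keys s" "v \<notin> Poly_Mapping.keys t" using sub that by auto
      then show ?thesis by (simp add: in_keys_iff)
    qed
  qed
  have fin: "finite (?D ` Poly_Mapping.keys p)" "?D ` Poly_Mapping.keys p \<noteq> {}" using p by auto
  then have "Max (?D ` Poly_Mapping.keys p) \<in> ?D ` Poly_Mapping.keys p" by (rule Max_in)
  then obtain s where s: "s \<in> Poly_Mapping.keys p" "Max (?D ` Poly_Mapping.keys p) = ?D s" by (rule imageE)
  have max: "?D t \<le> ?D s" if "t \<in> Poly_Mapping.keys p" for t
    using Max_ge[OF fin(1) imageI[OF that]] s(2) by simp
  note s = s(1)
  have less: "?D t < ?D s" if "t \<in> Poly_Mapping.keys p" "t \<noteq> s" for t
    using max[OF that(1)] inj[OF that(1) s] that(2) by (meson le_neq_implies_less)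
  have c: "Poly_Mapping.lookup p t \<noteq> 0" if "t \<in> Poly_Mapping.keys p" for t using that by (simp add: in_keys_iff)
  note lead = lead_to_upoly_monom[OF sub B c]
  have eq: "to_upoly B N p = (\<Sum>t\<in>Poly_Mapping.keys p. ?m t)"
    by (subst mpoly_expansion_single[of p]) (rule hom_sum)
  \<comment> \<open>Only the term \<open>s\<close> of largest image degree reaches the degree
    \<open>?D s\<close>, so nothing can cancel its coefficient.\<close>
  have "coeff (?m t) (?D s) = 0" if "t \<in> Poly_Mapping.keys p" "t \<noteq> s" for t
    by (rule coeff_eq_0) (use less[OF that] lead(2)[OF that(1) that(1)] in simp)
  then have "coeff (to_upoly B N p) (?D s) = (\<Sum>t\<in>Poly_Mapping.keys p. if t = s then coeff (?m t) (?D s) else 0)"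
    unfolding eq coeff_sum by (intro sum.cong) auto
  also have "\<dots> = coeff (?m s) (?D s)" using s by simp
  also have "\<dots> = Const (Poly_Mapping.lookup p s)" using lead(2,3)[OF s s] by simp
  finally have co: "coeff (to_upoly B N p) (?D s) = Const (Poly_Mapping.lookup p s)" .
  have "degree (to_upoly B N p) \<le> ?D s"
    unfolding eq by (rule degree_sum_le) (use lead(2) max in auto)
  moreover have "Const (Poly_Mapping.lookup p s) \<noteq> (0 :: 'a mpoly)"
    using c[OF s] by (metis Const_def lookup_single_eq lookup_zero)
  then have "?D s \<le> degree (to_upoly B N p)" using co by (intro le_degree) simp
  ultimately have "degree (to_upoly B N p) = ?D s" by simp
  with co c[OF s] show ?thesis by auto
qed

text \<open>The indeterminate X returns to \<open>Var N\<close>, and the shift of the other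
  indeterminates is undone. This is only a left inverse of \<open>to_upoly\<close>, which is enough
  to carry an equivalence of rows back along a ring homomorphism.\<close>

definition from_upoly :: "nat \<Rightarrow> nat \<Rightarrow> 'a::field mpoly poly \<Rightarrow> 'a mpoly" where
  "from_upoly B N P =
     poly (map_poly (subst (\<lambda>v. if v < N then Var v - Var N ^ (B ^ (N - v)) else Var v)) P) (Var N)"

lemma comm_ring_hom_from_upoly: "comm_ring_hom (from_upoly B N :: 'a::field mpoly poly \<Rightarrow> _)"
proof -
  let ?\<sigma> = "subst (\<lambda>v. if v < N then Var v - Var N ^ (B ^ (N - v)) else Var v) :: 'a mpoly \<Rightarrow> _"
  interpret \<sigma>: map_poly_comm_ring_hom ?\<sigma>
    by (intro map_poly_comm_ring_hom.intro comm_ring_hom_subst)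
  show ?thesis
    unfolding from_upoly_def
    by (rule comm_ring_hom_comp[OF poly_hom.comm_ring_hom_axioms \<sigma>.comm_ring_hom_axioms])
qed

lemma from_to_upoly:
  fixes p :: "'a::field mpoly"
  shows "from_upoly B N (to_upoly B N p) = p"
proof (rule mpoly_hom_eqI[OF comm_ring_hom_comp[OF comm_ring_hom_from_upoly comm_ring_hom_to_upoly]
      comm_ring_hom_id])
  let ?\<sigma> = "subst (\<lambda>v. if v < N then Var v - Var N ^ (B ^ (N - v)) else Var v) :: 'a mpoly \<Rightarrow> _"
  interpret \<sigma>: comm_ring_hom ?\<sigma> by (rule comm_ring_hom_subst)
  interpret M: map_poly_comm_ring_hom ?\<sigma>
    by (intro map_poly_comm_ring_hom.intro comm_ring_hom_subst)
  show "from_upoly B N (to_upoly B N (Const c)) = Const c" for c :: 'a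
    by (simp add: from_upoly_def \<sigma>.map_poly_pCons_hom)
  show "from_upoly B N (to_upoly B N (Var v)) = (Var v :: 'a mpoly)" for v
    by (auto simp: from_upoly_def to_upoly_Var M.hom_add \<sigma>.map_poly_pCons_hom map_poly_monom poly_monom)
qed

theorem quillen_suslin_row:
  fixes f u :: "nat \<Rightarrow> 'a::field mpoly"
  assumes n: "2 \<le> n" and "(\<Sum>i<n. u i * f i) = 1" and "\<And>i. i < n \<Longrightarrow> vars (f i) \<subseteq> {..<N}"
  shows "sl_equiv n f (\<lambda>i. if i = 0 then 1 else 0)"
  using assms(2,3)
proof (induction N arbitrary: f u)
  case 0
  obtain j where j: "j < n" "f j \<noteq> 0"
    using 0(1) by (metis (no_types, lifting) lessThan_iff mult_zero_right sum.neutral zero_neq_one)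
  \<comment> \<open>Without indeterminates the entries are constants, and a nonzero one is a
    unit.\<close>
  have "Poly_Mapping.keys (f j) \<subseteq> {0}" using 0(2)[OF j(1)] by (fastforce simp: vars_def)
  then have "f j = Const (Poly_Mapping.lookup (f j) 0)"
    using mpoly_expansion_single[of "f j"] by (cases "Poly_Mapping.keys (f j) = {}") (auto simp: Const_def subset_singleton_iff)
  then obtain c where c: "f j = Const c" by blast
  with j have "c \<noteq> 0" by (auto simp: Const_def)
  then have "f j * Const (inverse c) = 1" by (simp add: c Const_def mult_single)
  with n j(1) show ?case by (rule sl_equiv_unit)
next
  case (Suc N)
  have *: "sl_equiv n f (\<lambda>i. if i = 0 then 1 else 0)"
    if u: "(\<Sum>i<n. u i * f i) = 1" and f: "\<And>i. i < n \<Longrightarrow> vars (f i) \<subseteq> {..<Suc N}" and f0: "f 0 \<noteq> 0" for f u :: "nat \<Rightarrow> 'a mpoly"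
  proof -
    \<comment> \<open>Larger than every exponent in \<open>f 0\<close>; the summand 2 also ensures
      \<open>1 < B\<close>.\<close>
    define B where "B = (\<Sum>t\<in>Poly_Mapping.keys (f 0). \<Sum>v\<in>Poly_Mapping.keys t. Poly_Mapping.lookup t v) + 2"
    have exps: "Poly_Mapping.lookup t v < B" if t: "t \<in> Poly_Mapping.keys (f 0)" for t v
    proof (cases "v \<in> Poly_Mapping.keys t")
      case True
      have "Poly_Mapping.lookup t v \<le> (\<Sum>v\<in>Poly_Mapping.keys t. Poly_Mapping.lookup t v)" by (rule member_le_sum[OF True]) auto
      also have "\<dots> \<le> (\<Sum>t\<in>Poly_Mapping.keys (f 0). \<Sum>v\<in>Poly_Mapping.keys t. Poly_Mapping.lookup t v)" by (rule member_le_sum[OF t]) auto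
      finally show ?thesis by (simp add: B_def)
    qed (simp add: B_def in_keys_iff)
    have "vars (f 0) \<subseteq> {..N}" using f[of 0] n by (simp add: lessThan_Suc_atMost)
    from lead_to_upoly[OF f0 this _ exps] obtain c where c: "c \<noteq> 0" "lead_coeff (to_upoly B N (f 0)) = Const c"
      by (auto simp: B_def)
    let ?F = "\<lambda>i. to_upoly B N (f i)"
    interpret \<Phi>: comm_ring_hom "to_upoly B N :: 'a mpoly \<Rightarrow> _" by (rule comm_ring_hom_to_upoly)
    have uF: "(\<Sum>i<n. to_upoly B N (u i) * ?F i) = 1"
      using arg_cong[OF u, of "to_upoly B N"] by (simp add: \<Phi>.hom_sum \<Phi>.hom_mult)
    have "lead_coeff (?F 0) * Const (inverse c) = 1" using c by (simp add: Const_def mult_single)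
    from sl_equiv_at_0[OF n uF this] have s1: "sl_equiv n ?F (\<lambda>i. [:poly (?F i) 0:])" .
    let ?G = "\<lambda>i. poly (?F i) 0"
    \<comment> \<open>At X = 0 the powers added by the shift vanish, because their exponents are
      positive; what remains is \<open>f i\<close> with \<open>Var N\<close> set to 0.\<close>
    have G: "?G i = subst (\<lambda>v. if v < N then Var v else if v = N then 0 else Var v) (f i)" for i
      by (rule mpoly_hom_eqI[OF comm_ring_hom_comp[OF poly_hom.comm_ring_hom_axioms comm_ring_hom_to_upoly]
            comm_ring_hom_subst]) (use B_def in \<open>auto simp: to_upoly_Var poly_monom power_0_left\<close>)
    have "vars (?G i) \<subseteq> {..<N}" if "i < n" for i
      unfolding G by (rule vars_subst_subset) (use f[OF that] in auto)
    moreover have "(\<Sum>i<n. poly (to_upoly B N (u i)) 0 * ?G i) = 1"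
      using arg_cong[OF uF, of "\<lambda>p. poly p 0"] by (simp add: poly_sum)
    ultimately have "sl_equiv n ?G (\<lambda>i. if i = 0 then 1 else 0)" by (intro Suc.IH)
    moreover have "comm_ring_hom (\<lambda>x :: 'a mpoly. [:x:])" by unfold_locales (auto simp: one_pCons)
    ultimately have "sl_equiv n (\<lambda>i. [:?G i:]) (\<lambda>i. [:if i = 0 then 1 else 0:])"
      by (rule sl_equiv_hom[rotated])
    \<comment> \<open>Back in the multivariate ring, \<open>from_upoly\<close> restores
      \<open>f\<close> on the left and fixes 0 and 1 on the right.\<close>
    from sl_equiv_hom[OF comm_ring_hom_from_upoly sl_equiv_trans[OF s1 this], of B N]
    have "sl_equiv n f (\<lambda>i. from_upoly B N [:if i = 0 then 1 else 0:])"
      by (simp add: from_to_upoly)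
    moreover interpret \<Psi>: comm_ring_hom "from_upoly B N :: 'a mpoly poly \<Rightarrow> _" by (rule comm_ring_hom_from_upoly)
    have "from_upoly B N [:if i = 0 then 1 else 0:] = (if i = 0 then 1 else 0 :: 'a mpoly)" for i :: nat
      by (simp add: one_pCons[symmetric])
    ultimately show ?thesis by simp
  qed
  show ?case
  proof (cases "f 0 = 0")
    case True
    obtain j where j: "j < n" "f j \<noteq> 0"
      using Suc.prems(1) by (metis (no_types, lifting) lessThan_iff mult_zero_right sum.neutral zero_neq_one)
    \<comment> \<open>A unimodular row has a nonzero entry; adding it to entry 0 leads back to the
      previous case.\<close>
    let ?g = "f(0 := f 0 + 1 * f j)"
    have "j \<noteq> 0" using j True by metis
    then have s: "sl_equiv n f ?g" using n j by (intro sl_equiv_add) auto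
    obtain v where v: "(\<Sum>i<n. v i * ?g i) = 1" using sl_equiv_unimodular[OF s Suc.prems(1)] by blast
    have "sl_equiv n ?g (\<lambda>i. if i = 0 then 1 else 0)"
      by (rule *[OF v]) (use j True Suc.prems(2) in auto)
    then show ?thesis by (rule sl_equiv_trans[OF s])
  qed (use *[OF Suc.prems] in blast)
qed

section \<open>From unimodular rows to matrices with a right inverse\<close>

lemma mult_mat_index:
  assumes "A \<in> carrier_mat n m" "B \<in> carrier_mat m p" "i < n" "j < p"
  shows "(A * B) $$ (i,j) = (\<Sum>t<m. A $$ (i,t) * B $$ (t,j))"
  using assms by (auto simp: scalar_prod_def atLeast0LessThan intro!: sum.cong)

lemma one_smult_mat [simp]: "(1 :: 'a::semiring_1) \<cdot>\<^sub>m A = A"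
  by (rule eq_matI) auto

abbreviation ident_zero :: "nat \<Rightarrow> nat \<Rightarrow> 'a::{zero,one} mat" where
  "ident_zero k l \<equiv> mat k l (\<lambda>(i, j). if i = j then 1 else 0)"

text \<open>Once column operations have turned the first row into (1, 0, ..., 0), the right inverse
  has that first row as well, so the block of the remaining rows and columns again has a right
  inverse. The inequality \<open>k < l\<close> passes to this block and provides the two columns
  that the row theorem asks for.\<close>

theorem quillen_suslin_mat:
  fixes A :: "'a::field mpoly mat"
  assumes "A \<in> carrier_mat k l" "C \<in> carrier_mat l k" "A * C = 1\<^sub>m k" "k < l"
  shows "\<exists>B\<in>carrier_mat l l. det B = 1 \<and> A * B = ident_zero k l"
  using assms
proof (induction k arbitrary: A C l)
  case 0
  then show ?case by (intro bexI[of _ "1\<^sub>m l"]) auto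
next
  case (Suc k)
  note A = Suc.prems(1) and C = Suc.prems(2)
  obtain l' where l: "l = Suc l'" using Suc.prems(4) by (cases l) auto
  have kl: "k < l'" and l2: "2 \<le> l" using Suc.prems(4) l by auto
  have sh: "(\<Sum>t<l. f t) = f 0 + (\<Sum>t<l'. f (Suc t))" for f :: "nat \<Rightarrow> 'a mpoly"
    unfolding l by (rule sum.lessThan_Suc_shift)
  let ?f = "\<lambda>j. A $$ (0,j)"
  have "(\<Sum>j<l. C $$ (j,0) * ?f j) = (A * C) $$ (0,0)"
    by (subst mult_mat_index[OF A C]) (auto simp: mult.commute)
  then have u: "(\<Sum>j<l. C $$ (j,0) * ?f j) = 1" using Suc.prems(3) by simp
  define N where "N = Suc (Max (\<Union>j<l. vars (?f j)))"
  have fin: "finite (\<Union>j<l. vars (?f j))" by (auto simp: vars_def)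
  have "vars (?f j) \<subseteq> {..<N}" if "j < l" for j
    using that by (auto simp: N_def less_Suc_eq_le intro!: Max_ge[OF fin])
  from quillen_suslin_row[OF l2 u this] obtain Q where
    Q: "Q \<in> carrier_mat l l" "det Q = 1" "Q *\<^sub>v vec l ?f = vec l (\<lambda>i. if i = 0 then 1 else 0)"
    by (auto simp: sl_equiv_def)
  \<comment> \<open>The row theorem acts on column vectors from the left, hence the
    transpose.\<close>
  define B1 where "B1 = transpose_mat Q"
  have B1: "B1 \<in> carrier_mat l l" "det B1 = 1"
    using Q det_transpose[OF Q(1)] by (auto simp: B1_def)
  define M where "M = A * B1"
  have M: "M \<in> carrier_mat (Suc k) l" using A B1 by (simp add: M_def)
  have M0: "M $$ (0,j) = (if j = 0 then 1 else 0)" if j: "j < l" for j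
  proof -
    have "M $$ (0,j) = (\<Sum>t<l. A $$ (0,t) * B1 $$ (t,j))"
      unfolding M_def by (rule mult_mat_index[OF A B1(1) _ j]) simp
    also have "\<dots> = (Q *\<^sub>v vec l ?f) $ j"
      using j Q(1) by (auto simp: B1_def scalar_prod_def atLeast0LessThan mult.commute intro!: sum.cong)
    finally show ?thesis using j by (simp add: Q(3))
  qed
  \<comment> \<open>As \<open>det B1 = 1\<close>, the adjugate inverts \<open>B1\<close>, and
    \<open>C1\<close> is a right inverse of \<open>M\<close>.\<close>
  define C1 where "C1 = adj_mat B1 * C"
  note adj = adj_mat[OF B1(1)]
  have C1: "C1 \<in> carrier_mat l (Suc k)" using adj C by (simp add: C1_def)
  have AB: "A * (B1 * adj_mat B1) = M * adj_mat B1"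
    unfolding M_def by (rule assoc_mult_mat[OF A B1(1) adj(1), symmetric])
  have "M * C1 = A * (B1 * adj_mat B1) * C"
    unfolding AB C1_def by (rule assoc_mult_mat[OF M adj(1) C, symmetric])
  also have "\<dots> = 1\<^sub>m (Suc k)" using adj(2) B1(2) A Suc.prems(3) by simp
  finally have MC: "M * C1 = 1\<^sub>m (Suc k)" .
  \<comment> \<open>The first row of \<open>M\<close> is a unit vector, so the first row of
    \<open>M * C1\<close> is that of \<open>C1\<close>.\<close>
  have C10: "C1 $$ (0,j) = (if j = 0 then 1 else 0)" if j: "j < Suc k" for j
  proof -
    have "(M * C1) $$ (0,j) = (\<Sum>t<l. M $$ (0,t) * C1 $$ (t,j))"
      by (rule mult_mat_index[OF M C1 _ j]) simp
    also have "\<dots> = C1 $$ (0,j)" unfolding sh by (simp add: M0 l)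
    finally show ?thesis using j by (auto simp: MC)
  qed
  define A' where "A' = mat k l' (\<lambda>(i,j). M $$ (Suc i, Suc j))"
  define C' where "C' = mat l' k (\<lambda>(i,j). C1 $$ (Suc i, Suc j))"
  have A': "A' \<in> carrier_mat k l'" and C': "C' \<in> carrier_mat l' k"
    by (auto simp: A'_def C'_def)
  have "A' * C' = 1\<^sub>m k"
  proof (rule eq_matI)
    fix i j assume "i < dim_row (1\<^sub>m k :: 'a mpoly mat)" "j < dim_col (1\<^sub>m k :: 'a mpoly mat)"
    then have ij: "i < k" "j < k" by auto
    have "(M * C1) $$ (Suc i, Suc j) = (\<Sum>t<l. M $$ (Suc i,t) * C1 $$ (t,Suc j))"
      by (rule mult_mat_index[OF M C1]) (use ij in auto)
    also have "\<dots> = (\<Sum>t<l'. A' $$ (i,t) * C' $$ (t,j))"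
      unfolding sh using C10[of "Suc j"] ij by (simp add: A'_def C'_def)
    also have "\<dots> = (A' * C') $$ (i,j)" by (rule mult_mat_index[OF A' C' ij, symmetric])
    finally show "(A' * C') $$ (i,j) = 1\<^sub>m k $$ (i,j)" using ij by (simp add: MC)
  qed (use A' C' in auto)
  from Suc.IH[OF A' C' this kl] obtain B' where
    B': "B' \<in> carrier_mat l' l'" "det B' = 1" "A' * B' = ident_zero k l'" by blast
  define B2 where "B2 = four_block_mat (1\<^sub>m 1) (0\<^sub>m 1 l') (0\<^sub>m l' 1) B'"
  have B2: "B2 \<in> carrier_mat l l"
    unfolding B2_def l using four_block_carrier_mat[of "1\<^sub>m 1" 1 1 B' l' l'] B'(1) by simp
  have "det B2 = det (1\<^sub>m 1 :: 'a mpoly mat) * det B'"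
    unfolding B2_def by (rule det_four_block_mat_upper_right_zero) (use B' in auto)
  then have detB2: "det B2 = 1" using B'(2) by simp
  \<comment> \<open>Subtracts \<open>M $$ (i,0)\<close> times column \<open>i\<close> from column 0.
    The columns 1 to \<open>k\<close> of the product formed next are unit vectors, so this clears
    column 0 below its first entry.\<close>
  define B3 where "B3 = mat l l (\<lambda>(i,j). if i = j then 1 else if j = 0 \<and> i < Suc k then - M $$ (i,0) else 0)"
  have B3: "B3 \<in> carrier_mat l l" by (simp add: B3_def)
  have "det B3 = prod_list (diag_mat B3)"
    by (rule det_lower_triangular[OF _ B3]) (auto simp: B3_def)
  also have "diag_mat B3 = replicate l 1"
    by (rule nth_equalityI) (auto simp: diag_mat_def B3_def)
  finally have detB3: "det B3 = 1" by simp
  define N where "N = M * B2"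
  have N: "N \<in> carrier_mat (Suc k) l" using M B2 by (simp add: N_def)
  have B2ij: "B2 $$ (i,j) = (if i = 0 then if j = 0 then 1 else 0 else if j = 0 then 0 else B' $$ (i - 1, j - 1))"
    if "i < l" "j < l" for i j
  proof -
    have d: "dim_row B' = l'" "dim_col B' = l'" using B'(1) by auto
    show ?thesis
      using that[unfolded l] by (cases i; cases j) (simp_all add: B2_def d)
  qed
  have Nij: "N $$ (i,j) = (if j = 0 then M $$ (i,0) else if i = j then 1 else 0)" if ij: "i < Suc k" "j < l" for i j
  proof -
    have "N $$ (i,j) = (\<Sum>t<l. M $$ (i,t) * B2 $$ (t,j))"
      unfolding N_def by (rule mult_mat_index[OF M B2 ij])
    also have "\<dots> = M $$ (i,0) * B2 $$ (0,j) + (\<Sum>t<l'. M $$ (i,Suc t) * B2 $$ (Suc t,j))"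
      by (rule sh)
    also have "\<dots> = (if j = 0 then M $$ (i,0) else if i = j then 1 else 0)"
    proof (cases "j = 0")
      case True
      then show ?thesis using l by (simp add: B2ij)
    next
      case j: False
      show ?thesis
      proof (cases "i = 0")
        case True
        then show ?thesis using j l ij by (simp add: B2ij M0)
      next
        case False
        then have "(\<Sum>t<l'. M $$ (i,Suc t) * B2 $$ (Suc t,j)) = (\<Sum>t<l'. A' $$ (i - 1,t) * B' $$ (t,j - 1))"
          using ij j l by (intro sum.cong) (auto simp: A'_def B2ij)
        also have "\<dots> = (A' * B') $$ (i - 1, j - 1)"
          by (rule mult_mat_index[OF A' B'(1), symmetric]) (use ij j l False in auto)
        also have "\<dots> = (if i = j then 1 else 0)"
          unfolding B'(3) using ij j l False by auto
        finally show ?thesis using j ij l by (simp add: B2ij)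
      qed
    qed
    finally show ?thesis .
  qed
  have "N * B3 = ident_zero (Suc k) l"
  proof (rule eq_matI)
    fix i j assume "i < dim_row (ident_zero (Suc k) l :: 'a mpoly mat)" "j < dim_col (ident_zero (Suc k) l :: 'a mpoly mat)"
    then have ij: "i < Suc k" "j < l" by auto
    have "(N * B3) $$ (i,j) = (\<Sum>t<l. N $$ (i,t) * B3 $$ (t,j))"
      by (rule mult_mat_index[OF N B3 ij])
    also have "\<dots> = (if i = j then 1 else 0)"
    proof (cases "j = 0")
      case False
      have "(\<Sum>t<l. N $$ (i,t) * B3 $$ (t,j)) = (\<Sum>t<l. if t = j then N $$ (i,t) else 0)"
        by (rule sum.cong) (use ij False in \<open>auto simp: B3_def\<close>)
      then show ?thesis using ij False by (simp add: Nij)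
    next
      case True
      have "(\<Sum>t<l. N $$ (i,t) * B3 $$ (t,0)) = N $$ (i,0) * B3 $$ (0,0) + (\<Sum>t<l'. N $$ (i,Suc t) * B3 $$ (Suc t,0))"
        by (rule sh)
      also have "(\<Sum>t<l'. N $$ (i,Suc t) * B3 $$ (Suc t,0)) = (\<Sum>t<l'. if Suc t = i then - M $$ (i,0) else 0)"
        by (rule sum.cong) (use ij l in \<open>auto simp: B3_def Nij\<close>)
      also have "\<dots> = (if i = 0 then 0 else - M $$ (i,0))"
      proof (cases i)
        case i: (Suc i')
        then have "i' < l'" using ij kl by simp
        then have "(\<Sum>t<l'. if Suc t = Suc i' then c else 0) = c" for c :: "'a mpoly" by simp
        then show ?thesis unfolding i by simp
      qed simp
      finally show ?thesis using True ij l by (auto simp: Nij B3_def M0)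
    qed
    finally show "(N * B3) $$ (i,j) = ident_zero (Suc k) l $$ (i,j)" using ij by simp
  qed (use N B3 in auto)
  moreover have B12: "B1 * B2 \<in> carrier_mat l l" using B1 B2 by simp
  have "A * (B1 * B2 * B3) = N * B3"
    unfolding N_def M_def assoc_mult_mat[OF A B1(1) B2] by (rule assoc_mult_mat[OF A B12 B3, symmetric])
  ultimately have "A * (B1 * B2 * B3) = ident_zero (Suc k) l" by simp
  moreover have "det (B1 * B2 * B3) = 1"
    using B1 detB2 detB3 by (simp add: det_mult[OF B12 B3] det_mult[OF B1(1) B2])
  moreover have "B1 * B2 * B3 \<in> carrier_mat l l" using B12 B3 by simp
  ultimately show ?case by blast
qed

section \<open>Unimodular and right invertible matrices\<close>

lemma bij_betw_pick:
  assumes "finite J"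
  shows "bij_betw (pick J) {..<card J} J"
proof -
  have inj: "inj_on (pick J) {..<card J}"
  proof (rule inj_onI)
    fix x y assume *: "x \<in> {..<card J}" "y \<in> {..<card J}" "pick J x = pick J y"
    then show "x = y" using pick_mono[of x J y] pick_mono[of y J x]
      by (metis lessThan_iff nat_neq_iff)
  qed
  moreover have "pick J ` {..<card J} = J"
    by (rule card_subset_eq[OF assms]) (use pick_in_set[of _ J] card_image[OF inj] in auto)
  ultimately show ?thesis by (simp add: bij_betw_def)
qed

lemma submatrix_columns:
  assumes A: "A \<in> carrier_mat k l" and J: "J \<subseteq> {..<l}" "card J = k"
  shows "submatrix A {..<dim_row A} J = mat k k (\<lambda>(i,j). A $$ (i, pick J j))"
proof -
  have c: "{i. i < k \<and> i \<in> {..<k}} = {..<k}" "{j. j < l \<and> j \<in> J} = J" using J by auto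
  have pk: "pick {..<k} i = i" if "i < k" for i
  proof -
    have "{a. a < k \<and> a \<in> UNIV} = {..<k}" by auto
    then have "pick UNIV i = pick {..<k} i" using pick_reduce_set[of i k UNIV] that by simp
    then show ?thesis by (simp add: pick_UNIV)
  qed
  show ?thesis
    by (rule eq_matI) (use A J in \<open>auto simp: submatrix_def c pk simp del: lessThan_iff\<close>)
qed

text \<open>The \<open>x\<close> for which \<open>x\<close> times the identity factors through
  \<open>A\<close> form an ideal. It contains each maximal minor: the adjugate of the submatrix,
  padded with zero rows, is the second factor.\<close>

lemma right_inverse_of_minors:
  fixes A :: "'a::field mpoly mat"
  assumes A: "A \<in> carrier_mat k l"
    and one: "\<And>T. type_ideal T \<Longrightarrow> maximal_minors A \<subseteq> T \<Longrightarrow> 1 \<in> T"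
  shows "\<exists>C\<in>carrier_mat l k. A * C = 1\<^sub>m k"
proof -
  define T where "T = {x. \<exists>C\<in>carrier_mat l k. A * C = x \<cdot>\<^sub>m 1\<^sub>m k}"
  have "type_ideal T"
    unfolding type_ideal_def
  proof (intro conjI ballI allI)
    show "0 \<in> T" unfolding T_def using A
      by (intro CollectI bexI[of _ "0\<^sub>m l k"]) auto
    fix x assume "x \<in> T"
    then obtain C where C: "C \<in> carrier_mat l k" "A * C = x \<cdot>\<^sub>m 1\<^sub>m k" by (auto simp: T_def)
    show "c * x \<in> T" for c
      unfolding T_def using mult_smult_distrib[OF A C(1), of c] C
      by (intro CollectI bexI[of _ "c \<cdot>\<^sub>m C"]) auto
    fix y assume "y \<in> T"
    then obtain D where D: "D \<in> carrier_mat l k" "A * D = y \<cdot>\<^sub>m 1\<^sub>m k" by (auto simp: T_def)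
    show "x + y \<in> T"
      unfolding T_def using mult_add_distrib_mat[OF A C(1) D(1)] C D
      by (intro CollectI bexI[of _ "C + D"]) (auto simp: add_smult_distrib_right_mat[of _ k k])
  qed
  moreover have "maximal_minors A \<subseteq> T"
  proof
    fix x assume "x \<in> maximal_minors A"
    then obtain J where x: "x = det (submatrix A {..<dim_row A} J)" and J: "J \<subseteq> {..<l}" "card J = k"
      using A by (auto simp: maximal_minors_def)
    define S where "S = mat k k (\<lambda>(i,j). A $$ (i, pick J j))"
    have S: "S \<in> carrier_mat k k" by (simp add: S_def)
    have xS: "x = det S" unfolding x submatrix_columns[OF A J] S_def ..
    have finJ: "finite J" using J finite_subset by blast
    note bij = bij_betw_pick[OF finJ, unfolded J(2)]
    define p where "p = inv_into {..<k} (pick J)"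
    have p: "p (pick J s) = s" if "s < k" for s
      unfolding p_def using bij that by (simp add: bij_betw_def)
    define C where "C = mat l k (\<lambda>(i,j). if i \<in> J then adj_mat S $$ (p i, j) else 0)"
    have C: "C \<in> carrier_mat l k" by (simp add: C_def)
    have "A * C = x \<cdot>\<^sub>m 1\<^sub>m k"
    proof (rule eq_matI)
      fix i j assume "i < dim_row (x \<cdot>\<^sub>m 1\<^sub>m k)" "j < dim_col (x \<cdot>\<^sub>m 1\<^sub>m k)"
      then have ij: "i < k" "j < k" by auto
      have "(A * C) $$ (i,j) = (\<Sum>t<l. A $$ (i,t) * C $$ (t,j))"
        by (rule mult_mat_index[OF A C ij])
      also have "\<dots> = (\<Sum>t\<in>J. A $$ (i,t) * adj_mat S $$ (p t, j))"
        by (rule sum.mono_neutral_cong_right) (use J ij in \<open>auto simp: C_def\<close>)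
      also have "\<dots> = (\<Sum>s<k. A $$ (i,pick J s) * adj_mat S $$ (p (pick J s), j))"
        by (rule sum.reindex_bij_betw[OF bij, symmetric])
      also have "\<dots> = (\<Sum>s<k. S $$ (i,s) * adj_mat S $$ (s, j))"
        using ij by (intro sum.cong) (auto simp: p S_def)
      also have "\<dots> = (S * adj_mat S) $$ (i,j)"
        by (rule mult_mat_index[OF S adj_mat(1)[OF S] ij, symmetric])
      finally show "(A * C) $$ (i,j) = (x \<cdot>\<^sub>m 1\<^sub>m k) $$ (i,j)"
        by (simp add: adj_mat(2)[OF S] xS)
    qed (use A C in auto)
    then show "x \<in> T" using C by (auto simp: T_def)
  qed
  ultimately have "1 \<in> T" by (rule one)
  then show ?thesis by (simp add: T_def one_smult_mat)
qed

text \<open>A repeated column makes the determinant vanish; otherwise the columns are those of a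
  maximal minor in another order, which only costs a sign.\<close>

lemma det_columns_in_minor_ideal:
  fixes A :: "'a::field mpoly mat"
  assumes A: "A \<in> carrier_mat k l" and T: "type_ideal T" "maximal_minors A \<subseteq> T"
    and \<phi>: "\<phi> ` {..<k} \<subseteq> {..<l}"
  shows "det (mat k k (\<lambda>(i,j). A $$ (i, \<phi> j))) \<in> T"
proof (cases "inj_on \<phi> {..<k}")
  case False
  then obtain i j where ij: "i < k" "j < k" "i \<noteq> j" "\<phi> i = \<phi> j" by (auto simp: inj_on_def)
  have "det (mat k k (\<lambda>(i,j). A $$ (i, \<phi> j))) = 0"
    by (rule det_identical_columns[of _ k i j]) (use ij in auto)
  then show ?thesis using type_ideal_0[OF T(1)] by simp
next
  case True
  let ?J = "\<phi> ` {..<k}"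
  have cJ: "card ?J = k" using card_image[OF True] by simp
  define S where "S = mat k k (\<lambda>(i,j). A $$ (i, pick ?J j))"
  have "det (submatrix A {..<dim_row A} ?J) \<in> maximal_minors A"
    unfolding maximal_minors_def using \<phi> cJ A by auto
  then have "det S \<in> T"
    using T(2) submatrix_columns[OF A \<phi> cJ] by (auto simp: S_def)
  have bij: "bij_betw (pick ?J) {..<k} ?J" using bij_betw_pick[of ?J] cJ by simp
  \<comment> \<open>The permutation with \<open>pick ?J (\<pi> j) = \<phi> j\<close>, extended by
    the identity as \<open>permutes\<close> demands.\<close>
  define \<pi> where "\<pi> = (\<lambda>j. if j < k then inv_into {..<k} (pick ?J) (\<phi> j) else j)"
  have "bij_betw (inv_into {..<k} (pick ?J) \<circ> \<phi>) {..<k} {..<k}"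
    by (rule bij_betw_trans[OF _ bij_betw_inv_into[OF bij]]) (use True in \<open>simp add: bij_betw_def\<close>)
  then have "bij_betw \<pi> {..<k} {..<k}"
    by (rule iffD1[OF bij_betw_cong, rotated]) (auto simp: \<pi>_def)
  then have \<pi>: "\<pi> permutes {0..<k}"
    unfolding atLeast0LessThan by (rule bij_imp_permutes) (auto simp: \<pi>_def)
  have p\<pi>: "pick ?J (\<pi> j) = \<phi> j" "\<pi> j < k" if "j < k" for j
  proof -
    have "\<phi> j \<in> pick ?J ` {..<k}" using bij that by (auto simp: bij_betw_def)
    from f_inv_into_f[OF this] inv_into_into[OF this] that
    show "pick ?J (\<pi> j) = \<phi> j" "\<pi> j < k" by (auto simp: \<pi>_def)
  qed
  have ST: "S\<^sup>T \<in> carrier_mat k k" by (simp add: S_def)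
  have "mat k k (\<lambda>(i,j). A $$ (i, \<phi> j)) = (mat k k (\<lambda>(i,j). S\<^sup>T $$ (\<pi> i, j)))\<^sup>T"
    by (rule eq_matI) (auto simp: S_def p\<pi>)
  then have "det (mat k k (\<lambda>(i,j). A $$ (i, \<phi> j))) = det (mat k k (\<lambda>(i,j). S\<^sup>T $$ (\<pi> i, j)))"
    by (simp add: det_transpose[of _ k])
  also have "\<dots> = signof \<pi> * det (S\<^sup>T)" by (rule det_permute_rows[OF ST \<pi>])
  also have "det (S\<^sup>T) = det S" by (rule det_transpose[of _ k]) (simp add: S_def)
  finally show ?thesis using type_ideal_mult[OF T(1) \<open>det S \<in> T\<close>] by simp
qed

text \<open>The Cauchy--Binet formula up to the coefficients, which do not matter for ideal membership.\<close>

lemma det_mult_in_minor_ideal: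
  fixes A :: "'a::field mpoly mat"
  assumes A: "A \<in> carrier_mat k l" and C: "C \<in> carrier_mat l k"
    and T: "type_ideal T" "maximal_minors A \<subseteq> T"
  shows "det (A * C) \<in> T"
proof -
  let ?P = "{p. p permutes {0..<k}}" and ?F = "Pi\<^sub>E {..<k} (\<lambda>_. {..<l})"
  have AC: "A * C \<in> carrier_mat k k" using A C by simp
  have "det (A * C) = (\<Sum>p\<in>?P. signof p * (\<Prod>j<k. \<Sum>t<l. A $$ (p j,t) * C $$ (t,j)))"
    unfolding det_col[OF AC]
  proof (intro sum.cong arg_cong2[of _ _ _ _ "(*)"] prod.cong refl)
    fix p j assume "p \<in> ?P" "j \<in> {..<k}"
    then show "(A * C) $$ (p j, j) = (\<Sum>t<l. A $$ (p j,t) * C $$ (t,j))"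
      using permutes_in_image[of p "{0..<k}" j] by (intro mult_mat_index[OF A C]) auto
  qed
  also have "\<dots> = (\<Sum>p\<in>?P. \<Sum>\<phi>\<in>?F. signof p * (\<Prod>j<k. A $$ (p j,\<phi> j) * C $$ (\<phi> j,j)))"
    by (simp add: prod_sum_PiE sum_distrib_left)
  also have "\<dots> = (\<Sum>\<phi>\<in>?F. (\<Prod>j<k. C $$ (\<phi> j,j)) * (\<Sum>p\<in>?P. signof p * (\<Prod>j<k. A $$ (p j,\<phi> j))))"
    by (subst sum.swap) (simp add: sum_distrib_left prod.distrib mult_ac)
  also have "\<dots> = (\<Sum>\<phi>\<in>?F. (\<Prod>j<k. C $$ (\<phi> j,j)) * det (mat k k (\<lambda>(i,j). A $$ (i, \<phi> j))))"
  proof (intro sum.cong arg_cong2[of _ _ _ _ "(*)"] refl)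
    fix \<phi>
    have "(\<Prod>j<k. A $$ (p j,\<phi> j)) = (\<Prod>j<k. mat k k (\<lambda>(i,j). A $$ (i, \<phi> j)) $$ (p j, j))" if "p \<in> ?P" for p
      using permutes_in_image[of p "{0..<k}"] that by (intro prod.cong) auto
    then show "(\<Sum>p\<in>?P. signof p * (\<Prod>j<k. A $$ (p j,\<phi> j))) = det (mat k k (\<lambda>(i,j). A $$ (i, \<phi> j)))"
      by (subst det_col[of _ k]) auto
  qed
  also have "\<dots> \<in> T"
    by (intro type_ideal_sum[OF T(1)] type_ideal_mult[OF T(1)] det_columns_in_minor_ideal[OF A T])
      auto
  finally show ?thesis .
qed

text \<open>With more rows than columns there are no maximal minors, so the determinant of the
  identity would lie in the zero ideal.\<close>

lemma right_invertible_dim_le: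
  fixes A :: "'a::field mpoly mat"
  assumes A: "A \<in> carrier_mat k l" and C: "C \<in> carrier_mat l k" and AC: "A * C = 1\<^sub>m k"
  shows "k \<le> l"
proof (rule ccontr)
  assume kl: "\<not> k \<le> l"
  have "type_ideal {0 :: 'a mpoly}" by (auto simp: type_ideal_def)
  moreover have "maximal_minors A = {}"
    using A kl card_mono[of "{..<l}"] by (fastforce simp: maximal_minors_def)
  ultimately have "det (A * C) \<in> {0}" by (intro det_mult_in_minor_ideal[OF A C]) auto
  then show False by (simp add: AC)
qed

subsection \<open>Descent to finitely many indeterminates\<close>

text \<open>
  The type \<open>'a mpoly\<close> has infinitely many indeterminates. Right inverses and solutions of the
  unimodular matrix problem found there are moved to \<open>mpoly_ring V\<close> by the retraction that kills
  the indeterminates outside \<open>V\<close>.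
\<close>

definition restrict_vars :: "nat set \<Rightarrow> 'a::field mpoly \<Rightarrow> 'a mpoly" where
  "restrict_vars V = subst (\<lambda>v. if v \<in> V then Var v else 0)"

lemma restrict_vars_id: "vars p \<subseteq> V \<Longrightarrow> restrict_vars V p = p"
  unfolding restrict_vars_def by (rule subst_id) auto

lemma vars_restrict_vars: "vars (restrict_vars V p) \<subseteq> V"
  unfolding restrict_vars_def by (rule vars_subst_subset) auto

lemma comm_ring_hom_restrict_vars: "comm_ring_hom (restrict_vars V)"
  unfolding restrict_vars_def by (rule comm_ring_hom_subst)

lemma carrier_mpoly_ring [simp]: "p \<in> carrier (mpoly_ring V) \<longleftrightarrow> vars p \<subseteq> V"
  by (simp add: mpoly_ring_def)

lemma mpoly_ring_simps [simp]:
  "zero (mpoly_ring V) = 0" "one (mpoly_ring V) = 1"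
  "p \<oplus>\<^bsub>mpoly_ring V\<^esub> q = p + q" "p \<otimes>\<^bsub>mpoly_ring V\<^esub> q = p * q"
  by (simp_all add: mpoly_ring_def)

lemma ring_mpoly_ring: "ring (mpoly_ring V)"
  using cring_mpoly_ring by (rule cring.axioms)

lemma a_inv_mpoly_ring:
  assumes "vars p \<subseteq> V"
  shows "\<ominus>\<^bsub>mpoly_ring V\<^esub> p = - p"
proof -
  interpret ring "mpoly_ring V" by (rule ring_mpoly_ring)
  show ?thesis using minus_equality[of "- p" p] assms by (simp add: vars_uminus)
qed

lemma ideal_mpoly_ringI:
  assumes sub: "\<And>x. x \<in> I \<Longrightarrow> vars x \<subseteq> V" and zero: "0 \<in> I"
    and add: "\<And>x y. x \<in> I \<Longrightarrow> y \<in> I \<Longrightarrow> x + y \<in> I"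
    and mult: "\<And>x c. x \<in> I \<Longrightarrow> vars c \<subseteq> V \<Longrightarrow> c * x \<in> I"
  shows "ideal I (mpoly_ring V)"
proof (rule idealI[OF ring_mpoly_ring])
  interpret ring "mpoly_ring V" by (rule ring_mpoly_ring)
  show "subgroup I (add_monoid (mpoly_ring V))"
  proof (rule add.subgroupI)
    fix x assume x: "x \<in> I"
    then show "\<ominus>\<^bsub>mpoly_ring V\<^esub> x \<in> I"
      using mult[of x "- 1"] sub[of x] by (simp add: a_inv_mpoly_ring vars_uminus)
  qed (use assms in auto)
qed (use mult in \<open>auto simp: mult.commute\<close>)

lemma ideal_mpoly_ringD:
  assumes "ideal I (mpoly_ring V)"
  shows "x \<in> I \<Longrightarrow> vars x \<subseteq> V" "0 \<in> I" "x \<in> I \<Longrightarrow> y \<in> I \<Longrightarrow> x + y \<in> I"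
    "x \<in> I \<Longrightarrow> vars c \<subseteq> V \<Longrightarrow> c * x \<in> I"
  using ideal.Icarr[OF assms] additive_subgroup.zero_closed[OF ideal.axioms(1)[OF assms]]
    additive_subgroup.a_closed[OF ideal.axioms(1)[OF assms]] ideal.I_l_closed[OF assms]
  by (auto simp del: subset_iff)

text \<open>Links generated ideals in a carrier to ideals of the whole type: the trace of
  \<open>T\<close> on the carrier is an ideal of \<open>mpoly_ring V\<close>.\<close>

lemma genideal_subset_type_ideal:
  assumes "type_ideal T" "S \<subseteq> T" "S \<subseteq> carrier (mpoly_ring V)"
  shows "genideal (mpoly_ring V) S \<subseteq> T"
proof -
  interpret ring "mpoly_ring V" by (rule ring_mpoly_ring)
  have "ideal (T \<inter> carrier (mpoly_ring V)) (mpoly_ring V)"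
    by (rule ideal_mpoly_ringI)
      (use type_ideal_0[OF assms(1)] type_ideal_add[OF assms(1)] type_ideal_mult[OF assms(1)] in
        \<open>auto simp: vars_add_subset vars_mult_subset simp del: subset_iff\<close>)
  then have "Idl\<^bsub>mpoly_ring V\<^esub> S \<subseteq> T \<inter> carrier (mpoly_ring V)"
    using assms by (intro genideal_minimal) auto
  then show ?thesis by simp
qed

lemma vars_det_subset:
  assumes A: "A \<in> carrier_mat k k" and v: "\<And>i j. i < k \<Longrightarrow> j < k \<Longrightarrow> vars (A $$ (i,j)) \<subseteq> V"
  shows "vars (det A) \<subseteq> V"
proof -
  have "vars (signof p :: 'a mpoly) \<subseteq> V" for p :: "nat \<Rightarrow> nat"
    by (auto simp: sign_def vars_uminus)
  then show ?thesis
    unfolding det_col[OF A]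
    by (intro vars_sum_subset vars_mult_subset vars_prod_subset v)
      (auto dest: permutes_in_image)
qed

lemma maximal_minors_carrier:
  assumes A: "A \<in> carrier_mat k l" and v: "\<And>i j. i < k \<Longrightarrow> j < l \<Longrightarrow> vars (A $$ (i,j)) \<subseteq> V"
  shows "maximal_minors A \<subseteq> carrier (mpoly_ring V)"
proof
  fix x assume "x \<in> maximal_minors A"
  then obtain J where x: "x = det (submatrix A {..<dim_row A} J)" and J: "J \<subseteq> {..<l}" "card J = k"
    using A by (auto simp: maximal_minors_def)
  have "finite J" using J finite_subset by blast
  then have "pick J j < l" if "j < k" for j using pick_in_set[of j J] that J by auto
  then have "vars (mat k k (\<lambda>(i,j). A $$ (i, pick J j)) $$ (i,j)) \<subseteq> V" if "i < k" "j < k" for i j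
    using v[of i "pick J j"] that by simp
  then have "vars x \<subseteq> V" unfolding x submatrix_columns[OF A J]
    by (intro vars_det_subset[of _ k]) simp_all
  then show "x \<in> carrier (mpoly_ring V)" by simp
qed

lemma elements_mat_subset_iff:
  "A \<in> carrier_mat k l \<Longrightarrow> elements_mat A \<subseteq> S \<longleftrightarrow> (\<forall>i<k. \<forall>j<l. A $$ (i,j) \<in> S)"
  by (auto 0 3 simp: elements_mat_def)

text \<open>\<open>C\<close> is found over the whole type and may involve indeterminates outside
  \<open>V\<close>; they disappear when a solution is built from it.\<close>

lemma unimodular_imp_right_inverse:
  assumes A: "A \<in> carrier_mat k l" and U: "unimodular (mpoly_ring V) A"
  shows "\<exists>C\<in>carrier_mat l k. A * C = 1\<^sub>m k"
proof (rule right_inverse_of_minors[OF A])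
  fix T :: "'a mpoly set" assume T: "type_ideal T" "maximal_minors A \<subseteq> T"
  have "maximal_minors A \<subseteq> carrier (mpoly_ring V)"
    by (rule maximal_minors_carrier[OF A])
      (use U elements_mat_subset_iff[OF A] in \<open>auto simp: unimodular_def simp del: subset_iff\<close>)
  from genideal_subset_type_ideal[OF T this] U
  show "1 \<in> T" by (auto simp: unimodular_def)
qed

text \<open>The ideal of the minors, pulled back along the retraction, becomes an ideal of the whole
  type, where Cauchy--Binet puts \<open>det (A * C) = 1\<close> into it.\<close>

lemma right_inverse_imp_unimodular:
  assumes A: "A \<in> carrier_mat k l" and v: "\<And>i j. i < k \<Longrightarrow> j < l \<Longrightarrow> vars (A $$ (i,j)) \<subseteq> V"
    and C: "C \<in> carrier_mat l k" and AC: "A * C = 1\<^sub>m k"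
  shows "unimodular (mpoly_ring V) A"
proof -
  interpret R: ring "mpoly_ring V :: 'a mpoly ring" by (rule ring_mpoly_ring)
  interpret \<rho>: comm_ring_hom "restrict_vars V :: 'a mpoly \<Rightarrow> _" by (rule comm_ring_hom_restrict_vars)
  let ?G = "genideal (mpoly_ring V) (maximal_minors A)"
  have sub: "maximal_minors A \<subseteq> carrier (mpoly_ring V)" by (rule maximal_minors_carrier[OF A v])
  have G: "ideal ?G (mpoly_ring V)" by (rule R.genideal_ideal[OF sub])
  let ?T = "{p. restrict_vars V p \<in> ?G}"
  have "type_ideal ?T"
    unfolding type_ideal_def using ideal_mpoly_ringD[OF G]
    by (auto simp: \<rho>.hom_add \<rho>.hom_mult vars_restrict_vars)
  moreover have "maximal_minors A \<subseteq> ?T"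
  proof
    fix x assume x: "x \<in> maximal_minors A"
    then have "x \<in> carrier (mpoly_ring V)" using sub by blast
    then have "restrict_vars V x = x" by (intro restrict_vars_id) simp
    then show "x \<in> ?T" using x R.genideal_self[OF sub] by auto
  qed
  ultimately have "det (A * C) \<in> ?T" by (rule det_mult_in_minor_ideal[OF A C])
  then have "1 \<in> ?G" by (simp add: AC)
  then have "?G = carrier (mpoly_ring V)"
    using ideal.one_imp_carrier[OF G] by simp
  then show ?thesis
    unfolding unimodular_def elements_mat_subset_iff[OF A] using v by simp
qed

section \<open>Solutions of the unimodular matrix problem\<close>

lemma map_mat_restrict_vars_id:
  "A \<in> carrier_mat k l \<Longrightarrow> (\<And>i j. i < k \<Longrightarrow> j < l \<Longrightarrow> vars (A $$ (i,j)) \<subseteq> V) \<Longrightarrow>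
    map_mat (restrict_vars V) A = A"
  by (rule eq_matI) (auto simp: restrict_vars_id simp del: subset_iff)

text \<open>The determinant of \<open>A\<close> is a unit, so \<open>C\<close> has to be the
  adjugate of \<open>A\<close> divided by it.\<close>

lemma right_inverse_imp_left_inverse:
  fixes A C :: "'r::comm_ring_1 mat"
  assumes A: "A \<in> carrier_mat k k" and C: "C \<in> carrier_mat k k" and AC: "A * C = 1\<^sub>m k"
  shows "C * A = 1\<^sub>m k"
proof -
  have d: "det A * det C = 1" using det_mult[OF A C] AC by simp
  note adj = adj_mat[OF A]
  have "det A \<cdot>\<^sub>m C = adj_mat A * A * C"
    unfolding adj(3) mult_smult_assoc_mat[OF one_carrier_mat C] using C by simp
  also have "\<dots> = adj_mat A" using assoc_mult_mat[OF adj(1) A C] AC adj(1) by simp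
  finally have "det C \<cdot>\<^sub>m (det A \<cdot>\<^sub>m C) = det C \<cdot>\<^sub>m adj_mat A" by simp
  moreover have smult: "det C \<cdot>\<^sub>m (det A \<cdot>\<^sub>m X) = X" for X
    using d by (auto simp: mult.assoc[symmetric] mult.commute[of "det C"])
  ultimately have "C = det C \<cdot>\<^sub>m adj_mat A" by simp
  then have "C * A = (det C \<cdot>\<^sub>m adj_mat A) * A" by simp
  also have "\<dots> = det C \<cdot>\<^sub>m (det A \<cdot>\<^sub>m 1\<^sub>m k)"
    unfolding mult_smult_assoc_mat[OF adj(1) A] adj(3) ..
  finally show ?thesis unfolding smult .
qed

text \<open>A right inverse settles the square case and Quillen--Suslin the other one. The
  retraction fixes \<open>A\<close>, so it keeps the equations while it moves the solution into
  \<open>mpoly_ring V\<close>.\<close>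

lemma solves_UMP_exists:
  assumes A: "A \<in> carrier_mat k l" and v: "\<And>i j. i < k \<Longrightarrow> j < l \<Longrightarrow> vars (A $$ (i,j)) \<subseteq> V"
    and C: "C \<in> carrier_mat l k" and AC: "A * C = 1\<^sub>m k"
  shows "\<exists>B. solves_UMP (mpoly_ring V) A B"
proof -
  interpret \<rho>: comm_ring_hom "restrict_vars V :: 'a mpoly \<Rightarrow> _" by (rule comm_ring_hom_restrict_vars)
  let ?\<rho> = "map_mat (restrict_vars V :: 'a mpoly \<Rightarrow> _)"
  have elem: "elements_mat (?\<rho> B) \<subseteq> carrier (mpoly_ring V)" if "B \<in> carrier_mat l l" for B :: "'a mpoly mat"
    by (subst elements_mat_subset_iff[of _ l l]) (use that in \<open>simp_all add: vars_restrict_vars\<close>)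
  have \<rho>A: "?\<rho> A = A" by (rule map_mat_restrict_vars_id[OF A v])
  show ?thesis
  proof (cases "k = l")
    case True
    have C': "C \<in> carrier_mat l l" and A': "A \<in> carrier_mat l l" using A C True by auto
    have hom: "A * ?\<rho> C = ?\<rho> (A * C)" "?\<rho> C * A = ?\<rho> (C * A)"
      using \<rho>.mat_hom_mult[OF A' C'] \<rho>.mat_hom_mult[OF C' A'] \<rho>A by auto
    have "A * C = 1\<^sub>m l" using AC True by simp
    then have "A * ?\<rho> C = 1\<^sub>m l" "?\<rho> C * A = 1\<^sub>m l"
      unfolding hom right_inverse_imp_left_inverse[OF A' C' \<open>A * C = 1\<^sub>m l\<close>]
      by (simp_all only: \<rho>.mat_hom_one)
    then show ?thesis
      using elem[OF C'] C' A' by (intro exI[of _ "?\<rho> C"]) (simp add: solves_UMP_def inverts_mat_def)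
  next
    case False
    with right_invertible_dim_le[OF A C AC] have "k < l" by simp
    from quillen_suslin_mat[OF A C AC this] obtain B where
      B: "B \<in> carrier_mat l l" "det B = 1" "A * B = ident_zero k l" by blast
    have "?\<rho> (A * B) = A * ?\<rho> B" using \<rho>.mat_hom_mult[OF A B(1)] \<rho>A by simp
    moreover have "?\<rho> (ident_zero k l) = ident_zero k l" by (rule eq_matI) auto
    ultimately have "A * ?\<rho> B = ident_zero k l" using B(3) by simp
    moreover have "det (?\<rho> B) = 1" using B(2) by simp
    ultimately show ?thesis
      using elem[OF B(1)] B(1) A False by (intro exI[of _ "?\<rho> B"]) (auto simp: solves_UMP_def)
  qed
qed

text \<open>A common consequence of both branches of \<open>solves_UMP\<close>, so that the
  elimination treats them alike.\<close>

lemma solves_UMP_first_columns: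
  assumes A: "A \<in> carrier_mat k l" and B: "solves_UMP R A B" and ij: "i < k" "j < l"
  shows "(\<Sum>t<l. A $$ (i,t) * B $$ (t,j)) = (if i = j then 1 else 0)"
proof -
  have B': "B \<in> carrier_mat l l" using A B by (simp add: solves_UMP_def)
  have "(A * B) $$ (i,j) = (if i = j then 1 else 0)"
    using A B ij by (auto simp: solves_UMP_def inverts_mat_def split: if_splits)
  then show ?thesis using mult_mat_index[OF A B' ij] by simp
qed

text \<open>In the square case \<open>A\<close> itself inverts \<open>B\<close>, otherwise the
  adjugate does, as \<open>det B = 1\<close>. This makes the change of coordinates
  invertible.\<close>

lemma solves_UMP_inverse:
  fixes A :: "'a::field mpoly mat"
  assumes A: "A \<in> carrier_mat k l" and B: "solves_UMP (mpoly_ring V) A B"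
    and v: "\<And>i j. i < k \<Longrightarrow> j < l \<Longrightarrow> vars (A $$ (i,j)) \<subseteq> V"
  shows "\<exists>C\<in>carrier_mat l l. (\<forall>i<l. \<forall>j<l. vars (C $$ (i,j)) \<subseteq> V) \<and> C * B = 1\<^sub>m l \<and> B * C = 1\<^sub>m l"
proof (cases "k = l")
  case True
  then show ?thesis
    using A B v by (intro bexI[of _ A]) (auto simp: solves_UMP_def inverts_mat_def)
next
  case False
  have B': "B \<in> carrier_mat l l" "det B = 1" "\<forall>i<l. \<forall>j<l. vars (B $$ (i,j)) \<subseteq> V"
    using A B False elements_mat_subset_iff[of B l l] by (auto simp: solves_UMP_def simp del: subset_iff)
  interpret \<rho>: comm_ring_hom "restrict_vars V :: 'a mpoly \<Rightarrow> _" by (rule comm_ring_hom_restrict_vars)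
  let ?C = "map_mat (restrict_vars V) (adj_mat B)"
  note adj = adj_mat[OF B'(1)]
  have \<rho>B: "map_mat (restrict_vars V) B = B"
    by (rule map_mat_restrict_vars_id[OF B'(1)]) (use B' in blast)
  have "?C * B = map_mat (restrict_vars V) (adj_mat B * B)"
    using \<rho>.mat_hom_mult[OF adj(1) B'(1)] \<rho>B by simp
  moreover have "B * ?C = map_mat (restrict_vars V) (B * adj_mat B)"
    using \<rho>.mat_hom_mult[OF B'(1) adj(1)] \<rho>B by simp
  ultimately have "?C * B = 1\<^sub>m l" "B * ?C = 1\<^sub>m l"
    using adj(2,3) B'(2) \<rho>.mat_hom_one by simp_all
  then show ?thesis using adj(1) by (intro bexI[of _ ?C]) (simp_all add: vars_restrict_vars)
qed

section \<open>Blocks of indices\<close>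

lemma sum_block:
  assumes "mono_on {..<N} u" "d \<in> u ` {..<N}"
  shows "(\<Sum>j | j < N \<and> u j = d. f j) = (\<Sum>t<block_size u N d. f (block_start u N d + t))"
proof -
  have "{j. j < N \<and> u j = d} = {block_start u N d..<block_start u N d + block_size u N d}"
    by (rule block_eq) (use assms in auto)
  moreover have "sum f {a..<a + s} = (\<Sum>t<s. f (a + t))" for a s
    by (rule sum.reindex_bij_witness[of _ "\<lambda>t. a + t" "\<lambda>j. j - a"]) auto
  ultimately show ?thesis by simp
qed

text \<open>A block starts after all indices of smaller value. The sum is the offset in
  \<open>nth_concat_sorted\<close>, so each block of the concatenated tuple sits at its own
  indices.\<close>

lemma block_start_eq_sum:
  fixes u :: "nat \<Rightarrow> int"
  assumes u: "mono_on {..<N} u" and d: "d \<in> u ` {..<N}"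
  shows "block_start u N d = (\<Sum>d' | d' \<in> u ` {..<N} \<and> d' < d. block_size u N d')"
proof -
  let ?a = "block_start u N d"
  have a: "?a < N \<and> u ?a = d"
    unfolding block_start_def by (rule LeastI_ex) (use d in auto)
  have least: "u j = d \<Longrightarrow> j < N \<Longrightarrow> ?a \<le> j" for j
    unfolding block_start_def by (rule Least_le) simp
  have "{..<?a} = {j. j < N \<and> u j < d}"
  proof (intro subset_antisym subsetI)
    fix j assume "j \<in> {..<?a}"
    then have "j < N" "u j \<le> d" "u j \<noteq> d"
      using a least[of j] mono_onD[OF u, of j ?a] by auto
    then show "j \<in> {j. j < N \<and> u j < d}" by simp
  next
    fix j assume "j \<in> {j. j < N \<and> u j < d}"
    then show "j \<in> {..<?a}" using a mono_onD[OF u, of ?a j] by (cases "j < ?a") auto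
  qed
  then have "?a = card {j. j < N \<and> u j < d}" by (metis card_lessThan)
  also have "{j. j < N \<and> u j < d} = (\<Union>d'\<in>{d'. d' \<in> u ` {..<N} \<and> d' < d}. {j. j < N \<and> u j = d'})"
    by auto
  also have "card \<dots> = (\<Sum>d' | d' \<in> u ` {..<N} \<and> d' < d. card {j. j < N \<and> u j = d'})"
    by (rule card_UN_disjoint) auto
  finally show ?thesis by (simp add: block_size_def)
qed

lemma sum_block_size: "(\<Sum>d\<in>u ` {..<N}. block_size u N d) = N"
proof -
  have "{..<N} = (\<Union>d\<in>u ` {..<N}. {j. j < N \<and> u j = d})" by auto
  then have "N = card (\<Union>d\<in>u ` {..<N}. {j. j < N \<and> u j = d})" by (metis card_lessThan)
  also have "\<dots> = (\<Sum>d\<in>u ` {..<N}. card {j. j < N \<and> u j = d})"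
    by (rule card_UN_disjoint) auto
  finally show ?thesis by (simp add: block_size_def)
qed

lemma block_index:
  assumes u: "mono_on {..<N} u" and j: "j < N"
  shows "block_start u N (u j) \<le> j" "j - block_start u N (u j) < block_size u N (u j)"
proof -
  have "j \<in> {i. i < N \<and> u i = u j}" using j by simp
  also have "\<dots> = {block_start u N (u j)..<block_start u N (u j) + block_size u N (u j)}"
    by (rule block_eq[OF u]) (use j in auto)
  finally show "block_start u N (u j) \<le> j" "j - block_start u N (u j) < block_size u N (u j)"
    by auto
qed

lemma block_indexI:
  assumes u: "mono_on {..<N} u" and d: "d \<in> u ` {..<N}" and i: "i < block_size u N d"
  shows "block_start u N d + i < N" "u (block_start u N d + i) = d"
proof -
  have "block_start u N d + i \<in> {block_start u N d..<block_start u N d + block_size u N d}"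
    using i by simp
  also have "\<dots> = {j. j < N \<and> u j = d}"
    by (rule block_eq[OF u, symmetric]) (use d in auto)
  finally show "block_start u N d + i < N" "u (block_start u N d + i) = d" by auto
qed

lemma nth_concat_sorted:
  fixes ds :: "'d::linorder list"
  assumes "sorted_wrt (<) ds" "d \<in> set ds" "i < length (f d)"
  shows "concat (map f ds) ! ((\<Sum>d' | d' \<in> set ds \<and> d' < d. length (f d')) + i) = f d ! i"
  using assms
proof (induction ds)
  case (Cons c ds)
  show ?case
  proof (cases "d = c")
    case True
    then have e: "{d'. d' \<in> set (c # ds) \<and> d' < d} = {}" using Cons.prems(1) by auto
    show ?thesis using True Cons.prems(3) unfolding e by (simp add: nth_append)
  next
    case False
    then have "d \<in> set ds" "c < d" using Cons.prems by auto
    then have "{d'. d' \<in> set (c # ds) \<and> d' < d} = insert c {d'. d' \<in> set ds \<and> d' < d}" by auto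
    moreover have "c \<notin> {d'. d' \<in> set ds \<and> d' < d}" using Cons.prems(1) by auto
    ultimately have "(\<Sum>d' | d' \<in> set (c # ds) \<and> d' < d. length (f d')) =
        length (f c) + (\<Sum>d' | d' \<in> set ds \<and> d' < d. length (f d'))" by simp
    then show ?thesis using Cons.IH Cons.prems \<open>d \<in> set ds\<close> by (simp add: nth_append)
  qed
qed simp

lemma length_block_tuple: "B \<in> carrier_mat s s \<Longrightarrow> length (block_tuple a s B) = s"
  by (simp add: block_tuple_def)

lemma nth_block_tuple:
  assumes "B \<in> carrier_mat s s" "i < s"
  shows "block_tuple a s B ! i = (\<Sum>j<s. B $$ (i,j) * Var (a + j))"
proof -
  have "block_tuple a s B ! i = (mat 1 s (\<lambda>(_, j). Var (a + j)) * transpose_mat B) $$ (0,i)"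
    using assms by (simp add: block_tuple_def list_of_vec_index)
  also have "\<dots> = (\<Sum>j<s. mat 1 s (\<lambda>(_, j). Var (a + j)) $$ (0,j) * transpose_mat B $$ (j,i))"
    by (rule mult_mat_index[of _ 1 s _ s]) (use assms in auto)
  also have "\<dots> = (\<Sum>j<s. B $$ (i,j) * Var (a + j))"
    using assms by (intro sum.cong) (auto simp: mult.commute)
  finally show ?thesis .
qed

section \<open>Weighted degrees\<close>

lemma wdeg_superset:
  "finite S \<Longrightarrow> Poly_Mapping.keys t \<subseteq> S \<Longrightarrow> wdeg W t = (\<Sum>v\<in>S. W v * int (Poly_Mapping.lookup t v))"
  unfolding wdeg_def by (rule sum.mono_neutral_left) (auto simp: in_keys_iff)

lemma wdeg_add: "wdeg W (s + t) = wdeg W s + wdeg W t"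
proof -
  let ?S = "Poly_Mapping.keys s \<union> Poly_Mapping.keys t"
  have "wdeg W (s + t) = (\<Sum>v\<in>?S. W v * int (Poly_Mapping.lookup (s + t) v))"
    by (rule wdeg_superset) (use Poly_Mapping.keys_add[of s t] in auto)
  then show ?thesis
    by (simp add: wdeg_superset[of ?S s] wdeg_superset[of ?S t] lookup_add distrib_left sum.distrib)
qed

lemma wdeg_single [simp]: "wdeg W (Poly_Mapping.single v n) = W v * int n"
  by (simp add: wdeg_def)

lemma wdeg_0 [simp]: "wdeg W 0 = 0"
  by (simp add: wdeg_def)

lemma homogeneous_0 [simp]: "homogeneous W d 0"
  by (simp add: homogeneous_def)

lemma homogeneous_add: "homogeneous W d p \<Longrightarrow> homogeneous W d q \<Longrightarrow> homogeneous W d (p + q)"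
  using Poly_Mapping.keys_add[of p q] by (auto simp: homogeneous_def)

lemma homogeneous_uminus: "homogeneous W d p \<Longrightarrow> homogeneous W d (- p)"
  by (simp add: homogeneous_def)

lemma homogeneous_diff: "homogeneous W d p \<Longrightarrow> homogeneous W d q \<Longrightarrow> homogeneous W d (p - q)"
  using homogeneous_add[of W d p "- q"] homogeneous_uminus[of W d q] by simp

lemma homogeneous_sum: "(\<And>i. i \<in> S \<Longrightarrow> homogeneous W d (f i)) \<Longrightarrow> homogeneous W d (sum f S)"
  by (induction S rule: infinite_finite_induct) (simp_all add: homogeneous_add)

lemma homogeneous_mult:
  "homogeneous W c p \<Longrightarrow> homogeneous W d q \<Longrightarrow> homogeneous W (c + d) (p * q)"
  using Poly_Mapping.keys_mult[of p q] by (fastforce simp: homogeneous_def wdeg_add)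

lemma homogeneous_Const [simp]: "homogeneous W 0 (Const c)"
  by (simp add: homogeneous_def Const_def)

lemma homogeneous_1 [simp]: "homogeneous W 0 1"
  by (simp add: homogeneous_def)

lemma homogeneous_Var [simp]: "homogeneous W (W v) (Var v)"
  by (simp add: homogeneous_def Var_def)

lemma homogeneous_Var_iff: "homogeneous W d (Var v :: 'a::field mpoly) \<longleftrightarrow> W v = d"
  by (simp add: homogeneous_def Var_def)

lemma homogeneous_power: "homogeneous W d p \<Longrightarrow> homogeneous W (d * int n) (p ^ n)"
proof (induction n)
  case (Suc n)
  then have "homogeneous W (d + d * int n) (p * p ^ n)" by (intro homogeneous_mult) auto
  then show ?case by (simp add: algebra_simps)
qed simp

lemma homogeneous_prod:
  "finite S \<Longrightarrow> (\<And>i. i \<in> S \<Longrightarrow> homogeneous W (d i) (f i)) \<Longrightarrow> homogeneous W (sum d S) (prod f S)"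
  by (induction S rule: finite_induct) (simp_all add: homogeneous_mult)

lemma homogeneous_of_vars:
  "(\<And>v. v \<in> vars p \<Longrightarrow> W v = 0) \<Longrightarrow> homogeneous W 0 p"
  by (fastforce simp: homogeneous_def wdeg_def vars_def intro!: sum.neutral)

text \<open>Formulated for single terms and an arbitrary \<open>p\<close>, so that it also transfers
  lower bounds, such as the one for the weight that counts the x's.\<close>

lemma wdeg_keys_subst:
  assumes "t \<in> Poly_Mapping.keys (subst F p)" and F: "\<And>v. v \<in> vars p \<Longrightarrow> homogeneous W (W v) (F v)"
  shows "\<exists>s\<in>Poly_Mapping.keys p. wdeg W t = wdeg W s"
proof -
  let ?m = "\<lambda>s. Const (Poly_Mapping.lookup p s) * (\<Prod>v\<in>Poly_Mapping.keys s. F v ^ Poly_Mapping.lookup s v)"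
  have "homogeneous W (0 + wdeg W s) (?m s)" if "s \<in> Poly_Mapping.keys p" for s
    unfolding wdeg_def
    by (intro homogeneous_mult homogeneous_prod homogeneous_power F homogeneous_Const)
      (use that in \<open>auto simp: vars_def\<close>)
  moreover obtain s where "s \<in> Poly_Mapping.keys p" "t \<in> Poly_Mapping.keys (?m s)"
    using assms(1) Poly_Mapping.keys_sum[of ?m "Poly_Mapping.keys p"] by (auto simp: subst_def)
  ultimately show ?thesis by (auto simp: homogeneous_def)
qed

lemma homogeneous_subst:
  assumes "homogeneous W d p" "\<And>v. v \<in> vars p \<Longrightarrow> homogeneous W (W v) (F v)"
  shows "homogeneous W d (subst F p)"
  using wdeg_keys_subst[of _ F p W] assms unfolding homogeneous_def by metis

lemma lookup_mult_single: "Poly_Mapping.lookup (p * Poly_Mapping.single s (1 :: 'a::field)) (t + s) = Poly_Mapping.lookup p (t :: nat \<Rightarrow>\<^sub>0 nat)"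
proof (induction p rule: mpoly_induct)
  case (monom t' c)
  have "t' + s = t + s \<longleftrightarrow> t' = t" by simp
  then show ?case by (simp add: mult_single lookup_single when_def)
qed (simp add: distrib_right lookup_add)

section \<open>Ideals of polynomial rings\<close>

lemma lookup_hcomp: "Poly_Mapping.lookup (hcomp W d p) t = (if wdeg W t = d then Poly_Mapping.lookup p t else 0)"
proof -
  have "Poly_Mapping.lookup (hcomp W d p) t = (\<Sum>s\<in>{s \<in> Poly_Mapping.keys p. wdeg W s = d}. if s = t then Poly_Mapping.lookup p s else 0)"
    by (simp add: hcomp_def lookup_sum lookup_single when_def)
  also have "\<dots> = (if wdeg W t = d then Poly_Mapping.lookup p t else 0)"
    by (auto simp: in_keys_iff)
  finally show ?thesis .
qed

lemma hcomp_add: "hcomp W d (p + q) = hcomp W d p + hcomp W d q"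
  by (rule poly_mapping_eqI) (simp add: lookup_hcomp lookup_add)

lemma hcomp_single: "hcomp W d (Poly_Mapping.single t c) = (if wdeg W t = d then Poly_Mapping.single t c else 0)"
  by (rule poly_mapping_eqI) (auto simp: lookup_hcomp lookup_single when_def)

lemma hcomp_homogeneous: "homogeneous W c p \<Longrightarrow> hcomp W d p = (if c = d then p else 0)"
  by (rule poly_mapping_eqI) (auto simp: lookup_hcomp homogeneous_def in_keys_iff)

lemma hcomp_0 [simp]: "hcomp W d 0 = 0"
  by (simp add: hcomp_def)

lemma hcomp_mult_single:
  "hcomp W d (Poly_Mapping.single t c * p) = Poly_Mapping.single t c * hcomp W (d - wdeg W t) p"
proof (induction p rule: mpoly_induct)
  case (monom s a)
  show ?case by (auto simp: mult_single hcomp_single wdeg_add)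
qed (simp add: distrib_left hcomp_add)

lemma ideal_closed:
  assumes "ideal I (mpoly_ring V)"
  shows "finite S \<Longrightarrow> (\<And>i. i \<in> S \<Longrightarrow> f i \<in> I) \<Longrightarrow> sum f S \<in> I"
    and "x \<in> I \<Longrightarrow> - x \<in> I" and "x \<in> I \<Longrightarrow> y \<in> I \<Longrightarrow> x - y \<in> I"
proof -
  note I = ideal_mpoly_ringD[OF assms]
  show "finite S \<Longrightarrow> (\<And>i. i \<in> S \<Longrightarrow> f i \<in> I) \<Longrightarrow> sum f S \<in> I"
    by (induction S rule: finite_induct) (auto intro: I)
  show neg: "x \<in> I \<Longrightarrow> - x \<in> I" for x using I(4)[of x "- 1"] by (simp add: vars_uminus)
  show "x \<in> I \<Longrightarrow> y \<in> I \<Longrightarrow> x - y \<in> I" using I(3)[of x "- y"] neg by simp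
qed

text \<open>The elements whose components all stay in the ideal form an ideal themselves, because
  multiplication by a monomial merely shifts the components; it contains the generators.\<close>

lemma genideal_homogeneous:
  assumes S: "S \<subseteq> carrier (mpoly_ring V)" and hom: "\<And>p. p \<in> S \<Longrightarrow> \<exists>d. homogeneous W d p"
  shows "homogeneous_ideal (mpoly_ring V) W (genideal (mpoly_ring V) S)"
proof -
  interpret ring "mpoly_ring V :: 'a mpoly ring" by (rule ring_mpoly_ring)
  let ?J = "Idl\<^bsub>mpoly_ring V\<^esub> S"
  have J: "ideal ?J (mpoly_ring V)" by (rule genideal_ideal[OF S])
  note JD = ideal_mpoly_ringD[OF J]
  let ?K = "{p \<in> ?J. \<forall>d. hcomp W d p \<in> ?J}"
  have "ideal ?K (mpoly_ring V)"
  proof (rule ideal_mpoly_ringI)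
    fix x c :: "'a mpoly" assume x: "x \<in> ?K" and c: "vars c \<subseteq> V"
    have "hcomp W d (c * x) \<in> ?J" for d
    proof -
      have s: "vars (Poly_Mapping.single t (Poly_Mapping.lookup c t)) \<subseteq> V" if "t \<in> Poly_Mapping.keys c" for t
        using c that by (auto simp: vars_def)
      have hs: "hcomp W d (sum f T) = (\<Sum>t\<in>T. hcomp W d (f t))" for f :: "(nat \<Rightarrow>\<^sub>0 nat) \<Rightarrow> 'a mpoly" and T
        by (induction T rule: infinite_finite_induct) (auto simp: hcomp_add)
      have "hcomp W d (c * x) = hcomp W d ((\<Sum>t\<in>Poly_Mapping.keys c. Poly_Mapping.single t (Poly_Mapping.lookup c t)) * x)"
        using mpoly_expansion_single[of c] by simp
      also have "\<dots> = (\<Sum>t\<in>Poly_Mapping.keys c. Poly_Mapping.single t (Poly_Mapping.lookup c t) * hcomp W (d - wdeg W t) x)"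
        by (simp add: sum_distrib_right hs hcomp_mult_single)
      also have "\<dots> \<in> ?J"
        by (intro ideal_closed(1)[OF J] JD(4) s) (use x in auto)
      finally show ?thesis .
    qed
    then show "c * x \<in> ?K" using x c JD(4) by auto
  qed (use JD in \<open>auto simp: hcomp_add\<close>)
  moreover have "S \<subseteq> ?K"
  proof
    fix p assume p: "p \<in> S"
    then obtain c where "homogeneous W c p" using hom by blast
    moreover have "p \<in> ?J" using p genideal_self[OF S] by blast
    ultimately show "p \<in> ?K" using JD(2) by (simp add: hcomp_homogeneous)
  qed
  ultimately have "?J \<subseteq> ?K" by (rule genideal_minimal)
  then show ?thesis using J by (auto simp: homogeneous_ideal_def)
qed

lemma subst_cong_ideal:
  fixes p :: "'a::field mpoly"
  assumes L: "ideal L (mpoly_ring V)"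
    and FG: "\<And>v. v \<in> vars p \<Longrightarrow> vars (F v) \<subseteq> V \<and> vars (G v) \<subseteq> V \<and> F v - G v \<in> L"
  shows "subst F p - subst G p \<in> L"
proof -
  note LD = ideal_mpoly_ringD[OF L]
  \<comment> \<open>Membership in the ring is carried along, since \<open>L\<close> absorbs only
    factors over \<open>V\<close>.\<close>
  let ?R = "\<lambda>x y. vars x \<subseteq> V \<and> vars y \<subseteq> V \<and> x - y \<in> L"
  have mult: "?R (x * x') (y * y')" if "?R x y" "?R x' y'" for x y x' y' :: "'a mpoly"
  proof -
    have "x * x' - y * y' = x * (x' - y') + y' * (x - y)" by (simp add: algebra_simps)
    also have "\<dots> \<in> L" using that by (intro LD(3) LD(4)) auto
    finally show ?thesis using that vars_mult_subset by blast
  qed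
  have one: "?R 1 1" using LD(2) by simp
  have pow: "?R (x ^ n) (y ^ n)" if "?R x y" for x y :: "'a mpoly" and n
  proof (induction n)
    case (Suc n)
    show ?case unfolding power_Suc by (rule mult[OF that Suc.IH])
  qed (use one in simp)
  have prod: "?R (prod f S) (prod g S)" if "\<And>i. i \<in> S \<Longrightarrow> ?R (f i) (g i)" for f g :: "nat \<Rightarrow> 'a mpoly" and S
    using that
  proof (induction S rule: infinite_finite_induct)
    case (insert i S)
    then show ?case unfolding prod.insert[OF insert.hyps] by (intro mult) auto
  qed (use one in simp_all)
  have "?R (Const (Poly_Mapping.lookup p t) * (\<Prod>v\<in>Poly_Mapping.keys t. F v ^ Poly_Mapping.lookup t v)) (Const (Poly_Mapping.lookup p t) * (\<Prod>v\<in>Poly_Mapping.keys t. G v ^ Poly_Mapping.lookup t v))"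
    if "t \<in> Poly_Mapping.keys p" for t
    by (rule mult, use LD(2) in simp, rule prod, rule pow, rule FG) (use that in \<open>auto simp: vars_def\<close>)
  then show ?thesis
    unfolding subst_def sum_subtractf[symmetric] by (intro ideal_closed(1)[OF L]) auto
qed

section \<open>Successive elimination\<close>

lemma replace_vars_cong:
  assumes "inj_on u {..<i}" "\<And>j. j < i \<Longrightarrow> q j = q' j"
  shows "replace_vars u q i = replace_vars u q' i"
proof -
  have "q (inv_into {..<i} u v) = q' (inv_into {..<i} u v)" if "v \<in> u ` {..<i}" for v
    using assms(2) inv_into_into[OF that] by simp
  then show ?thesis unfolding replace_vars_def by (intro arg_cong[of _ _ subst] ext) simp
qed

lemma replace_vars_Var:
  assumes "inj_on u {..<i}"
  shows "j < i \<Longrightarrow> replace_vars u q i (Var (u j)) = q j"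
    and "v \<notin> u ` {..<i} \<Longrightarrow> replace_vars u q i (Var v) = Var v"
  using assms by (auto simp: replace_vars_def)

lemma replace_vars_eq_subst: "replace_vars u q i = subst (\<lambda>v. replace_vars u q i (Var v))"
  by (simp add: replace_vars_def)

lemma comm_ring_hom_replace_vars: "comm_ring_hom (replace_vars u q i)"
  unfolding replace_vars_def by (rule comm_ring_hom_subst)

text \<open>Each new polynomial depends on all earlier ones through the function argument of
  \<open>replace_vars\<close>, so a table is extended one index at a time; at stage \<open>i\<close>
  the entries from \<open>i\<close> on are placeholders.\<close>

primrec elim_table :: "(nat \<Rightarrow> nat) \<Rightarrow> (nat \<Rightarrow> 'a::field mpoly) \<Rightarrow> nat \<Rightarrow> nat \<Rightarrow> 'a mpoly" where
  "elim_table u f 0 = (\<lambda>_. 0)"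
| "elim_table u f (Suc i) =
    (elim_table u f i)(i := Var (u i) - replace_vars u (elim_table u f i) i (f i))"

definition eliminant :: "(nat \<Rightarrow> nat) \<Rightarrow> (nat \<Rightarrow> 'a::field mpoly) \<Rightarrow> nat \<Rightarrow> 'a mpoly" where
  "eliminant u f i = elim_table u f (Suc i) i"

text \<open>Stage \<open>i\<close> reads only indices below \<open>i\<close>, where the table
  already has its final values.\<close>

lemma replace_vars_eliminant:
  assumes "inj_on u {..<i}"
  shows "replace_vars u (eliminant u f) i (f i) = Var (u i) - eliminant u f i"
proof -
  have "elim_table u f i j = eliminant u f j" if "j < i" for i j
    using that by (induction i) (auto simp: eliminant_def less_Suc_eq)
  then have "replace_vars u (eliminant u f) i = replace_vars u (elim_table u f i) i"
    by (intro replace_vars_cong assms) simp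
  then show ?thesis by (simp add: eliminant_def)
qed

section \<open>Elimination of indeterminates\<close>

text \<open>The hypotheses as the elimination uses them: unimodularity as a right inverse over the
  whole type, and membership in the square of the ideal of the x's as the lower bound 2 for the
  weight that counts the x's.\<close>

locale linear_parts =
  fixes m n k :: nat and W :: "nat \<Rightarrow> int" and g ht :: "nat \<Rightarrow> 'a::field mpoly"
    and h :: "nat \<Rightarrow> nat \<Rightarrow> 'a mpoly" and e :: "nat \<Rightarrow> int"
  assumes mn: "m < n"
    and W_zero: "\<And>v. v < m \<Longrightarrow> W v = 0"
    and W_pos: "\<And>v. m \<le> v \<Longrightarrow> v < n \<Longrightarrow> 0 < W v"
    and W_mono: "mono_on {m..<n} W"
    and e_mono: "mono_on {..<k} e"
    and g_hom: "\<And>i. i < k \<Longrightarrow> homogeneous W (e i) (g i)"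
    and h_vars: "\<And>i j. i < k \<Longrightarrow> j < n - m \<Longrightarrow> vars (h i j) \<subseteq> {..<m}"
    and ht_vars: "\<And>i. i < k \<Longrightarrow> vars (ht i) \<subseteq> {..<n}"
    and ht_order: "\<And>i t. i < k \<Longrightarrow> t \<in> Poly_Mapping.keys (ht i) \<Longrightarrow> 2 \<le> wdeg (\<lambda>v. if m \<le> v then 1 else 0) t"
    and g_eq: "\<And>i. i < k \<Longrightarrow> g i = (\<Sum>j<n - m. h i j * Var (m + j)) + ht i"
    and right_inverse: "\<exists>C\<in>carrier_mat (n - m) k. mat k (n - m) (\<lambda>(i, j). h i j) * C = 1\<^sub>m k"
begin

abbreviation "N \<equiv> n - m"
abbreviation "w \<equiv> \<lambda>j. W (m + j)"
abbreviation "D \<equiv> w ` {..<N}"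
abbreviation "\<alpha> \<equiv> block_start w N"
abbreviation "sx \<equiv> block_size w N"
abbreviation "\<gamma> \<equiv> block_start e k"
abbreviation "sg \<equiv> block_size e k"
abbreviation "xw \<equiv> \<lambda>v. if m \<le> v then 1 else 0 :: int"
abbreviation "\<nu> \<equiv> \<lambda>i. \<alpha> (e i) + i - \<gamma> (e i)"
abbreviation "Ad \<equiv> \<lambda>d. mat (sg d) (sx d) (\<lambda>(i, j). h (\<gamma> d + i) (\<alpha> d + j))"

lemma w_mono: "mono_on {..<N} w"
proof (rule mono_onI)
  fix r s assume "r \<in> {..<N}" "s \<in> {..<N}" "r \<le> s"
  then show "w r \<le> w s" using mono_onD[OF W_mono, of "m + r" "m + s"] by auto
qed

text \<open>Since \<open>g i\<close> is homogeneous, the matrix \<open>h\<close> decomposes into the blocks \<open>Ad d\<close>.\<close>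

lemma h_nonzero:
  assumes i: "i < k" and j: "j < N" and nz: "h i j \<noteq> 0"
  shows "w j = e i"
proof -
  from nz obtain s where s: "s \<in> Poly_Mapping.keys (h i j)" by fastforce
  have s_vars: "Poly_Mapping.keys s \<subseteq> {..<m}" using h_vars[OF i j] s by (auto simp: vars_def)
  \<comment> \<open>The product of \<open>s\<close> with the j-th x. The coefficients
    \<open>h i j'\<close> are free of x's, so this term occurs in no other summand, and the terms of
    \<open>ht i\<close> contain at least two x's. Hence it survives in \<open>g i\<close>, and its
    degree \<open>w j\<close> is \<open>e i\<close>.\<close>
  let ?t = "s + Poly_Mapping.single (m + j) 1"
  have "Poly_Mapping.lookup (h i j' * Var (m + j')) ?t = (if j' = j then Poly_Mapping.lookup (h i j) s else 0)" if j': "j' < N" for j'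
  proof (cases "j' = j")
    case True
    then show ?thesis by (simp add: Var_def lookup_mult_single)
  next
    case False
    have "?t \<notin> Poly_Mapping.keys (h i j' * Var (m + j'))"
    proof
      assume "?t \<in> Poly_Mapping.keys (h i j' * Var (m + j'))"
      with Poly_Mapping.keys_mult[of "h i j'" "Var (m + j')"]
      obtain a where "?t = a + Poly_Mapping.single (m + j') 1" by (auto simp: Var_def)
      then have "Poly_Mapping.lookup ?t (m + j') = Poly_Mapping.lookup (a + Poly_Mapping.single (m + j') 1) (m + j')" by simp
      moreover have "m + j' \<notin> Poly_Mapping.keys s" using s_vars by auto
      ultimately show False using False by (simp add: lookup_add lookup_single in_keys_iff)
    qed
    then show ?thesis using False by (simp add: in_keys_iff)
  qed
  then have "Poly_Mapping.lookup (\<Sum>j'<N. h i j' * Var (m + j')) ?t = Poly_Mapping.lookup (h i j) s"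
    using j by (simp add: lookup_sum)
  moreover have "Poly_Mapping.lookup (ht i) ?t = 0"
  proof (rule ccontr)
    assume "Poly_Mapping.lookup (ht i) ?t \<noteq> 0"
    then have "2 \<le> wdeg xw ?t" by (intro ht_order[OF i]) (simp add: in_keys_iff)
    moreover have "wdeg xw s = 0"
      unfolding wdeg_def by (rule sum.neutral) (use s_vars in auto)
    ultimately show False by (simp add: wdeg_add)
  qed
  ultimately have "Poly_Mapping.lookup (g i) ?t = Poly_Mapping.lookup (h i j) s" using g_eq[OF i] by (simp add: lookup_add)
  then have "?t \<in> Poly_Mapping.keys (g i)" using s by (simp add: in_keys_iff)
  then have "wdeg W ?t = e i" using g_hom[OF i] by (simp add: homogeneous_def)
  moreover have "wdeg W s = 0"
    unfolding wdeg_def by (rule sum.neutral) (use s_vars W_zero in auto)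
  ultimately show ?thesis by (simp add: wdeg_add)
qed

lemma right_inverse_entries:
  obtains C where "\<And>i j. i < k \<Longrightarrow> j < k \<Longrightarrow> (\<Sum>t<N. h i t * C t j) = (if i = j then 1 else 0)"
proof -
  let ?A = "mat k N (\<lambda>(i, j). h i j)"
  obtain C where C: "C \<in> carrier_mat N k" "?A * C = 1\<^sub>m k" using right_inverse by blast
  show ?thesis
  proof (rule that[of "\<lambda>t j. C $$ (t,j)"])
    fix i j assume ij: "i < k" "j < k"
    have "(?A * C) $$ (i,j) = (\<Sum>t<N. ?A $$ (i,t) * C $$ (t,j))"
      by (rule mult_mat_index[OF _ C(1) ij]) simp
    then show "(\<Sum>t<N. h i t * C $$ (t,j)) = (if i = j then 1 else 0)"
      using ij by (simp add: C(2))
  qed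
qed

text \<open>By the right inverse, row \<open>i\<close> has a nonzero entry, and the column of that
  entry has degree \<open>e i\<close>.\<close>

lemma e_in_D: assumes "i < k" shows "e i \<in> D"
proof -
  obtain C where "\<And>i j. i < k \<Longrightarrow> j < k \<Longrightarrow> (\<Sum>t<N. h i t * C t j) = (if i = j then 1 else 0)"
    using right_inverse_entries by blast
  from this[OF assms assms] have "(\<Sum>t<N. h i t * C t i) \<noteq> 0" by simp
  then obtain t where "t < N" "h i t \<noteq> 0"
    by (metis (no_types, lifting) lessThan_iff mult_zero_left sum.neutral)
  then show ?thesis using h_nonzero[OF assms] by force
qed

lemma block_of_g:
  assumes "0 < sg d"
  shows "d \<in> e ` {..<k}"
  using assms by (auto simp: block_size_def card_gt_0_iff)

text \<open>In the rows of degree \<open>d\<close> all entries outside the block vanish, so the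
  matching part of a right inverse of the whole matrix inverts the block.\<close>

lemma block_right_inverse:
  assumes d: "0 < sg d"
  shows "\<exists>C\<in>carrier_mat (sx d) (sg d). Ad d * C = 1\<^sub>m (sg d)"
proof -
  obtain C where C: "\<And>i j. i < k \<Longrightarrow> j < k \<Longrightarrow> (\<Sum>t<N. h i t * C t j) = (if i = j then 1 else 0)"
    using right_inverse_entries by blast
  note de = block_of_g[OF d]
  then have dD: "d \<in> D" using e_in_D by auto
  let ?C = "mat (sx d) (sg d) (\<lambda>(i,j). C (\<alpha> d + i) (\<gamma> d + j))"
  have "Ad d * ?C = 1\<^sub>m (sg d)"
  proof (rule eq_matI)
    fix i j assume "i < dim_row (1\<^sub>m (sg d) :: 'a mpoly mat)" "j < dim_col (1\<^sub>m (sg d) :: 'a mpoly mat)"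
    then have ij: "i < sg d" "j < sg d" by auto
    note bi = block_indexI[OF e_mono de ij(1)] and bj = block_indexI[OF e_mono de ij(2)]
    have "(Ad d * ?C) $$ (i,j) = (\<Sum>t<sx d. Ad d $$ (i,t) * ?C $$ (t,j))"
      by (rule mult_mat_index[of _ "sg d" "sx d" _ "sg d"]) (use ij in auto)
    also have "\<dots> = (\<Sum>t<sx d. h (\<gamma> d + i) (\<alpha> d + t) * C (\<alpha> d + t) (\<gamma> d + j))"
      using ij by simp
    also have "\<dots> = (\<Sum>t | t < N \<and> w t = d. h (\<gamma> d + i) t * C t (\<gamma> d + j))"
      by (rule sum_block[OF w_mono dD, symmetric])
    also have "\<dots> = (\<Sum>t<N. h (\<gamma> d + i) t * C t (\<gamma> d + j))"
      by (rule sum.mono_neutral_left) (use h_nonzero[OF bi(1)] bi(2) in auto)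
    also have "\<dots> = 1\<^sub>m (sg d) $$ (i,j)" using C[OF bi(1) bj(1)] ij by simp
    finally show "(Ad d * ?C) $$ (i,j) = 1\<^sub>m (sg d) $$ (i,j)" .
  qed auto
  then show ?thesis by (intro bexI[of _ ?C]) auto
qed

lemma Ad_vars:
  assumes "0 < sg d" "i < sg d" "j < sx d"
  shows "vars (Ad d $$ (i,j)) \<subseteq> {..<m}"
proof -
  note de = block_of_g[OF assms(1)]
  then have dD: "d \<in> D" using e_in_D by auto
  show ?thesis
    using h_vars[OF block_indexI(1)[OF e_mono de assms(2)] block_indexI(1)[OF w_mono dD assms(3)]] assms
    by simp
qed

lemma blocks_unimodular:
  assumes "0 < sg d"
  shows "sg d \<le> sx d" "unimodular (mpoly_ring {..<m}) (Ad d)" "\<exists>B. solves_UMP (mpoly_ring {..<m}) (Ad d) B"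
proof -
  obtain C where C: "C \<in> carrier_mat (sx d) (sg d)" "Ad d * C = 1\<^sub>m (sg d)"
    using block_right_inverse[OF assms] by blast
  have A: "Ad d \<in> carrier_mat (sg d) (sx d)" by simp
  show "sg d \<le> sx d" by (rule right_invertible_dim_le[OF A C])
  show "unimodular (mpoly_ring {..<m}) (Ad d)"
    by (rule right_inverse_imp_unimodular[OF A _ C]) (rule Ad_vars[OF assms])
  show "\<exists>B. solves_UMP (mpoly_ring {..<m}) (Ad d) B"
    by (rule solves_UMP_exists[OF A _ C]) (rule Ad_vars[OF assms])
qed

text \<open>A right invertible block has at least as many columns as rows, so \<open>\<nu> i\<close>
  stays within the block of degree \<open>e i\<close>. As \<open>\<gamma> (e i) \<le> i\<close>, the
  truncated subtraction in \<open>\<nu>\<close> is harmless.\<close>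

lemma \<nu>_eq:
  assumes i: "i < k"
  shows "\<gamma> (e i) \<le> i" "i - \<gamma> (e i) < sg (e i)" "\<nu> i = \<alpha> (e i) + (i - \<gamma> (e i))"
    "i - \<gamma> (e i) < sx (e i)" "\<nu> i < N" "w (\<nu> i) = e i"
proof -
  show g: "\<gamma> (e i) \<le> i" "i - \<gamma> (e i) < sg (e i)" by (rule block_index[OF e_mono i])+
  then show eq: "\<nu> i = \<alpha> (e i) + (i - \<gamma> (e i))" by simp
  have "0 < sg (e i)" using g by simp
  from blocks_unimodular(1)[OF this] g show s: "i - \<gamma> (e i) < sx (e i)" by simp
  show "\<nu> i < N" "w (\<nu> i) = e i"
    unfolding eq by (rule block_indexI[OF w_mono e_in_D[OF i] s])+
qed

lemma \<nu>_inj: "inj_on \<nu> {..<k}"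
proof (rule inj_onI)
  fix i j assume ij: "i \<in> {..<k}" "j \<in> {..<k}" "\<nu> i = \<nu> j"
  then have e: "e i = e j" using \<nu>_eq(6)[of i] \<nu>_eq(6)[of j] by simp
  have "\<alpha> (e i) + (i - \<gamma> (e i)) = \<alpha> (e j) + (j - \<gamma> (e j))"
    using ij \<nu>_eq(3)[of i] \<nu>_eq(3)[of j] by simp
  then show "i = j" using ij \<nu>_eq(1)[of i] \<nu>_eq(1)[of j] e by simp
qed

lemma ht_hom: assumes i: "i < k" shows "homogeneous W (e i) (ht i)"
proof -
  have "homogeneous W (e i) (h i j * Var (m + j))" if j: "j < N" for j
  proof (cases "h i j = 0")
    case False
    have "homogeneous W (0 + w j) (h i j * Var (m + j))"
      by (intro homogeneous_mult homogeneous_of_vars homogeneous_Var W_zero)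
        (use h_vars[OF i j] in auto)
    then show ?thesis using h_nonzero[OF i j False] by simp
  qed simp
  then have "homogeneous W (e i) (g i - (\<Sum>j<N. h i j * Var (m + j)))"
    by (intro homogeneous_diff homogeneous_sum g_hom[OF i]) auto
  then show ?thesis using g_eq[OF i] by simp
qed

abbreviation "u \<equiv> \<lambda>i. m + \<nu> i"
abbreviation "Vh \<equiv> {..<n} - u ` {..<k}"

lemma u_inj: "inj_on u {..<k}"
  using \<nu>_inj by (auto simp: inj_on_def)

lemma u_inj_le: "i \<le> k \<Longrightarrow> inj_on u {..<i}"
  by (rule inj_on_subset[OF u_inj]) auto

lemma u_props: assumes "i < k" shows "m \<le> u i" "u i < n" "W (u i) = e i"
  using \<nu>_eq(5,6)[OF assms] by auto

lemma card_Vh: "card Vh = n - k"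
proof -
  have "u ` {..<k} \<subseteq> {..<n}" using u_props by auto
  then show ?thesis using card_image[OF u_inj] by (simp add: card_Diff_subset)
qed

end

locale elimination = linear_parts +
  fixes B :: "int \<Rightarrow> 'a mpoly mat"
  assumes B: "\<And>d. d \<in> D \<Longrightarrow>
    if sg d = 0 then B d = 1\<^sub>m (sx d) else solves_UMP (mpoly_ring {..<m}) (Ad d) (B d)"
begin

section \<open>The linear change of coordinates\<close>

definition "F = map Var [0..<m] @ concat (map (\<lambda>d. block_tuple (m + \<alpha> d) (sx d) (B d)) (sorted_list_of_set D))"

definition "\<phi> = subst (\<lambda>v. F ! v)"

lemma B_carrier: assumes "d \<in> D" shows "B d \<in> carrier_mat (sx d) (sx d)"
  using B[OF assms] by (auto simp: solves_UMP_def split: if_splits)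

lemma B_vars:
  assumes "d \<in> D" "i < sx d" "j < sx d"
  shows "vars (B d $$ (i,j)) \<subseteq> {..<m}"
proof (cases "sg d = 0")
  case True
  then show ?thesis using B[OF assms(1)] assms(2,3) by (auto simp: one_mat_def)
next
  case False
  then have "elements_mat (B d) \<subseteq> carrier (mpoly_ring {..<m})"
    using B[OF assms(1)] by (simp add: solves_UMP_def)
  then show ?thesis
    using assms elements_mat_subset_iff[OF B_carrier[OF assms(1)]] by auto
qed

lemma B_inverse:
  assumes d: "d \<in> D"
  shows "\<exists>C\<in>carrier_mat (sx d) (sx d). (\<forall>i<sx d. \<forall>j<sx d. vars (C $$ (i,j)) \<subseteq> {..<m}) \<and>
    C * B d = 1\<^sub>m (sx d) \<and> B d * C = 1\<^sub>m (sx d)"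
proof (cases "sg d = 0")
  case True
  then show ?thesis using B[OF d] by (intro bexI[of _ "1\<^sub>m (sx d)"]) auto
next
  case False
  then show ?thesis
    using B[OF d] Ad_vars[of d] by (intro solves_UMP_inverse[of "Ad d" "sg d"]) auto
qed

lemma length_F: "length F = n"
proof -
  have "length F = m + (\<Sum>d\<leftarrow>sorted_list_of_set D. length (block_tuple (m + \<alpha> d) (sx d) (B d)))"
    by (simp add: F_def length_concat comp_def)
  also have "\<dots> = m + (\<Sum>d\<in>D. length (block_tuple (m + \<alpha> d) (sx d) (B d)))"
    by (simp add: sum_list_distinct_conv_sum_set)
  also have "\<dots> = m + (\<Sum>d\<in>D. sx d)"
    by (simp add: length_block_tuple[OF B_carrier])
  also have "\<dots> = n" using mn by (simp add: sum_block_size)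
  finally show ?thesis .
qed

lemma F_low: "v < m \<Longrightarrow> F ! v = Var v"
  by (simp add: F_def nth_append)

lemma F_block:
  assumes d: "d \<in> D" and i: "i < sx d"
  shows "F ! (m + (\<alpha> d + i)) = (\<Sum>t<sx d. B d $$ (i,t) * Var (m + (\<alpha> d + t)))"
proof -
  let ?f = "\<lambda>d. block_tuple (m + \<alpha> d) (sx d) (B d)"
  have len: "length (?f d) = sx d" if "d \<in> D" for d
    by (rule length_block_tuple[OF B_carrier[OF that]])
  have "\<alpha> d = (\<Sum>d' | d' \<in> D \<and> d' < d. sx d')"
    by (rule block_start_eq_sum[OF w_mono d])
  also have "\<dots> = (\<Sum>d' | d' \<in> D \<and> d' < d. length (?f d'))"
  proof (rule sum.cong[OF refl])
    fix d' assume "d' \<in> {d'. d' \<in> D \<and> d' < d}"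
    then have "d' \<in> D" by (elim CollectE conjE)
    then show "sx d' = length (?f d')" by (rule len[symmetric])
  qed
  finally have \<alpha>: "\<alpha> d = (\<Sum>d' | d' \<in> set (sorted_list_of_set D) \<and> d' < d. length (?f d'))" by simp
  have "F ! (m + (\<alpha> d + i)) = concat (map ?f (sorted_list_of_set D)) ! (\<alpha> d + i)"
    by (simp add: F_def nth_append)
  also have "\<dots> = ?f d ! i"
  proof -
    have "sorted_wrt (<) (sorted_list_of_set D)" "d \<in> set (sorted_list_of_set D)" "i < length (?f d)"
      using d i len[OF d] by auto
    from nth_concat_sorted[of _ d i ?f, OF this] show ?thesis by (simp only: \<alpha>[symmetric])
  qed
  also have "\<dots> = (\<Sum>t<sx d. B d $$ (i,t) * Var (m + (\<alpha> d + t)))"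
    using nth_block_tuple[OF B_carrier[OF d] i] by (simp add: add.assoc)
  finally show ?thesis .
qed

lemma block_cases:
  assumes "v < n"
  obtains "v < m" | d i where "d \<in> D" "i < sx d" "v = m + (\<alpha> d + i)" "W v = d"
proof (cases "v < m")
  case False
  let ?j = "v - m"
  have j: "?j < N" "m + ?j = v" using assms False by auto
  show ?thesis
  proof (rule that(2)[of "w ?j" "?j - \<alpha> (w ?j)"])
    show "w ?j \<in> D" using j(1) by blast
    show "?j - \<alpha> (w ?j) < sx (w ?j)" by (rule block_index[OF w_mono j(1)])
    show "v = m + (\<alpha> (w ?j) + (?j - \<alpha> (w ?j)))" using block_index(1)[OF w_mono j(1)] j by simp
    show "W v = w ?j" using j by simp
  qed
qed (use that in blast)

lemma block_var:
  assumes "d \<in> D" "i < sx d"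
  shows "m + (\<alpha> d + i) < n" "W (m + (\<alpha> d + i)) = d"
  using block_indexI[OF w_mono assms] by auto

text \<open>General in \<open>b\<close>, since it serves both the matrices \<open>B d\<close> and
  their inverses.\<close>

lemma linear_form_props:
  fixes b :: "nat \<Rightarrow> nat \<Rightarrow> 'a mpoly"
  assumes d: "d \<in> D" and i: "i < sx d"
    and b: "\<And>i t. i < sx d \<Longrightarrow> t < sx d \<Longrightarrow> vars (b i t) \<subseteq> {..<m}"
  shows "vars (\<Sum>t<sx d. b i t * Var (m + (\<alpha> d + t))) \<subseteq> {..<n}"
    and "homogeneous W d (\<Sum>t<sx d. b i t * Var (m + (\<alpha> d + t)))"
    and "homogeneous xw 1 (\<Sum>t<sx d. b i t * Var (m + (\<alpha> d + t)))"
proof -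
  show "vars (\<Sum>t<sx d. b i t * Var (m + (\<alpha> d + t))) \<subseteq> {..<n}"
  proof (rule vars_sum_subset)
    fix t assume "t \<in> {..<sx d}"
    then have "vars (b i t) \<subseteq> {..<n}" "vars (Var (m + (\<alpha> d + t)) :: 'a mpoly) \<subseteq> {..<n}"
      using b[OF i, of t] block_var(1)[OF d, of t] mn by auto
    then show "vars (b i t * Var (m + (\<alpha> d + t))) \<subseteq> {..<n}" by (rule vars_mult_subset)
  qed
  have b0: "homogeneous V 0 (b i t)" if "t < sx d" "\<And>v. v < m \<Longrightarrow> V v = 0" for t V
    by (rule homogeneous_of_vars) (use b[OF i that(1)] that(2) in auto)
  have hom: "homogeneous V c (\<Sum>t<sx d. b i t * Var (m + (\<alpha> d + t)))"
    if "\<And>v. v < m \<Longrightarrow> V v = 0" "\<And>t. t < sx d \<Longrightarrow> V (m + (\<alpha> d + t)) = c" for V c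
  proof (rule homogeneous_sum)
    fix t assume t: "t \<in> {..<sx d}"
    have "homogeneous V (0 + V (m + (\<alpha> d + t))) (b i t * Var (m + (\<alpha> d + t)))"
      by (rule homogeneous_mult[OF b0 homogeneous_Var]) (use t that(1) in auto)
    then show "homogeneous V c (b i t * Var (m + (\<alpha> d + t)))" using that(2) t by simp
  qed
  show "homogeneous W d (\<Sum>t<sx d. b i t * Var (m + (\<alpha> d + t)))"
    by (rule hom) (use W_zero block_var(2)[OF d] in auto)
  show "homogeneous xw 1 (\<Sum>t<sx d. b i t * Var (m + (\<alpha> d + t)))"
    by (rule hom) auto
qed

lemma F_props:
  assumes "v < n"
  shows "vars (F ! v) \<subseteq> {..<n}" "homogeneous W (W v) (F ! v)" "homogeneous xw (xw v) (F ! v)"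
proof -
  have "vars (F ! v) \<subseteq> {..<n} \<and> homogeneous W (W v) (F ! v) \<and> homogeneous xw (xw v) (F ! v)"
    using assms
  proof (cases rule: block_cases)
    case 1
    then show ?thesis using mn homogeneous_Var[of W v] homogeneous_Var[of xw v] by (simp add: F_low)
  next
    case (2 d i)
    then show ?thesis
      using linear_form_props[OF 2(1,2), of "\<lambda>i t. B d $$ (i,t)"] B_vars[OF 2(1)] F_block[OF 2(1,2)] by simp
  qed
  then show "vars (F ! v) \<subseteq> {..<n}" "homogeneous W (W v) (F ! v)" "homogeneous xw (xw v) (F ! v)"
    by blast+
qed

lemma \<phi>_vars: "vars p \<subseteq> {..<n} \<Longrightarrow> vars (\<phi> p) \<subseteq> {..<n}"
  unfolding \<phi>_def by (rule vars_subst_subset) (use F_props in auto)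

lemma \<phi>_hom: "vars p \<subseteq> {..<n} \<Longrightarrow> homogeneous W d p \<Longrightarrow> homogeneous W d (\<phi> p)"
  unfolding \<phi>_def by (rule homogeneous_subst) (use F_props in auto)

lemma \<phi>_Var: "\<phi> (Var v) = F ! v"
  by (simp add: \<phi>_def)

lemma \<phi>_low: "vars p \<subseteq> {..<m} \<Longrightarrow> \<phi> p = p"
  unfolding \<phi>_def by (rule subst_id) (use F_low in auto)

lemma \<phi>_ring_hom: "comm_ring_hom \<phi>"
  unfolding \<phi>_def by (rule comm_ring_hom_subst)

text \<open>\<open>\<phi>\<close> fixes P_0 and acts on each block of indeterminates by an
  invertible matrix over P_0, so the inverse matrices define the inverse substitution.\<close>

lemma \<phi>_inverse:
  obtains \<phi>' where "comm_ring_hom \<phi>'" "\<And>p. vars p \<subseteq> {..<n} \<Longrightarrow> vars (\<phi>' p) \<subseteq> {..<n}"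
    "\<And>p. vars p \<subseteq> {..<n} \<Longrightarrow> \<phi> (\<phi>' p) = p" "\<And>p. vars p \<subseteq> {..<n} \<Longrightarrow> \<phi>' (\<phi> p) = p"
proof -
  interpret \<phi>: comm_ring_hom \<phi> by (rule \<phi>_ring_hom)
  have "\<forall>d\<in>D. \<exists>C. C \<in> carrier_mat (sx d) (sx d) \<and> (\<forall>i<sx d. \<forall>j<sx d. vars (C $$ (i,j)) \<subseteq> {..<m}) \<and>
    C * B d = 1\<^sub>m (sx d) \<and> B d * C = 1\<^sub>m (sx d)" using B_inverse by blast
  from bchoice[OF this] obtain C where "\<forall>d\<in>D. C d \<in> carrier_mat (sx d) (sx d) \<and>
    (\<forall>i<sx d. \<forall>j<sx d. vars (C d $$ (i,j)) \<subseteq> {..<m}) \<and>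
    C d * B d = 1\<^sub>m (sx d) \<and> B d * C d = 1\<^sub>m (sx d)" by (rule exE)
  then have C: "\<And>d. d \<in> D \<Longrightarrow> C d \<in> carrier_mat (sx d) (sx d)"
    and C_vars: "\<And>d i j. d \<in> D \<Longrightarrow> i < sx d \<Longrightarrow> j < sx d \<Longrightarrow> vars (C d $$ (i,j)) \<subseteq> {..<m}"
    and CB: "\<And>d. d \<in> D \<Longrightarrow> C d * B d = 1\<^sub>m (sx d)" and BC: "\<And>d. d \<in> D \<Longrightarrow> B d * C d = 1\<^sub>m (sx d)"
    by blast+
  \<comment> \<open>\<open>W v\<close> is the degree of the block that contains \<open>v\<close>,
    and \<open>v - m - \<alpha> (W v)\<close> the position of \<open>v\<close> in it.\<close>
  define G where "G = (\<lambda>v. if v < m then Var v else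
    \<Sum>t<sx (W v). C (W v) $$ (v - m - \<alpha> (W v), t) * Var (m + (\<alpha> (W v) + t)))"
  have G_block: "G (m + (\<alpha> d + i)) = (\<Sum>t<sx d. C d $$ (i,t) * Var (m + (\<alpha> d + t)))"
    if "d \<in> D" "i < sx d" for d i
    using block_var(2)[OF that] by (simp add: G_def)
  interpret S: comm_ring_hom "subst G" by (rule comm_ring_hom_subst)
  have G_low: "subst G p = p" if "vars p \<subseteq> {..<m}" for p
    by (rule subst_id) (use that in \<open>auto simp: G_def\<close>)
  have comp: "(\<Sum>t<s. X $$ (i,t) * (\<Sum>j<s. Y $$ (t,j) * f j)) = f i"
    if "X \<in> carrier_mat s s" "Y \<in> carrier_mat s s" "X * Y = 1\<^sub>m s" "i < s"
    for X Y :: "'a mpoly mat" and s i f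
  proof -
    have XY: "(\<Sum>t<s. X $$ (i,t) * Y $$ (t,j)) = (if i = j then 1 else 0)" if "j < s" for j
      using mult_mat_index[OF \<open>X \<in> _\<close> \<open>Y \<in> _\<close> \<open>i < s\<close> that] \<open>X * Y = _\<close> \<open>i < s\<close> that by simp
    have "(\<Sum>t<s. X $$ (i,t) * (\<Sum>j<s. Y $$ (t,j) * f j)) = (\<Sum>j<s. (\<Sum>t<s. X $$ (i,t) * Y $$ (t,j)) * f j)"
      unfolding sum_distrib_left sum_distrib_right by (subst sum.swap) (simp add: mult.assoc)
    also have "\<dots> = (\<Sum>j<s. (if i = j then f j else 0))"
      by (intro sum.cong) (auto simp: XY)
    finally show ?thesis using that(4) by simp
  qed
  have G: "vars (G v) \<subseteq> {..<n} \<and> \<phi> (G v) = Var v \<and> subst G (F ! v) = Var v" if "v < n" for v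
    using that
  proof (cases rule: block_cases)
    case 1
    then show ?thesis using mn F_low \<phi>_Var by (simp add: G_def)
  next
    case (2 d i)
    note d = 2(1) and i = 2(2)
    have "\<phi> (G v) = (\<Sum>t<sx d. C d $$ (i,t) * (\<Sum>j<sx d. B d $$ (t,j) * Var (m + (\<alpha> d + j))))"
      unfolding 2(3) G_block[OF d i] \<phi>.hom_sum \<phi>.hom_mult \<phi>_Var
      by (intro sum.cong refl) (simp add: \<phi>_low[OF C_vars[OF d i]] F_block[OF d])
    also have "\<dots> = Var v" unfolding 2(3) by (rule comp[OF C[OF d] B_carrier[OF d] CB[OF d] i])
    finally have 1: "\<phi> (G v) = Var v" .
    have "subst G (F ! v) = (\<Sum>t<sx d. B d $$ (i,t) * (\<Sum>j<sx d. C d $$ (t,j) * Var (m + (\<alpha> d + j))))"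
      unfolding 2(3) F_block[OF d i] S.hom_sum S.hom_mult subst_Var
      by (intro sum.cong refl) (simp add: G_low[OF B_vars[OF d i]] G_block[OF d])
    also have "\<dots> = Var v" unfolding 2(3) by (rule comp[OF B_carrier[OF d] C[OF d] BC[OF d] i])
    finally have 2: "subst G (F ! v) = Var v" .
    have "vars (G v) \<subseteq> {..<n}"
      unfolding \<open>v = _\<close> G_block[OF d i]
      by (rule linear_form_props(1)[OF d i, of "\<lambda>i t. C d $$ (i,t)"]) (rule C_vars[OF d])
    with 1 2 show ?thesis by simp
  qed
  show ?thesis
  proof (rule that[of "subst G"])
    show "comm_ring_hom (subst G)" by (rule comm_ring_hom_subst)
    fix p :: "'a mpoly" assume p: "vars p \<subseteq> {..<n}"
    show "vars (subst G p) \<subseteq> {..<n}" by (rule vars_subst_subset) (use G p in auto)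
    show "\<phi> (subst G p) = p"
      unfolding \<phi>_def subst_subst by (rule subst_id) (use G p in \<open>auto simp: \<phi>_def\<close>)
    show "subst G (\<phi> p) = p"
      unfolding \<phi>_def subst_subst by (rule subst_id) (use G p in auto)
  qed
qed

text \<open>The unimodular matrix problem pays off here: the left side is row
  \<open>i - \<gamma> (e i)\<close> of the product of \<open>Ad\<close> and \<open>B\<close> in
  degree \<open>e i\<close>, applied to the indeterminates of the block, and that row is a unit
  vector.\<close>

lemma linear_part_\<phi>:
  assumes i: "i < k"
  shows "(\<Sum>j<N. h i j * F ! (m + j)) = Var (u i)"
proof -
  let ?d = "e i" and ?i = "i - \<gamma> (e i)"
  note \<nu> = \<nu>_eq[OF i]
  have d: "?d \<in> D" by (rule e_in_D[OF i])
  have U: "solves_UMP (mpoly_ring {..<m}) (Ad ?d) (B ?d)" using B[OF d] \<nu>(2) by (auto split: if_splits)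
  have A: "Ad ?d \<in> carrier_mat (sg ?d) (sx ?d)" by simp
  have "(\<Sum>j<N. h i j * F ! (m + j)) = (\<Sum>j | j < N \<and> w j = ?d. h i j * F ! (m + j))"
    by (rule sum.mono_neutral_right) (use h_nonzero[OF i] in auto)
  also have "\<dots> = (\<Sum>t<sx ?d. h i (\<alpha> ?d + t) * F ! (m + (\<alpha> ?d + t)))"
    by (rule sum_block[OF w_mono d])
  also have "\<dots> = (\<Sum>t<sx ?d. Ad ?d $$ (?i, t) * (\<Sum>j<sx ?d. B ?d $$ (t,j) * Var (m + (\<alpha> ?d + j))))"
    using \<nu>(1,2) by (intro sum.cong refl) (simp add: F_block[OF d])
  also have "\<dots> = (\<Sum>j<sx ?d. (\<Sum>t<sx ?d. Ad ?d $$ (?i, t) * B ?d $$ (t,j)) * Var (m + (\<alpha> ?d + j)))"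
    unfolding sum_distrib_left sum_distrib_right by (subst sum.swap) (simp add: mult.assoc)
  also have "\<dots> = (\<Sum>j<sx ?d. if ?i = j then Var (m + (\<alpha> ?d + j)) else 0)"
    by (intro sum.cong refl) (simp add: solves_UMP_first_columns[OF A U \<nu>(2)])
  also have "\<dots> = Var (u i)" using \<nu>(3,4) by simp
  finally show ?thesis .
qed

section \<open>Successive substitution\<close>

definition "q i = - \<phi> (ht i)"

lemma \<phi>_g: assumes i: "i < k" shows "\<phi> (g i) = Var (u i) - q i"
proof -
  interpret \<phi>: comm_ring_hom \<phi> by (rule \<phi>_ring_hom)
  have "\<phi> (g i) = (\<Sum>j<N. h i j * F ! (m + j)) + \<phi> (ht i)"
    unfolding g_eq[OF i] \<phi>.hom_add \<phi>.hom_sum \<phi>.hom_mult \<phi>_Var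
    using \<phi>_low[OF h_vars[OF i]] by simp
  then show ?thesis by (simp add: linear_part_\<phi>[OF i] q_def)
qed

lemma q_vars: "i < k \<Longrightarrow> vars (q i) \<subseteq> {..<n}"
  using \<phi>_vars[OF ht_vars] by (simp add: q_def vars_uminus)

lemma q_hom: "i < k \<Longrightarrow> homogeneous W (e i) (q i)"
  unfolding q_def by (intro homogeneous_uminus \<phi>_hom ht_vars ht_hom)

text \<open>
  A term of \<open>q i\<close> contains at least two of the indeterminates of positive degree, so each of them
  has a degree less than \<open>e i\<close>.
\<close>

lemma q_small:
  assumes i: "i < k" and t: "t \<in> Poly_Mapping.keys (q i)" and v: "v \<in> Poly_Mapping.keys t" "m \<le> v"
  shows "W v < e i"
proof -
  have "t \<in> Poly_Mapping.keys (\<phi> (ht i))" using t by (simp add: q_def)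
  then obtain s where "s \<in> Poly_Mapping.keys (ht i)" "wdeg xw t = wdeg xw s"
    using wdeg_keys_subst[of t "\<lambda>v. F ! v" "ht i" xw] F_props(3) ht_vars[OF i] by (auto simp: \<phi>_def)
  then have x2: "2 \<le> wdeg xw t" using ht_order[OF i] by simp
  have eW: "wdeg W t = e i" using q_hom[OF i] t by (simp add: homogeneous_def)
  have tn: "Poly_Mapping.keys t \<subseteq> {..<n}" using q_vars[OF i] t by (auto simp: vars_def)
  \<comment> \<open>One factor \<open>v\<close> is split off. The rest still contains an x, and
    every x has weight at least 1, so \<open>wdeg W t'\<close> is positive and \<open>W v\<close>
    falls short of \<open>e i\<close>.\<close>
  define t' where "t' = t - Poly_Mapping.single v 1"
  have tt: "t = Poly_Mapping.single v 1 + t'"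
    by (rule poly_mapping_eqI)
      (use v(1) in \<open>auto simp: t'_def lookup_add lookup_minus lookup_single when_def in_keys_iff\<close>)
  have "Poly_Mapping.keys t' \<subseteq> {..<n}"
  proof
    fix x assume "x \<in> Poly_Mapping.keys t'"
    then have "x \<in> Poly_Mapping.keys t" by (subst tt) (simp add: in_keys_iff lookup_add)
    then show "x \<in> {..<n}" using tn by blast
  qed
  then have "wdeg xw t' \<le> wdeg W t'"
    unfolding wdeg_def using W_pos W_zero by (intro sum_mono mult_right_mono) force+
  moreover have "wdeg xw t = 1 + wdeg xw t'" using v(2) by (subst tt) (simp add: wdeg_add)
  moreover have "wdeg W t = W v + wdeg W t'" by (subst tt) (simp add: wdeg_add)
  ultimately show ?thesis using x2 eW by simp
qed

text \<open>The degrees \<open>e\<close> increase weakly with the index, while each x in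
  \<open>q i\<close> has degree less than \<open>e i\<close>. In particular \<open>u i\<close>
  itself does not occur in \<open>q i\<close>.\<close>

lemma q_no_u:
  assumes i: "i < k" and j: "j < k" and ij: "u j \<in> vars (q i)"
  shows "j < i"
proof (rule ccontr)
  assume "\<not> j < i"
  then have "e i \<le> e j" using mono_onD[OF e_mono, of i j] i j by auto
  moreover obtain t where "t \<in> Poly_Mapping.keys (q i)" "u j \<in> Poly_Mapping.keys t" using ij by (auto simp: vars_def)
  then have "W (u j) < e i" using u_props(1)[OF j] by (intro q_small[OF i])
  ultimately show False using u_props(3)[OF j] by simp
qed

definition "qt = eliminant u (\<lambda>i. \<phi> (g i))"

lemma replace_g: "i < k \<Longrightarrow> replace_vars u qt i (\<phi> (g i)) = Var (u i) - qt i"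
  unfolding qt_def by (rule replace_vars_eliminant) (rule u_inj_le, simp)

lemma replace_u:
  assumes "i \<le> k" "j < i"
  shows "replace_vars u qt i (Var (u j)) = qt j"
  by (rule replace_vars_Var(1)[OF u_inj_le[OF assms(1)] assms(2)])

lemma replace_Var:
  assumes "i \<le> k" "v \<notin> u ` {..<i}"
  shows "replace_vars u qt i (Var v) = Var v"
  by (rule replace_vars_Var(2)[OF u_inj_le[OF assms(1)] assms(2)])

lemma qt_eq: assumes i: "i < k" shows "qt i = replace_vars u qt i (q i)"
proof -
  interpret R: comm_ring_hom "replace_vars u qt i" by (rule comm_ring_hom_replace_vars)
  have "u i \<notin> u ` {..<i}" using inj_on_eq_iff[OF u_inj, of i] i by auto
  then have "replace_vars u qt i (Var (u i)) = Var (u i)"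
    by (intro replace_Var) (use i in simp)
  then show ?thesis using replace_g[OF i] by (simp add: \<phi>_g[OF i] R.hom_minus)
qed

text \<open>Every eliminated indeterminate in \<open>q i\<close> has an index below \<open>i\<close>
  and is replaced by a polynomial of its own degree in which no eliminated indeterminate is
  left.\<close>

lemma qt_props:
  assumes "i < k"
  shows "vars (qt i) \<subseteq> Vh \<and> homogeneous W (e i) (qt i)"
  using assms
proof (induction i rule: less_induct)
  case (less i)
  have ik: "i \<le> k" using less.prems by simp
  have *: "vars (replace_vars u qt i (Var v)) \<subseteq> Vh \<and> homogeneous W (W v) (replace_vars u qt i (Var v))"
    if v: "v \<in> vars (q i)" for v
  proof (cases "v \<in> u ` {..<k}")
    case True
    then obtain j where j: "j < k" "v = u j" by auto
    then have "j < i" using q_no_u[OF less.prems j(1)] v by simp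
    then show ?thesis
      using less.IH[OF _ j(1)] replace_u[OF ik, of j] j u_props(3)[OF j(1)] by simp
  next
    case False
    then have "replace_vars u qt i (Var v) = Var v"
      by (intro replace_Var[OF ik]) (use ik in auto)
    then show ?thesis using False v q_vars[OF less.prems] by auto
  qed
  let ?S = "\<lambda>v. replace_vars u qt i (Var v)"
  have "qt i = subst ?S (q i)"
    using qt_eq[OF less.prems] fun_cong[OF replace_vars_eq_subst, of u qt i "q i"] by (rule trans)
  moreover have "vars (subst ?S (q i)) \<subseteq> Vh" by (rule vars_subst_subset) (use * in blast)
  moreover have "homogeneous W (e i) (subst ?S (q i))"
    by (rule homogeneous_subst[OF q_hom[OF less.prems]]) (use * in blast)
  ultimately show ?case by (simp only:)
qed

definition "\<psi> = replace_vars u qt k"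

lemma \<psi>_ring_hom: "comm_ring_hom \<psi>"
  unfolding \<psi>_def by (rule comm_ring_hom_replace_vars)

lemma \<psi>_u: "i < k \<Longrightarrow> \<psi> (Var (u i)) = qt i"
  unfolding \<psi>_def by (rule replace_vars_Var(1)[OF u_inj])

lemma \<psi>_Var: "v \<notin> u ` {..<k} \<Longrightarrow> \<psi> (Var v) = Var v"
  unfolding \<psi>_def by (rule replace_vars_Var(2)[OF u_inj])

lemma \<psi>_subst: "\<psi> = subst (\<lambda>v. \<psi> (Var v))"
  unfolding \<psi>_def by (rule replace_vars_eq_subst)

lemma \<psi>_Var_props:
  assumes "v < n"
  shows "vars (\<psi> (Var v)) \<subseteq> Vh \<and> homogeneous W (W v) (\<psi> (Var v))"
proof (cases "v \<in> u ` {..<k}")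
  case True
  then obtain i where "i < k" "v = u i" by auto
  then show ?thesis using qt_props[of i] u_props(3)[of i] \<psi>_u[of i] by simp
qed (use assms \<psi>_Var in auto)

lemma \<psi>_vars: "vars p \<subseteq> {..<n} \<Longrightarrow> vars (\<psi> p) \<subseteq> Vh"
  by (subst \<psi>_subst, rule vars_subst_subset) (use \<psi>_Var_props in blast)

lemma \<psi>_hom: "vars p \<subseteq> {..<n} \<Longrightarrow> homogeneous W d p \<Longrightarrow> homogeneous W d (\<psi> p)"
  by (subst \<psi>_subst, rule homogeneous_subst) (use \<psi>_Var_props in blast)+

lemma \<psi>_id: "vars p \<subseteq> Vh \<Longrightarrow> \<psi> p = p"
  by (subst \<psi>_subst, rule subst_id) (use \<psi>_Var in auto)

text \<open>Since \<open>q i\<close> involves \<open>u j\<close> only for \<open>j < i\<close>, the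
  full substitution agrees on it with that of stage \<open>i\<close>, which yields
  \<open>qt i\<close>.\<close>

lemma \<psi>_\<phi>_g: assumes i: "i < k" shows "\<psi> (\<phi> (g i)) = 0"
proof -
  interpret \<psi>: comm_ring_hom \<psi> by (rule \<psi>_ring_hom)
  have ik: "i \<le> k" using i by simp
  have "\<psi> (Var v) = replace_vars u qt i (Var v)" if v: "v \<in> vars (q i)" for v
  proof (cases "v \<in> u ` {..<k}")
    case True
    then obtain j where j: "j < k" "v = u j" by auto
    then have "j < i" using q_no_u[OF i j(1)] v by simp
    then show ?thesis using replace_u[OF ik, of j] \<psi>_u[OF j(1)] j by simp
  next
    case False
    then have "v \<notin> u ` {..<i}" using ik by auto
    then show ?thesis using replace_Var[OF ik] \<psi>_Var[OF False] by simp
  qed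
  then have "\<psi> (q i) = replace_vars u qt i (q i)"
    by (subst \<psi>_subst, subst replace_vars_eq_subst) (rule subst_cong)
  then show ?thesis using \<phi>_g[OF i] \<psi>_u[OF i] qt_eq[OF i] by (simp add: \<psi>.hom_minus)
qed

text \<open>\<open>L\<close> stands for the image of the ideal \<open>I\<close> under
  \<open>\<phi>\<close>. Modulo \<open>L\<close>, strong induction makes \<open>qt i\<close>
  congruent to the indeterminate \<open>u i\<close> that it replaces, so \<open>\<psi>\<close>
  preserves residue classes.\<close>

lemma \<psi>_cong_ideal:
  assumes L: "ideal L (mpoly_ring {..<n})" and gL: "\<And>i. i < k \<Longrightarrow> \<phi> (g i) \<in> L" and p: "vars p \<subseteq> {..<n}"
  shows "\<psi> p - p \<in> L"
proof -
  note LD = ideal_mpoly_ringD[OF L] and LC = ideal_closed[OF L]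
  have step: "replace_vars u qt i p - p \<in> L"
    if "i \<le> k" "\<And>j. j < i \<Longrightarrow> qt j - Var (u j) \<in> L" "vars p \<subseteq> {..<n}" for i p
  proof -
    have "subst (\<lambda>v. replace_vars u qt i (Var v)) p - subst Var p \<in> L"
    proof (rule subst_cong_ideal[OF L])
      fix v assume v: "v \<in> vars p"
      show "vars (replace_vars u qt i (Var v)) \<subseteq> {..<n} \<and> vars (Var v :: 'a mpoly) \<subseteq> {..<n} \<and>
        replace_vars u qt i (Var v) - Var v \<in> L"
      proof (cases "v \<in> u ` {..<i}")
        case True
        then obtain j where j: "j < i" "v = u j" by auto
        then have "vars (qt j) \<subseteq> {..<n}" using qt_props[of j] that(1) by auto
        then show ?thesis using j that(2)[OF j(1)] that(3) replace_u[OF that(1) j(1)] v by auto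
      next
        case False
        then show ?thesis using replace_Var[OF that(1) False] LD(2) v that(3) by auto
      qed
    qed
    moreover have "subst Var p = p" by (rule subst_id) simp
    ultimately show ?thesis using fun_cong[OF replace_vars_eq_subst, of u qt i p] by (simp only:)
  qed
  have qtL: "qt i - Var (u i) \<in> L" if "i < k" for i
    using that
  proof (induction i rule: less_induct)
    case (less i)
    have q: "vars (\<phi> (g i)) \<subseteq> {..<n}"
      unfolding \<phi>_g[OF less.prems] by (intro vars_diff_subset q_vars) (use less.prems u_props in auto)
    have "replace_vars u qt i (\<phi> (g i)) - \<phi> (g i) \<in> L"
      by (rule step[OF _ _ q]) (use less in auto)
    then have "- ((replace_vars u qt i (\<phi> (g i)) - \<phi> (g i)) + \<phi> (g i)) \<in> L"
      by (intro LC(2) LD(3) gL less.prems)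
    then show ?case by (simp add: replace_g[OF less.prems])
  qed
  show ?thesis unfolding \<psi>_def by (rule step[OF _ qtL p]) simp_all
qed

end

section \<open>The induced isomorphism\<close>

lemma ideal_image:
  assumes I: "ideal I (mpoly_ring V)" and T: "comm_ring_hom T"
    and vars: "\<And>p. vars p \<subseteq> V \<Longrightarrow> vars (T p) \<subseteq> V'"
    and surj: "\<And>c. vars c \<subseteq> V' \<Longrightarrow> \<exists>c'. vars c' \<subseteq> V \<and> T c' = c"
  shows "ideal (T ` I) (mpoly_ring V')"
proof -
  note ID = ideal_mpoly_ringD[OF I]
  interpret T: comm_ring_hom T by (rule T)
  show ?thesis
  proof (rule ideal_mpoly_ringI)
    show "0 \<in> T ` I" using ID(2) by (rule rev_image_eqI) simp
    fix x assume "x \<in> T ` I"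
    then obtain a where a: "a \<in> I" "x = T a" by blast
    show "vars x \<subseteq> V'" using vars[OF ID(1)[OF a(1)]] a(2) by simp
    show "c * x \<in> T ` I" if c: "vars c \<subseteq> V'" for c
    proof -
      obtain c' where "vars c' \<subseteq> V" "T c' = c" using surj[OF c] by blast
      then show ?thesis
        using a by (intro rev_image_eqI[OF ID(4)[OF a(1), of c']]) (simp_all add: T.hom_mult)
    qed
    fix y assume "y \<in> T ` I"
    then obtain b where b: "b \<in> I" "y = T b" by blast
    then show "x + y \<in> T ` I"
      using a by (intro rev_image_eqI[OF ID(3)[OF a(1) b(1)]]) (simp add: T.hom_add)
  qed
qed

text \<open>First isomorphism theorem for \<open>T\<close> followed by the projection modulo
  \<open>J\<close>, whose kernel is \<open>I\<close> by \<open>ker\<close>.\<close>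

lemma quotient_alg_iso:
  assumes I: "ideal I (mpoly_ring V)" and J: "ideal J (mpoly_ring V')" and T: "comm_ring_hom T"
    and vars: "\<And>p. vars p \<subseteq> V \<Longrightarrow> vars (T p) \<subseteq> V'"
    and surj: "\<And>c. vars c \<subseteq> V' \<Longrightarrow> \<exists>c'. vars c' \<subseteq> V \<and> T c' = c"
    and Const: "\<And>c. T (Const c) = Const c"
    and ker: "\<And>p. vars p \<subseteq> V \<Longrightarrow> T p \<in> J \<longleftrightarrow> p \<in> I"
  defines "P \<equiv> mpoly_ring V" and "Q \<equiv> mpoly_ring V'"
  shows "\<exists>\<Theta> \<in> alg_iso (P Quot I) (\<lambda>c. I +>\<^bsub>P\<^esub> Const c) (Q Quot J) (\<lambda>c. J +>\<^bsub>Q\<^esub> Const c).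
    \<forall>f\<in>carrier P. \<Theta> (I +>\<^bsub>P\<^esub> f) = J +>\<^bsub>Q\<^esub> T f"
proof -
  interpret T: comm_ring_hom T by (rule T)
  interpret P: ring P unfolding P_def by (rule ring_mpoly_ring)
  interpret Q: ring Q unfolding Q_def by (rule ring_mpoly_ring)
  interpret J: ideal J Q using J by (simp add: Q_def)
  let ?h = "\<lambda>p. J +>\<^bsub>Q\<^esub> T p"
  have "T \<in> Ring.ring_hom P Q"
    by (rule ring_hom_memI) (auto simp: P_def Q_def T.hom_add T.hom_mult vars[THEN subsetD])
  then have "(+>\<^bsub>Q\<^esub>) J \<circ> T \<in> Ring.ring_hom P (Q Quot J)"
    by (rule ring_hom_trans[OF _ J.rcos_ring_hom])
  then have "?h \<in> Ring.ring_hom P (Q Quot J)" by (simp add: comp_def)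
  then interpret h: ring_hom_ring P "Q Quot J" ?h
    by (intro ring_hom_ringI2 P.ring_axioms J.quotient_is_ring)
  have "a_kernel P (Q Quot J) ?h = {p \<in> carrier P. T p \<in> J}"
  proof -
    have "?h p = J \<longleftrightarrow> T p \<in> J" if p: "p \<in> carrier P" for p
    proof -
      have Tp: "T p \<in> carrier Q" using vars p by (simp add: P_def Q_def)
      show ?thesis
        using Q.a_coset_join1[OF _ Tp J.a_subgroup] Q.a_coset_join2[OF Tp J.a_subgroup] by blast
    qed
    moreover have "zero (Q Quot J) = J" by (simp add: FactRing_def)
    ultimately show ?thesis
      unfolding a_kernel_def' by (intro Collect_cong conj_cong refl) (simp only:)
  qed
  also have "\<dots> = I" using ker ideal_mpoly_ringD(1)[OF I] by (auto simp: P_def)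
  finally have K: "a_kernel P (Q Quot J) ?h = I" .
  have "?h ` carrier P = carrier (Q Quot J)"
  proof (intro subset_antisym subsetI)
    fix X assume "X \<in> carrier (Q Quot J)"
    then obtain c where c: "c \<in> carrier Q" "X = J +>\<^bsub>Q\<^esub> c"
      by (auto simp: FactRing_def A_RCOSETS_def')
    obtain c' where c': "vars c' \<subseteq> V" "T c' = c" using surj[of c] c(1) by (auto simp: Q_def)
    have "X = ?h c'" unfolding c' c(2) ..
    moreover have "c' \<in> carrier P" using c'(1) by (simp add: P_def)
    ultimately show "X \<in> ?h ` carrier P" by (rule image_eqI)
  next
    fix X assume "X \<in> ?h ` carrier P"
    then show "X \<in> carrier (Q Quot J)" by (elim imageE) (simp only: h.hom_closed)
  qed
  from h.FactRing_iso_set[OF this]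
  have iso: "(\<lambda>X. the_elem (?h ` X)) \<in> ring_iso (P Quot I) (Q Quot J)" by (simp only: K)
  have val: "the_elem (?h ` (I +>\<^bsub>P\<^esub> f)) = ?h f" if "f \<in> carrier P" for f
    using h.the_elem_simp[OF that] by (simp only: K)
  have "Const c \<in> carrier P" for c by (simp add: P_def)
  then have alg: "(\<lambda>X. the_elem (?h ` X)) \<in>
      alg_iso (P Quot I) (\<lambda>c. I +>\<^bsub>P\<^esub> Const c) (Q Quot J) (\<lambda>c. J +>\<^bsub>Q\<^esub> Const c)"
    using iso by (simp add: alg_iso_def val Const)
  show ?thesis by (rule bexI[OF _ alg]) (intro ballI val)
qed

lemma alg_hom_mpoly_ringI:
  fixes T :: "'b::field mpoly \<Rightarrow> 'b mpoly"
  assumes "comm_ring_hom T" "\<And>p. vars p \<subseteq> V \<Longrightarrow> vars (T p) \<subseteq> V'" "\<And>c. T (Const c) = Const c"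
  shows "T \<in> alg_hom (mpoly_ring V) Const (mpoly_ring V') Const"
proof -
  interpret T: comm_ring_hom T by fact
  have "T \<in> Ring.ring_hom (mpoly_ring V) (mpoly_ring V')"
    by (rule ring_hom_memI) (use assms(2) in \<open>simp_all add: T.hom_add T.hom_mult\<close>)
  then show ?thesis using assms(3) by (simp add: alg_hom_def)
qed

locale full_elimination = elimination +
  fixes r :: nat
  assumes kr: "k \<le> r"
    and g_all_vars: "\<And>i. i < r \<Longrightarrow> vars (g i) \<subseteq> {..<n}"
    and g_all_hom: "\<And>i. i < r \<Longrightarrow> homogeneous W (e i) (g i)"
begin

abbreviation "I \<equiv> genideal (mpoly_ring {..<n}) (g ` {..<r})"
abbreviation "\<theta> \<equiv> \<psi> \<circ> \<phi>"
abbreviation "J \<equiv> genideal (mpoly_ring Vh) (\<theta> ` g ` {k..<r})"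

lemma \<theta>_ring_hom: "comm_ring_hom \<theta>"
  using comm_ring_hom_comp[OF \<psi>_ring_hom \<phi>_ring_hom] by (simp add: comp_def)

lemma \<theta>_vars: "vars p \<subseteq> {..<n} \<Longrightarrow> vars (\<theta> p) \<subseteq> Vh"
  by (simp add: \<psi>_vars \<phi>_vars)

text \<open>\<open>\<psi>\<close> fixes \<open>c\<close>, so a preimage of \<open>c\<close> under
  \<open>\<phi>\<close> is one under \<open>\<theta>\<close>.\<close>

lemma \<theta>_surj: "vars c \<subseteq> Vh \<Longrightarrow> \<exists>c'. vars c' \<subseteq> {..<n} \<and> \<theta> c' = c"
proof -
  assume c: "vars c \<subseteq> Vh"
  obtain \<phi>' where "\<And>p. vars p \<subseteq> {..<n} \<Longrightarrow> vars (\<phi>' p) \<subseteq> {..<n}" "\<And>p. vars p \<subseteq> {..<n} \<Longrightarrow> \<phi> (\<phi>' p) = p"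
    by (rule \<phi>_inverse) blast
  moreover have "vars c \<subseteq> {..<n}" using c by blast
  ultimately show ?thesis using \<psi>_id[OF c] by (intro exI[of _ "\<phi>' c"]) simp
qed

lemma \<theta>_Const: "\<theta> (Const c) = Const c"
  by (simp add: \<phi>_def \<psi>_def replace_vars_def)

lemma I_ideal: "ideal I (mpoly_ring {..<n})"
  by (rule ring.genideal_ideal[OF ring_mpoly_ring]) (use g_all_vars in auto)

lemma J_gen: "\<theta> ` g ` {k..<r} \<subseteq> carrier (mpoly_ring Vh)"
  using \<theta>_vars[OF g_all_vars] by (auto simp: image_subset_iff)

lemma J_ideal: "ideal J (mpoly_ring Vh)"
  by (rule ring.genideal_ideal[OF ring_mpoly_ring J_gen])

lemma g_in_I: "i < r \<Longrightarrow> g i \<in> I"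
proof -
  have "g ` {..<r} \<subseteq> carrier (mpoly_ring {..<n})" using g_all_vars by auto
  from ring.genideal_self[OF ring_mpoly_ring this] show "i < r \<Longrightarrow> g i \<in> I" by blast
qed

lemma \<theta>_in_J_iff:
  assumes p: "vars p \<subseteq> {..<n}"
  shows "\<theta> p \<in> J \<longleftrightarrow> p \<in> I"
proof
  interpret \<theta>: comm_ring_hom \<theta> by (rule \<theta>_ring_hom)
  note ID = ideal_mpoly_ringD[OF I_ideal] and JD = ideal_mpoly_ringD[OF J_ideal]
  {
    \<comment> \<open>The preimage of \<open>J\<close> is an ideal; it contains \<open>g i\<close>
      for \<open>i < k\<close> because \<open>\<theta>\<close> kills it, and the other generators by
      the choice of \<open>J\<close>.\<close>
    let ?K = "{p. vars p \<subseteq> {..<n} \<and> \<theta> p \<in> J}"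
    have "ideal ?K (mpoly_ring {..<n})"
    proof (rule ideal_mpoly_ringI)
      show "0 \<in> ?K" using JD(2) \<theta>.hom_zero by simp
      fix x assume x: "x \<in> ?K"
      then show "vars x \<subseteq> {..<n}" by blast
      show "c * x \<in> ?K" if "vars c \<subseteq> {..<n}" for c
        using x that JD(4)[OF _ \<theta>_vars[OF that]] \<theta>.hom_mult[of c x] by (simp add: vars_mult_subset)
      fix y assume "y \<in> ?K"
      then show "x + y \<in> ?K" using x JD(3) \<theta>.hom_add[of x y] by (simp add: vars_add_subset)
    qed
    moreover have "g ` {..<r} \<subseteq> ?K"
    proof
      fix x assume "x \<in> g ` {..<r}"
      then obtain i where i: "i < r" "x = g i" by auto
      have "\<theta> (g i) \<in> J"
      proof (cases "i < k")
        case True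
        then show ?thesis using \<psi>_\<phi>_g JD(2) by simp
      next
        case False
        then have "\<theta> (g i) \<in> \<theta> ` g ` {k..<r}" using i by (intro imageI) auto
        then show ?thesis using ring.genideal_self[OF ring_mpoly_ring J_gen] by blast
      qed
      then show "x \<in> ?K" using i g_all_vars by simp
    qed
    ultimately have "I \<subseteq> ?K" by (rule ring.genideal_minimal[OF ring_mpoly_ring])
    then show "p \<in> I \<Longrightarrow> \<theta> p \<in> J" by blast
  }
  assume "\<theta> p \<in> J"
  \<comment> \<open>Surjectivity makes the image of \<open>I\<close> an ideal, so
    \<open>\<theta> p\<close> is also the value at some \<open>c\<close> in \<open>I\<close>, and
    \<open>\<theta>\<close> kills \<open>p - c\<close>.\<close>
  moreover have "J \<subseteq> \<theta> ` I"
  proof (rule ring.genideal_minimal[OF ring_mpoly_ring])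
    show "ideal (\<theta> ` I) (mpoly_ring Vh)"
      by (rule ideal_image[OF I_ideal \<theta>_ring_hom \<theta>_vars \<theta>_surj])
    show "\<theta> ` g ` {k..<r} \<subseteq> \<theta> ` I" using g_in_I by (intro image_mono) auto
  qed
  ultimately obtain c where c: "c \<in> I" "\<theta> p = \<theta> c" by blast
  have d: "vars (p - c) \<subseteq> {..<n}" by (rule vars_diff_subset[OF p ID(1)[OF c(1)]])
  obtain \<phi>' where \<phi>': "\<And>p. vars p \<subseteq> {..<n} \<Longrightarrow> vars (\<phi>' p) \<subseteq> {..<n}"
    "\<And>p. vars p \<subseteq> {..<n} \<Longrightarrow> \<phi> (\<phi>' p) = p" "\<And>p. vars p \<subseteq> {..<n} \<Longrightarrow> \<phi>' (\<phi> p) = p"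
    by (rule \<phi>_inverse) blast
  have surj: "\<exists>c'. vars c' \<subseteq> {..<n} \<and> \<phi> c' = c" if "vars c \<subseteq> {..<n}" for c
    using \<phi>'(1,2)[OF that] by blast
  have L: "ideal (\<phi> ` I) (mpoly_ring {..<n})"
    by (rule ideal_image[OF I_ideal \<phi>_ring_hom \<phi>_vars surj])
  \<comment> \<open>The first term is 0, so \<open>\<phi> (p - c)\<close> lies in the image of
    \<open>I\<close>; injectivity of \<open>\<phi>\<close> brings \<open>p - c\<close> into
    \<open>I\<close>.\<close>
  have "\<psi> (\<phi> (p - c)) - \<phi> (p - c) \<in> \<phi> ` I"
    by (rule \<psi>_cong_ideal[OF L _ \<phi>_vars[OF d]]) (use g_in_I kr in auto)
  moreover have "\<psi> (\<phi> (p - c)) = 0" using \<theta>.hom_minus[of p c] c(2) by simp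
  ultimately have "\<phi> (p - c) \<in> \<phi> ` I"
    using ideal_closed(2)[OF L, of "- \<phi> (p - c)"] by simp
  then obtain c' where c': "c' \<in> I" "\<phi> (p - c) = \<phi> c'" by blast
  have "p - c = \<phi>' (\<phi> c')" using \<phi>'(3)[OF d] c'(2) by simp
  also have "\<dots> = c'" by (rule \<phi>'(3)[OF ID(1)[OF c'(1)]])
  finally have "p - c \<in> I" using c'(1) by simp
  from ID(3)[OF this c(1)] show "p \<in> I" by simp
qed

lemma J_homogeneous: "homogeneous_ideal (mpoly_ring Vh) W J"
proof (rule genideal_homogeneous[OF J_gen])
  fix p assume "p \<in> \<theta> ` g ` {k..<r}"
  then obtain i where i: "i < r" "p = \<psi> (\<phi> (g i))" by auto
  then have "homogeneous W (e i) p"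
    using \<psi>_hom[OF \<phi>_vars \<phi>_hom] g_all_vars g_all_hom by simp
  then show "\<exists>d. homogeneous W d p" by blast
qed

lemma q_no_own: "i < k \<Longrightarrow> t \<in> Poly_Mapping.keys (q i) \<Longrightarrow> u i \<notin> Poly_Mapping.keys t"
  using q_no_u[of i i] by (fastforce simp: vars_def)

lemma construction:
  "length F = n \<and> set F \<subseteq> carrier (mpoly_ring {..<n}) \<and>
   \<phi> \<in> alg_hom (mpoly_ring {..<n}) Const (mpoly_ring {..<n}) Const \<and>
   (\<forall>v<n. \<phi> (Var v) = F ! v) \<and>
   (\<forall>i<k. q i \<in> carrier (mpoly_ring {..<n}) \<and> \<phi> (g i) = Var (u i) - q i \<and>
      (\<forall>t\<in>Poly_Mapping.keys (q i). u i \<notin> Poly_Mapping.keys t)) \<and>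
   (\<forall>i<k. replace_vars u qt i (\<phi> (g i)) = Var (u i) - qt i) \<and>
   \<psi> \<in> alg_hom (mpoly_ring {..<n}) Const (mpoly_ring Vh) Const \<and>
   (\<forall>v<m. \<psi> (Var v) = Var v) \<and> (\<forall>i<k. \<psi> (Var (u i)) = qt i) \<and> (\<forall>v\<in>Vh. \<psi> (Var v) = Var v) \<and>
   card Vh = n - k \<and> homogeneous_ideal (mpoly_ring Vh) W J \<and>
   (\<exists>\<Theta> \<in> alg_iso (mpoly_ring {..<n} Quot I) (\<lambda>c. I +>\<^bsub>mpoly_ring {..<n}\<^esub> Const c)
      (mpoly_ring Vh Quot J) (\<lambda>c. J +>\<^bsub>mpoly_ring Vh\<^esub> Const c).
      \<forall>f\<in>carrier (mpoly_ring {..<n}). \<Theta> (I +>\<^bsub>mpoly_ring {..<n}\<^esub> f) = J +>\<^bsub>mpoly_ring Vh\<^esub> \<theta> f)"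
proof (intro conjI)
  show "length F = n" by (rule length_F)
  show "set F \<subseteq> carrier (mpoly_ring {..<n})"
  proof
    fix p assume "p \<in> set F"
    then obtain v where "v < n" "p = F ! v" using length_F by (auto simp: in_set_conv_nth)
    then show "p \<in> carrier (mpoly_ring {..<n})" using F_props(1) by simp
  qed
  show "\<phi> \<in> alg_hom (mpoly_ring {..<n}) Const (mpoly_ring {..<n}) Const"
    by (rule alg_hom_mpoly_ringI[OF \<phi>_ring_hom \<phi>_vars]) (simp_all add: \<phi>_def)
  show "\<forall>v<n. \<phi> (Var v) = F ! v" by (simp add: \<phi>_Var)
  show "\<forall>i<k. q i \<in> carrier (mpoly_ring {..<n}) \<and> \<phi> (g i) = Var (u i) - q i \<and> (\<forall>t\<in>Poly_Mapping.keys (q i). u i \<notin> Poly_Mapping.keys t)"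
    using q_vars \<phi>_g q_no_own by simp
  show "\<forall>i<k. replace_vars u qt i (\<phi> (g i)) = Var (u i) - qt i" using replace_g by blast
  show "\<psi> \<in> alg_hom (mpoly_ring {..<n}) Const (mpoly_ring Vh) Const"
    by (rule alg_hom_mpoly_ringI[OF \<psi>_ring_hom \<psi>_vars]) (simp_all add: \<psi>_def replace_vars_def)
  show "\<forall>v<m. \<psi> (Var v) = Var v"
  proof (intro allI impI \<psi>_Var)
    fix v assume "v < m"
    then show "v \<notin> u ` {..<k}" using u_props(1) by fastforce
  qed
  show "\<forall>i<k. \<psi> (Var (u i)) = qt i" using \<psi>_u by blast
  show "\<forall>v\<in>Vh. \<psi> (Var v) = Var v" using \<psi>_Var by blast
  show "card Vh = n - k" by (rule card_Vh)
  show "homogeneous_ideal (mpoly_ring Vh) W J" by (rule J_homogeneous)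
  show "\<exists>\<Theta> \<in> alg_iso (mpoly_ring {..<n} Quot I) (\<lambda>c. I +>\<^bsub>mpoly_ring {..<n}\<^esub> Const c)
      (mpoly_ring Vh Quot J) (\<lambda>c. J +>\<^bsub>mpoly_ring Vh\<^esub> Const c).
      \<forall>f\<in>carrier (mpoly_ring {..<n}). \<Theta> (I +>\<^bsub>mpoly_ring {..<n}\<^esub> f) = J +>\<^bsub>mpoly_ring Vh\<^esub> \<theta> f"
    by (rule quotient_alg_iso[OF I_ideal J_ideal \<theta>_ring_hom \<theta>_vars \<theta>_surj \<theta>_Const \<theta>_in_J_iff])
qed

end

section \<open>The ideal generated by the x's and its square\<close>

lemma keys_genideal_Var:
  assumes "p \<in> genideal (mpoly_ring {..<n}) (Var ` {m..<n})" "t \<in> Poly_Mapping.keys p"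
  shows "1 \<le> wdeg (\<lambda>v. if m \<le> v then 1 else 0) t"
proof -
  let ?xw = "\<lambda>v. if m \<le> v then 1 else 0 :: int"
  \<comment> \<open>The polynomials all of whose terms contain some x form an ideal that contains
    the generators.\<close>
  let ?T = "{p :: 'a mpoly. \<forall>t\<in>Poly_Mapping.keys p. 1 \<le> wdeg ?xw t}"
  have nonneg: "0 \<le> wdeg ?xw t" for t unfolding wdeg_def by (rule sum_nonneg) simp
  have "type_ideal ?T"
    unfolding type_ideal_def
  proof (intro conjI ballI allI)
    fix x assume x: "x \<in> ?T"
    show "c * x \<in> ?T" for c
    proof (rule CollectI, rule ballI)
      fix t assume "t \<in> Poly_Mapping.keys (c * x)"
      then obtain a b where ab: "t = a + b" "b \<in> Poly_Mapping.keys x" using Poly_Mapping.keys_mult[of c x] by blast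
      then have "1 \<le> wdeg ?xw b" using x by blast
      then show "1 \<le> wdeg ?xw t" using ab(1) nonneg[of a] by (simp add: wdeg_add)
    qed
    fix y assume "y \<in> ?T"
    then show "x + y \<in> ?T" using x Poly_Mapping.keys_add[of x y] by blast
  qed simp
  moreover have "Var ` {m..<n} \<subseteq> ?T" by (auto simp: Var_def)
  ultimately have "genideal (mpoly_ring {..<n}) (Var ` {m..<n}) \<subseteq> ?T"
    by (rule genideal_subset_type_ideal) auto
  with assms show ?thesis by blast
qed

text \<open>The weight that counts the x's is additive, so a product of two terms that each contain
  an x has weight at least 2.\<close>

lemma keys_ideal_prod_Var:
  fixes p :: "'a::field mpoly" and m n :: nat
  defines "X \<equiv> genideal (mpoly_ring {..<n}) (Var ` {m..<n})"
  assumes "p \<in> ideal_prod (mpoly_ring {..<n}) X X"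
  shows "vars p \<subseteq> {..<n}" "\<And>t. t \<in> Poly_Mapping.keys p \<Longrightarrow> 2 \<le> wdeg (\<lambda>v. if m \<le> v then 1 else 0) t"
proof -
  have X: "ideal X (mpoly_ring {..<n})"
    unfolding X_def by (rule ring.genideal_ideal[OF ring_mpoly_ring]) auto
  have "vars p \<subseteq> {..<n} \<and> (\<forall>t\<in>Poly_Mapping.keys p. 2 \<le> wdeg (\<lambda>v. if m \<le> v then 1 else 0) t)"
    using assms(2)
  proof (induction rule: ideal_prod.induct)
    case (prod i j)
    have "2 \<le> wdeg (\<lambda>v. if m \<le> v then 1 else 0) t" if t: "t \<in> Poly_Mapping.keys (i * j)" for t
    proof -
      obtain a b where ab: "t = a + b" "a \<in> Poly_Mapping.keys i" "b \<in> Poly_Mapping.keys j" using t Poly_Mapping.keys_mult[of i j] by blast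
      show ?thesis
        using keys_genideal_Var[OF prod(1)[unfolded X_def] ab(2)] keys_genideal_Var[OF prod(2)[unfolded X_def] ab(3)]
        by (simp add: ab(1) wdeg_add)
    qed
    then show ?case
      using ideal_mpoly_ringD(1)[OF X prod(1)] ideal_mpoly_ringD(1)[OF X prod(2)] vars_mult_subset by simp
  next
    case (sum p q)
    then show ?case using Poly_Mapping.keys_add[of p q] by (auto simp: vars_add_subset simp del: subset_iff)
  qed
  then show "vars p \<subseteq> {..<n}" "\<And>t. t \<in> Poly_Mapping.keys p \<Longrightarrow> 2 \<le> wdeg (\<lambda>v. if m \<le> v then 1 else 0) t"
    by blast+
qed

(* Indices start at 0: a_1, ..., a_m are Var 0, ..., Var (m - 1), and x_1, ..., x_{n-m} are
   Var m, ..., Var (n - 1); g_1, ..., g_r are g 0, ..., g (r - 1), of degrees e 0, ..., e (r - 1). *)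
theorem mainTheorem14:
  fixes m n r k :: nat
    and W :: "nat \<Rightarrow> int"
    and P P0 Ph :: "'a::field mpoly ring"
    and g ht :: "nat \<Rightarrow> 'a mpoly"
    and h :: "nat \<Rightarrow> nat \<Rightarrow> 'a mpoly"
    and e w :: "nat \<Rightarrow> int"
    and Xp I :: "'a mpoly set"
    and D :: "int set"
    and \<alpha> \<gamma> sx sg :: "int \<Rightarrow> nat"
    and Ad :: "int \<Rightarrow> 'a mpoly mat"
    and \<nu> :: "nat \<Rightarrow> nat"
    and Vh :: "nat set"
  assumes "m < n"
    and P: "P = mpoly_ring {..<n}" and P0: "P0 = mpoly_ring {..<m}"
    \<comment> \<open>the grading\<close>
    and "\<forall>v<n. 0 \<le> W v"
    and "graded_part P W 0 = carrier P0"
    and "0 < W m" and "mono_on {m..<n} W"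
    \<comment> \<open>the ideals\<close>
    and Xp: "Xp = genideal P (Var ` {m..<n})"
    and g: "\<forall>i<r. 0 < e i \<and> g i \<in> graded_part P W (e i)"
    and I: "I = genideal P (g ` {..<r})"
    \<comment> \<open>the linear parts of the first \<open>k\<close> generators\<close>
    and "1 \<le> k" and "k \<le> min r (n - m)"
    and "\<forall>i<k. \<forall>j<n - m. h i j \<in> carrier P0"
    and "\<forall>i<k. ht i \<in> ideal_prod P Xp Xp"
    and "\<forall>i<k. g i = (\<Sum>j<n - m. h i j * Var (m + j)) + ht i"
    and "unimodular P0 (mat k (n - m) (\<lambda>(i, j). h i j))"
    and "mono_on {..<k} e"
    \<comment> \<open>notation for the construction\<close>
    and w: "w = (\<lambda>j. W (m + j))"
    and D: "D = w ` {..<n - m}"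
    and \<alpha>: "\<alpha> = block_start w (n - m)" and sx: "sx = block_size w (n - m)"
    and \<gamma>: "\<gamma> = block_start e k" and sg: "sg = block_size e k"
    and Ad: "Ad = (\<lambda>d. mat (sg d) (sx d) (\<lambda>(i, j). h (\<gamma> d + i) (\<alpha> d + j)))"
    and \<nu>: "\<nu> = (\<lambda>i. \<alpha> (e i) + i - \<gamma> (e i))"
    and Vh: "Vh = {..<n} - (\<lambda>i. m + \<nu> i) ` {..<k}"
    and Ph: "Ph = mpoly_ring Vh"
  shows
    "(\<forall>i<k. e i \<in> D \<and> \<nu> i < n - m \<and> w (\<nu> i) = e i) \<and> inj_on \<nu> {..<k} \<and>
     (\<forall>d\<in>D. 0 < sg d \<longrightarrow>
        sg d \<le> sx d \<and> unimodular P0 (Ad d) \<and> (\<exists>B. solves_UMP P0 (Ad d) B)) \<and>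
     (\<forall>B. (\<forall>d\<in>D. if sg d = 0 then B d = 1\<^sub>m (sx d) else solves_UMP P0 (Ad d) (B d)) \<longrightarrow>
       (let F = map Var [0..<m] @
                concat (map (\<lambda>d. block_tuple (m + \<alpha> d) (sx d) (B d)) (sorted_list_of_set D));
            \<phi> = subst (\<lambda>v. F ! v)
        in length F = n \<and> set F \<subseteq> carrier P \<and>
           \<phi> \<in> alg_hom P Const P Const \<and> (\<forall>v<n. \<phi> (Var v) = F ! v) \<and>
           (\<exists>q qt.
              (\<forall>i<k. q i \<in> carrier P \<and> \<phi> (g i) = Var (m + \<nu> i) - q i \<and>
                     (\<forall>t\<in>Poly_Mapping.keys (q i). m + \<nu> i \<notin> Poly_Mapping.keys t)) \<and>
              (\<forall>i<k. replace_vars (\<lambda>j. m + \<nu> j) qt i (\<phi> (g i)) = Var (m + \<nu> i) - qt i) \<and>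
              (let \<psi> = replace_vars (\<lambda>j. m + \<nu> j) qt k;
                   \<theta> = \<psi> \<circ> \<phi>;
                   J = genideal Ph (\<theta> ` g ` {k..<r})
               in \<psi> \<in> alg_hom P Const Ph Const \<and>
                  (\<forall>v<m. \<psi> (Var v) = Var v) \<and>
                  (\<forall>i<k. \<psi> (Var (m + \<nu> i)) = qt i) \<and>
                  (\<forall>v\<in>Vh. \<psi> (Var v) = Var v) \<and>
                  card Vh = n - k \<and>
                  homogeneous_ideal Ph W J \<and>
                  (\<exists>\<Theta> \<in> alg_iso (P Quot I) (\<lambda>c. I +>\<^bsub>P\<^esub> Const c)
                                   (Ph Quot J) (\<lambda>c. J +>\<^bsub>Ph\<^esub> Const c).
                     \<forall>f\<in>carrier P. \<Theta> (I +>\<^bsub>P\<^esub> f) = J +>\<^bsub>Ph\<^esub> \<theta> f)))))"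
proof -
  let ?xw = "\<lambda>v. if m \<le> v then 1 else 0 :: int"
  have W_zero: "W v = 0" if "v < m" for v
  proof -
    \<comment> \<open>\<open>Var v\<close> lies in P_0, the part of degree 0.\<close>
    have "(Var v :: 'a mpoly) \<in> graded_part P W 0" using assms(5) that by (simp add: P0)
    then show ?thesis by (simp add: graded_part_def homogeneous_Var_iff)
  qed
  have W_pos: "0 < W v" if "m \<le> v" "v < n" for v
    using mono_onD[OF assms(7), of m v] that assms(1,6) by simp
  have g_vars: "vars (g i) \<subseteq> {..<n}" and homog: "homogeneous W (e i) (g i)" if "i < r" for i
    using g that by (simp_all add: graded_part_def P)
  have kr: "k \<le> r" using assms(12) by simp
  have ht: "ht i \<in> ideal_prod (mpoly_ring {..<n}) (genideal (mpoly_ring {..<n}) (Var ` {m..<n}))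
      (genideal (mpoly_ring {..<n}) (Var ` {m..<n}))" if "i < k" for i
    using assms(14) that by (simp add: P Xp)
  have inv: "\<exists>C\<in>carrier_mat (n - m) k. mat k (n - m) (\<lambda>(i, j). h i j) * C = 1\<^sub>m k"
    by (rule unimodular_imp_right_inverse[OF _ assms(16)[unfolded P0]]) simp
  interpret linear_parts m n k W g ht h e
  proof
    show "vars (h i j) \<subseteq> {..<m}" if "i < k" "j < n - m" for i j
      using assms(13) that by (simp add: P0)
    show "g i = (\<Sum>j<n - m. h i j * Var (m + j)) + ht i" if "i < k" for i
      using assms(15) that by blast
  qed (use assms(1,7,17) W_zero W_pos homog kr inv keys_ideal_prod_Var[OF ht] in auto)
  show ?thesis
    unfolding w D \<alpha> sx \<gamma> sg Ad \<nu> Vh Ph P P0 I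
  proof (intro conjI allI impI ballI, goal_cases)
    case (1 i)
    then show ?case by (rule e_in_D)
  next
    case (2 i)
    then show ?case by (rule \<nu>_eq)
  next
    case (3 i)
    then show ?case by (rule \<nu>_eq)
  next
    case 4
    show ?case by (rule \<nu>_inj)
  next
    case (5 d)
    then show ?case by (intro blocks_unimodular)
  next
    case (6 d)
    then show ?case by (intro blocks_unimodular)
  next
    case (7 d)
    then show ?case by (intro blocks_unimodular)
  next
    case (8 B)
    \<comment> \<open>The family \<open>B\<close> is given; \<open>q\<close> and \<open>qt\<close>
      of the locale are the witnesses.\<close>
    then interpret full_elimination m n k W g ht h e B r
      by unfold_locales (use kr g_vars homog in auto)
    show ?case
      unfolding Let_def F_def[symmetric] \<phi>_def[symmetric]
      using construction unfolding \<psi>_def by blast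
  qed
qed

end
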